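(* Let $p$ be a prime, $s \ge 1$, and $q=p^s$. Let $m$ and $\ell$ be positive integers. For each integer $r$ with $0 \le r \le m$, there exists a $(v^+,k_r^+,\lambda_r^+,\mu_r^+)$ partial difference set $D_r^+$ in the elementary abelian $p$-group $G=\mathbb{Z}_p^{sm(2\ell+1)}$, where \begin{align*} v^+ &= q^{m(2\ell+1)},\\ k_r^+ &= \frac{(q^m-q^{m-r})(q^{m\ell}-1)(q^{m(\ell+1)}-1)}{q^m-1} + q^{m(\ell+1)}-1,\\ \lambda_r^+ &= \frac{(q^m-q^{m-r})(q^{m(\ell+1)}-1)(q^{m(\ell+1)}-q^{m(\ell+1)-r}+q^{m-r}-1)}{(q^m-1)^2} + \frac{q^{m(\ell+2)-r}+q^{m(\ell+1)-r}-2q^{m(\ell+1)}-2q^{m-r}+2}{q^m-1},\\ \mu_r^+ &= \frac{(q^m-q^{m-r})(q^{m(\ell+1)}-1)(q^{m(\ell+1)}-q^{m(\ell+1)-r}+q^{m-r}-1)}{(q^m-1)^2}. \end{align*} Consequently, the Cayley graph $\mathrm{Cay}(G,D_r^+)$ is a $(v^+,k_r^+,\lambda_r^+,\mu_r^+)$ strongly regular graph.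
   Context: Let $G$ be an additively written finite group of order $v$. A subset $D\subseteq G$ with $|D|=k$ and $0_G\notin D$ is a $(v,k,\lambda,\mu)$ partial difference set (PDS) if the differences $g-h$ with $g,h\in D$, $g\neq h$, represent each element of $D$ exactly $\lambda$ times and each nonidentity element of $G\setminus D$ exactly $\mu$ times. For $D\subseteq G$ with $0_G\notin D$ and $D=-D$, the Cayley graph $\mathrm{Cay}(G,D)$ has vertex set $G$, with $g,h$ adjacent iff $g-h\in D$. A $(v,k,\lambda,\mu)$ strongly regular graph is a $k$-regular simple graph on $v$ vertices in which any two adjacent vertices have exactly $\lambda$ common neighbours and any two distinct non-adjacent vertices have exactly $\mu$ common neighbours. *)

theory Defs
  imports
    Complex_Main
    "HOL-Algebra.Elementary_Groups"
    "HOL-Algebra.Product_Groups"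
    "HOL-Computational_Algebra.Primes"
    "Graph_Theory.Pair_Digraph"
begin

text \<open>
  Group records are multiplicative: the difference \<open>g - h\<close> is \<open>g \<otimes> inv h\<close>,
  the element \<open>0\<close> is \<open>\<one>\<close> and \<open>-D\<close> is \<open>m_inv G ` D\<close>.
\<close>

definition Zp_power :: "nat \<Rightarrow> nat \<Rightarrow> (nat \<Rightarrow> int) monoid" where
  "Zp_power p n = product_group {..<n} (\<lambda>_. integer_mod_group p)"

definition difference_reps ::
    "('a, 'b) monoid_scheme \<Rightarrow> 'a set \<Rightarrow> 'a \<Rightarrow> ('a \<times> 'a) set" where
  "difference_reps G D x =
     {(g, h). g \<in> D \<and> h \<in> D \<and> g \<noteq> h \<and> g \<otimes>\<^bsub>G\<^esub> inv\<^bsub>G\<^esub> h = x}"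

definition partial_difference_set ::
    "('a, 'b) monoid_scheme \<Rightarrow> 'a set \<Rightarrow> nat \<Rightarrow> nat \<Rightarrow> nat \<Rightarrow> nat \<Rightarrow> bool" where
  "partial_difference_set G D v k lam mu \<longleftrightarrow>
     group G \<and> finite (carrier G) \<and> order G = v \<and>
     D \<subseteq> carrier G \<and> card D = k \<and> \<one>\<^bsub>G\<^esub> \<notin> D \<and>
     (\<forall>x \<in> D. card (difference_reps G D x) = lam) \<and>
     (\<forall>x \<in> carrier G - D - {\<one>\<^bsub>G\<^esub>}. card (difference_reps G D x) = mu)"

definition cayley_graph ::
    "('a, 'b) monoid_scheme \<Rightarrow> 'a set \<Rightarrow> 'a pair_pre_digraph" where
  "cayley_graph G D =
     \<lparr> pverts = carrier G,
       parcs = {(g, h). g \<in> carrier G \<and> h \<in> carrier G \<and> g \<otimes>\<^bsub>G\<^esub> inv\<^bsub>G\<^esub> h \<in> D} \<rparr>"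

definition neighbours :: "'a pair_pre_digraph \<Rightarrow> 'a \<Rightarrow> 'a set" where
  "neighbours \<Gamma> x = {y \<in> pverts \<Gamma>. (x, y) \<in> parcs \<Gamma>}"

text \<open>
  The locale predicate \<^const>\<open>pair_graph\<close> says that the arcs form a symmetric irreflexive
  relation on a finite vertex set, i.e. that \<open>\<Gamma>\<close> is a finite simple graph.
\<close>

definition strongly_regular_graph ::
    "'a pair_pre_digraph \<Rightarrow> nat \<Rightarrow> nat \<Rightarrow> nat \<Rightarrow> nat \<Rightarrow> bool" where
  "strongly_regular_graph \<Gamma> v k lam mu \<longleftrightarrow>
     pair_graph \<Gamma> \<and> card (pverts \<Gamma>) = v \<and>
     (\<forall>x \<in> pverts \<Gamma>. card (neighbours \<Gamma> x) = k) \<and>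
     (\<forall>x \<in> pverts \<Gamma>. \<forall>y \<in> pverts \<Gamma>. (x, y) \<in> parcs \<Gamma> \<longrightarrow>
        card (neighbours \<Gamma> x \<inter> neighbours \<Gamma> y) = lam) \<and>
     (\<forall>x \<in> pverts \<Gamma>. \<forall>y \<in> pverts \<Gamma>. x \<noteq> y \<and> (x, y) \<notin> parcs \<Gamma> \<longrightarrow>
        card (neighbours \<Gamma> x \<inter> neighbours \<Gamma> y) = mu)"

end

theory Submission
  imports Defs "HOL-Computational_Algebra.Fundamental_Theorem_Algebra" "HOL-Number_Theory.Residues"
begin

text \<open>
  Put \<open>Q = q ^ m\<close> and let \<open>H\<close> be an additive subgroup of order \<open>q ^ (m - r)\<close> of the field with
  \<open>Q\<close> elements. In the additive group of the product of the fields of orders \<open>Q ^ (l + 1)\<close> and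
  \<open>Q ^ l\<close>, the set \<open>D\<close> consists of the pairs \<open>(x, y)\<close> with \<open>N x \<notin> H * N y\<close>, where \<open>N\<close> denotes
  the norms to the field with \<open>Q\<close> elements. The contribution of \<open>N x = h * N y\<close> to a character
  sum over the complement of \<open>D\<close> is evaluated by the Hasse-Davenport relation: a sum over \<open>x\<close> of
  prescribed norm becomes, up to sign, a sum over pairs \<open>(z, c)\<close> from the fields of orders \<open>Q ^ l\<close>
  and \<open>Q\<close>, and orthogonality in \<open>z\<close> leaves a constant plus \<open>- Q ^ l\<close> times an additive character
  at a multiple of \<open>h\<close>. Summing over the subgroup \<open>H\<close> gives two values only, which is
  equivalent to the partial difference set property.

  All finite fields of characteristic \<open>p\<close> are found inside the residue field of a valuation ring of
  the complex numbers that does not contain \<open>1 / p\<close>.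
\<close>

hide_const (open) up_ring.coeff up_ring.monom module.smult

section \<open>A valuation ring above p\<close>

text \<open>The degrees l + 1 and l are consecutive because Hasse-Davenport makes the Gauss sums of
  the lifts of a multiplicative character, up to sign, the powers of one base Gauss sum. The
  quotient of two consecutive powers is a single Gauss sum over the field with Q elements, and this
  is the multiplicative Fourier transform of an additive character. Multiplicative characters
  themselves are avoided: after Fourier inversion the relation says that two counts with prescribed
  norm and trace have a sum that does not depend on the trace, which follows by counting monic
  polynomials through their roots.

  The obstacle is that this count needs many finite fields at once, with their inclusions,
  conjugates and splitting polynomials. The complex numbers supply the roots, and roots of unity
  give exact multiplicative representatives. The price is that addition is only available modulo
  \<open>M\<close>: additive statements are congruences \<open>\<doteq>\<close>, and the sum of two
  field elements is \<open>rp (x + y)\<close>.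

  Characters that are trivial on one of the two factors produce no third value because (Q ^ (l + 1)
  - 1) / (Q - 1) and (Q ^ l - 1) / (Q - 1) differ by exactly Q ^ l.\<close>

definition csubring :: "complex set \<Rightarrow> bool" where
  "csubring A \<longleftrightarrow> 1 \<in> A \<and> (\<forall>x\<in>A. \<forall>y\<in>A. x - y \<in> A \<and> x * y \<in> A)"

lemma csubring_closed:
  assumes "csubring A"
  shows "1 \<in> A" and "0 \<in> A"
    and "x \<in> A \<Longrightarrow> y \<in> A \<Longrightarrow> x - y \<in> A"
    and "x \<in> A \<Longrightarrow> y \<in> A \<Longrightarrow> x + y \<in> A"
    and "x \<in> A \<Longrightarrow> - x \<in> A"
    and "x \<in> A \<Longrightarrow> y \<in> A \<Longrightarrow> x * y \<in> A"
    and "x \<in> A \<Longrightarrow> x ^ n \<in> A"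
    and "(\<And>i. i \<in> I \<Longrightarrow> f i \<in> A) \<Longrightarrow> sum f I \<in> A"
proof -
  show one: "1 \<in> A" using assms by (simp add: csubring_def)
  have diff: "x - y \<in> A" if "x \<in> A" "y \<in> A" for x y
    using assms that by (simp add: csubring_def)
  have mul: "x * y \<in> A" if "x \<in> A" "y \<in> A" for x y
    using assms that by (simp add: csubring_def)
  show zero: "0 \<in> A" using diff[OF one one] by simp
  have um: "- x \<in> A" if "x \<in> A" for x using diff[OF zero that] by simp
  have add: "x + y \<in> A" if "x \<in> A" "y \<in> A" for x y
    using diff[OF that(1) um[OF that(2)]] by simp
  show "x \<in> A \<Longrightarrow> y \<in> A \<Longrightarrow> x - y \<in> A" "x \<in> A \<Longrightarrow> y \<in> A \<Longrightarrow> x + y \<in> A"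
    "x \<in> A \<Longrightarrow> - x \<in> A" "x \<in> A \<Longrightarrow> y \<in> A \<Longrightarrow> x * y \<in> A"
    by (auto intro: diff add um mul)
  show "x \<in> A \<Longrightarrow> x ^ n \<in> A" by (induction n) (auto intro: one mul)
  show "(\<And>i. i \<in> I \<Longrightarrow> f i \<in> A) \<Longrightarrow> sum f I \<in> A"
    by (induction I rule: infinite_finite_induct) (auto intro: zero add)
qed

definition adjoin :: "complex set \<Rightarrow> complex \<Rightarrow> complex set" where
  "adjoin A x = {poly f x |f. \<forall>i. coeff f i \<in> A}"

lemma csubring_adjoin:
  assumes A: "csubring A"
  shows "csubring (adjoin A x)" and "A \<subseteq> adjoin A x" and "x \<in> adjoin A x"
proof -
  note cl = csubring_closed[OF A]
  show "csubring (adjoin A x)"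
    unfolding csubring_def
  proof (intro conjI ballI)
    show "1 \<in> adjoin A x" unfolding adjoin_def
      by (intro CollectI exI[of _ 1]) (auto simp: cl)
    fix y z assume "y \<in> adjoin A x" "z \<in> adjoin A x"
    then obtain f g where f: "y = poly f x" "\<forall>i. coeff f i \<in> A" and g: "z = poly g x" "\<forall>i. coeff g i \<in> A"
      by (auto simp: adjoin_def)
    have "y - z = poly (f - g) x" "\<forall>i. coeff (f - g) i \<in> A" using f g by (auto intro: cl)
    then show "y - z \<in> adjoin A x" unfolding adjoin_def by blast
    have "y * z = poly (f * g) x" "\<forall>i. coeff (f * g) i \<in> A"
      using f g by (auto simp: coeff_mult intro!: cl)
    then show "y * z \<in> adjoin A x" unfolding adjoin_def by blast
  qed
  show "A \<subseteq> adjoin A x"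
  proof
    fix a assume a: "a \<in> A"
    have "a = poly [:a:] x" "\<forall>i. coeff [:a:] i \<in> A" using a by (auto simp: coeff_pCons cl split: nat.split)
    then show "a \<in> adjoin A x" unfolding adjoin_def by blast
  qed
  have "x = poly [:0, 1:] x" "\<forall>i. coeff [:0, 1 :: complex:] i \<in> A" by (auto simp: coeff_pCons cl split: nat.split)
  then show "x \<in> adjoin A x" unfolding adjoin_def by blast
qed

text \<open>Zorn's lemma, started at the integers, where p is not invertible. Omitting the single
  element 1 / p is preserved under unions of chains.\<close>

lemma exists_maximal_csubring:
  assumes "prime (p :: nat)"
  obtains A where "csubring A" "inverse (of_nat p) \<notin> A"
    "\<And>B. csubring B \<Longrightarrow> A \<subseteq> B \<Longrightarrow> inverse (of_nat p) \<notin> B \<Longrightarrow> B = A"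
proof -
  define S where "S = {A. csubring A \<and> inverse (of_nat p) \<notin> A}"
  have "inverse (of_nat p) \<notin> (\<int> :: complex set)"
  proof
    assume "inverse (of_nat p) \<in> (\<int> :: complex set)"
    then obtain z where z: "inverse (of_nat p) = (of_int z :: complex)" by (auto elim: Ints_cases)
    have "(of_nat p :: complex) \<noteq> 0" using assms by auto
    then have "of_int z * of_nat p = (1 :: complex)" using z by (metis left_inverse)
    then have "of_int (z * int p) = (of_int 1 :: complex)" by simp
    then have "z * int p = 1" by (simp only: of_int_eq_iff)
    then have "int p dvd 1" by (metis dvd_triv_right)
    then show False using assms by (simp add: prime_gt_1_nat)
  qed
  then have "\<int> \<in> S" by (simp add: S_def csubring_def)
  then have ne: "S \<noteq> {}" by blast
  have "\<exists>M\<in>S. \<forall>X\<in>S. M \<subseteq> X \<longrightarrow> X = M"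
  proof (rule subset_Zorn_nonempty[OF ne])
    fix C assume C: "C \<noteq> {}" "subset.chain S C"
    have "csubring (\<Union>C)" unfolding csubring_def
    proof (intro conjI ballI)
      show "1 \<in> \<Union>C" using C by (auto simp: S_def csubring_def subset.chain_def)
      fix x y assume "x \<in> \<Union>C" "y \<in> \<Union>C"
      then obtain B B' where B: "x \<in> B" "B \<in> C" "y \<in> B'" "B' \<in> C" by blast
      then have "B \<subseteq> B' \<or> B' \<subseteq> B" using C by (auto simp: subset.chain_def)
      then obtain E where E: "E \<in> C" "x \<in> E" "y \<in> E" using B by blast
      then have "csubring E" using C by (auto simp: S_def subset.chain_def)
      then have "x - y \<in> E" "x * y \<in> E" using E by (auto simp: csubring_def)
      then show "x - y \<in> \<Union>C" "x * y \<in> \<Union>C" using E by blast+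
    qed
    moreover have "inverse (of_nat p) \<notin> \<Union>C" using C by (auto simp: S_def subset.chain_def)
    ultimately show "\<Union>C \<in> S" by (simp add: S_def)
  qed
  then show ?thesis using that by (auto simp: S_def)
qed

text \<open>
  A subring that is maximal among those without \<open>1 / p\<close> is a valuation ring: if neither \<open>x\<close> nor
  \<open>1 / x\<close> belonged to it, a polynomial expression of \<open>1 / p\<close> in \<open>1 / x\<close> would give
  a monic relation for \<open>x\<close> that shortens a shortest expression of \<open>1 / p\<close> in \<open>x\<close>.
\<close>

lemma maximal_csubring_valuation:
  fixes p :: nat
  assumes p: "prime p" and A: "csubring A" and nA: "inverse (of_nat p) \<notin> A"
    and max: "\<And>B. csubring B \<Longrightarrow> A \<subseteq> B \<Longrightarrow> inverse (of_nat p) \<notin> B \<Longrightarrow> B = A"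
  shows "x \<in> A \<or> inverse x \<in> A"
proof (rule ccontr)
  assume neg: "\<not> (x \<in> A \<or> inverse x \<in> A)"
  note cl = csubring_closed[OF A]
  define P where "P = (of_nat p :: complex)"
  have P0: "P \<noteq> 0" using p by (auto simp: P_def)
  have PA: "P \<in> A" unfolding P_def by (induction p) (auto intro: cl)
  have x0: "x \<noteq> 0" using neg cl(2) by auto
  have ex: "inverse P \<in> adjoin A y" if "y \<notin> A" for y
    using max[of "adjoin A y"] csubring_adjoin[OF A, of y] that by (auto simp: P_def)
  \<comment> \<open>Elements congruent to 1 modulo \<open>P\<close> are units: were 1 / u outside
    \<open>A\<close>, then 1 / P would be a polynomial in 1 / u, so that u ^ n = P a; but also u ^ n
    = 1 - P b, whence 1 / P = a + b would lie in \<open>A\<close>.\<close>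
  have unit: "inverse (1 - P * c) \<in> A" if c: "c \<in> A" for c
  proof (rule ccontr)
    define u where "u = 1 - P * c"
    have uA: "u \<in> A" using c PA by (auto simp: u_def intro: cl)
    have u0: "u \<noteq> 0"
    proof
      assume "u = 0"
      then have "c = inverse P" using P0 by (simp add: u_def field_simps)
      then show False using c nA by (simp add: P_def)
    qed
    assume "inverse (1 - P * c) \<notin> A"
    then obtain f where f: "inverse P = poly f (inverse u)" "\<forall>i. coeff f i \<in> A"
      using ex[of "inverse u"] by (auto simp: adjoin_def u_def)
    define n where "n = degree f"
    define a where "a = u ^ n * poly f (inverse u)"
    have "a = (\<Sum>i\<le>n. coeff f i * u ^ (n - i))"
      unfolding a_def poly_altdef n_def sum_distrib_left
      by (intro sum.cong refl) (use u0 in \<open>auto simp: power_diff field_simps power_inverse\<close>)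
    then have aA: "a \<in> A" using f uA by (auto intro!: cl)
    have un: "u ^ n = P * a" using f P0 by (simp add: a_def field_simps)
    have "\<exists>b\<in>A. u ^ k = 1 - P * b" for k
    proof (induction k)
      case 0 show ?case using cl by (intro bexI[of _ 0]) auto
    next
      case (Suc k)
      then obtain b where b: "b \<in> A" "u ^ k = 1 - P * b" by blast
      have "u ^ Suc k = u * (1 - P * b)" using b by simp
      also have "\<dots> = 1 - P * (b + c - P * b * c)" by (simp add: u_def algebra_simps)
      finally have "u ^ Suc k = 1 - P * (b + c - P * b * c)" .
      moreover have "b + c - P * b * c \<in> A" using b c PA by (auto intro!: cl)
      ultimately show ?case by blast
    qed
    then obtain b where b: "b \<in> A" "u ^ n = 1 - P * b" by blast
    then have "P * (a + b) = 1" using un by (simp add: algebra_simps)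
    then have "inverse P = a + b" using P0 by (simp add: field_simps)
    then show False using aA b nA by (auto simp: P_def cl)
  qed
  define R where "R = (\<lambda>y f. inverse P = poly f y \<and> (\<forall>i. coeff f i \<in> A))"
  define dg where "dg = (\<lambda>y. LEAST n. \<exists>f. R y f \<and> degree f = n)"
  have dgE: "\<exists>f. R y f \<and> degree f = dg y" if "y \<notin> A" for y
  proof -
    have "\<exists>n f. R y f \<and> degree f = n" using ex[OF that] by (auto simp: R_def adjoin_def)
    then show ?thesis unfolding dg_def by (rule LeastI_ex)
  qed
  have dgle: "dg y \<le> degree f" if "R y f" for y f
    unfolding dg_def by (rule Least_le) (use that in blast)
  \<comment> \<open>The inequality between the two minimal degrees costs nothing, since x and 1 / x
    can be exchanged at the end.\<close>
  have main: False if yA: "y \<notin> A" and zA: "inverse y \<notin> A" and le: "dg (inverse y) \<le> dg y" for y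
  proof -
    have y0: "y \<noteq> 0" using yA cl by auto
    obtain f where f: "R y f" "degree f = dg y" using dgE[OF yA] by blast
    obtain g where g: "R (inverse y) g" "degree g = dg (inverse y)" using dgE[OF zA] by blast
    define n m where "n = degree f" and "m = degree g"
    have mn: "m \<le> n" using f g le by (simp add: n_def m_def)
    have fA: "coeff f i \<in> A" for i using f by (simp add: R_def)
    have gA: "coeff g i \<in> A" for i using g by (simp add: R_def)
    have n0: "n > 0"
    proof (rule ccontr)
      assume "\<not> n > 0"
      then have "inverse P = coeff f 0" using f by (simp add: R_def poly_altdef n_def)
      then show False using fA nA by (simp add: P_def)
    qed
    have m0: "m > 0"
    proof (rule ccontr)
      assume "\<not> m > 0"
      then have "inverse P = coeff g 0" using g by (simp add: R_def poly_altdef m_def)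
      then show False using gA nA by (simp add: P_def)
    qed
    define u where "u = 1 - P * coeff g 0"
    have ui: "inverse u \<in> A" unfolding u_def by (rule unit) (rule gA)
    have u0: "u \<noteq> 0"
    proof
      assume "u = 0"
      then have "coeff g 0 = inverse P" using P0 by (simp add: u_def field_simps)
      then show False using gA nA by (metis P_def)
    qed
    have "inverse P = (\<Sum>i\<le>m. coeff g i * inverse y ^ i)"
      using g by (simp add: R_def poly_altdef m_def)
    also have "\<dots> = coeff g 0 + (\<Sum>i\<in>{1..m}. coeff g i * inverse y ^ i)"
    proof -
      have "{..m} = insert 0 {1..m}" by auto
      then show ?thesis by simp
    qed
    finally have "P * (inverse P - coeff g 0) = P * (\<Sum>i\<in>{1..m}. coeff g i * inverse y ^ i)" by simp
    then have ueq: "u = (\<Sum>i\<in>{1..m}. P * coeff g i * inverse y ^ i)"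
      using P0 by (simp add: u_def algebra_simps sum_distrib_left)
    \<comment> \<open>Multiplying the relation \<open>ueq\<close> by inverse u * y ^ n turns it into
      y ^ n = h(y). The sum starts at i = 1, so h has degree below n; \<open>m \<le> n\<close> keeps
      the exponents n - i from being truncated.\<close>
    define h where "h = (\<Sum>i\<in>{1..m}. monom (inverse u * P * coeff g i) (n - i))"
    have hA: "coeff h i \<in> A" for i
      unfolding h_def coeff_sum by (auto simp: intro!: cl ui PA gA)
    have hy: "poly h y = y ^ n"
    proof -
      have "poly h y = (\<Sum>i\<in>{1..m}. inverse u * P * coeff g i * y ^ (n - i))"
        by (simp add: h_def poly_sum poly_monom)
      also have "\<dots> = (\<Sum>i\<in>{1..m}. inverse u * y ^ n * (P * coeff g i * inverse y ^ i))"
        by (intro sum.cong refl) (use y0 mn in \<open>auto simp: power_diff field_simps power_inverse\<close>)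
      also have "\<dots> = inverse u * y ^ n * u" by (subst (3) ueq) (simp add: sum_distrib_left)
      finally show ?thesis using u0 by simp
    qed
    have dh: "degree h \<le> n - 1" unfolding h_def
      by (rule degree_sum_le) (auto intro!: order.trans[OF degree_monom_le])
    \<comment> \<open>The leading term of f is traded for a multiple of h, which lowers the minimal
      degree.\<close>
    define f' where "f' = (f - monom (coeff f n) n) + smult (coeff f n) h"
    have "poly f' y = poly f y" using hy by (simp add: f'_def poly_monom)
    moreover have "coeff f' i \<in> A" for i unfolding f'_def
      by (auto intro!: cl fA hA)
    ultimately have "R y f'" using f by (simp add: R_def)
    moreover have "degree f' \<le> n - 1" unfolding f'_def
    proof (rule degree_add_le)
      show "degree (smult (coeff f n) h) \<le> n - 1" using dh by simp
      show "degree (f - monom (coeff f n) n) \<le> n - 1"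
      proof (rule degree_le, intro allI impI)
        fix i assume "n - 1 < i"
        then have "n \<le> i" by simp
        then show "coeff (f - monom (coeff f n) n) i = 0"
          by (cases "i = n") (auto simp: n_def coeff_eq_0)
      qed
    qed
    ultimately have "dg y \<le> n - 1" using dgle by (meson order.trans)
    then show False using f n0 by (simp add: n_def)
  qed
  show False
    using main[of x] main[of "inverse x"] neg by (cases "dg (inverse x) \<le> dg x") auto
qed

text \<open>
  Integral closedness of \<open>A\<close> in the complex numbers makes the residue field of \<open>M\<close>
  algebraically closed.
\<close>

locale residue =
  fixes A M :: "complex set" and p :: nat
  assumes prime_p: "prime p"
    and subring: "csubring A"
    and M_subset: "M \<subseteq> A"
    and M_diff: "x \<in> M \<Longrightarrow> y \<in> M \<Longrightarrow> x - y \<in> M"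
    and M_mult: "x \<in> A \<Longrightarrow> y \<in> M \<Longrightarrow> x * y \<in> M"
    and M_one: "1 \<notin> M"
    and M_prime: "x \<in> A \<Longrightarrow> y \<in> A \<Longrightarrow> x * y \<in> M \<Longrightarrow> x \<in> M \<or> y \<in> M"
    and p_in_M: "of_nat p \<in> M"
    and integrally_closed:
      "lead_coeff f = 1 \<Longrightarrow> (\<And>i. coeff f i \<in> A) \<Longrightarrow> poly f x = 0 \<Longrightarrow> x \<in> A"

text \<open>In a valuation ring the non-units form the maximal ideal: one of x / y and y / x lies in
  \<open>A\<close>, so x - y is an \<open>A\<close>-multiple of y or of x. For integral closedness,
  a root x outside \<open>A\<close> has 1 / x in \<open>A\<close>, and dividing its monic equation
  by x ^ (n - 1) writes x as a polynomial in 1 / x.\<close>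

lemma exists_residue:
  assumes p: "prime (p :: nat)"
  obtains A M where "residue A M p"
proof -
  obtain A where A: "csubring A" and nA: "inverse (of_nat p) \<notin> A"
    and max: "\<And>B. csubring B \<Longrightarrow> A \<subseteq> B \<Longrightarrow> inverse (of_nat p) \<notin> B \<Longrightarrow> B = A"
    using exists_maximal_csubring[OF p] by metis
  have val: "x \<in> A \<or> inverse x \<in> A" for x
    by (rule maximal_csubring_valuation[OF p A nA max])
  note cl = csubring_closed[OF A]
  \<comment> \<open>\<open>inverse 0\<close> is 0 and lies in \<open>A\<close>, so 0 has to be added
    to the non-units separately.\<close>
  define M where "M = {x \<in> A. x = 0 \<or> inverse x \<notin> A}"
  have unit: "inverse x \<in> A" if "x \<in> A" "y \<in> A" "x * y \<notin> M" for x y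
  proof -
    have "x * y \<in> A" using that by (auto intro: cl)
    then have xy: "x * y \<noteq> 0" "inverse (x * y) \<in> A" using that by (auto simp: M_def)
    have "y * inverse (x * y) = inverse x" using xy by (simp add: field_simps)
    then show ?thesis using cl(6)[OF that(2) xy(2)] by metis
  qed
  have mult: "x * y \<in> M" if "x \<in> A" "y \<in> M" for x y
  proof (rule ccontr)
    assume "x * y \<notin> M"
    then have "inverse y \<in> A" "y \<noteq> 0" using unit[of y x] that cl
      by (auto simp: M_def mult.commute)
    then show False using that by (auto simp: M_def)
  qed
  have um: "- x \<in> M" if "x \<in> M" for x
    using mult[of "- 1" x] that cl by auto
  have dif: "x - y \<in> M" if xy: "x \<in> M" "y \<in> M" for x y
  proof (cases "x = 0 \<or> y = 0")
    case True then show ?thesis using xy um by auto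
  next
    case False
    have "x * inverse y \<in> A \<or> y * inverse x \<in> A" using val[of "x * inverse y"] by (simp add: mult.commute)
    then show ?thesis
    proof
      assume "x * inverse y \<in> A"
      then have "(x * inverse y - 1) * y \<in> M" using xy cl by (intro mult) auto
      moreover have "(x * inverse y - 1) * y = x - y" using False by (simp add: field_simps)
      ultimately show ?thesis by simp
    next
      assume "y * inverse x \<in> A"
      then have "(1 - y * inverse x) * x \<in> M" using xy cl by (intro mult) auto
      moreover have "(1 - y * inverse x) * x = x - y" using False by (simp add: field_simps)
      ultimately show ?thesis by simp
    qed
  qed
  have pA: "of_nat p \<in> A" by (induction p) (auto intro: cl)
  have "residue A M p"
  proof
    show "prime p" "csubring A" by fact+
    show "M \<subseteq> A" by (auto simp: M_def)
    show "x - y \<in> M" if "x \<in> M" "y \<in> M" for x y using dif that .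
    show "x * y \<in> M" if "x \<in> A" "y \<in> M" for x y using mult that .
    show "1 \<notin> M" using cl by (simp add: M_def)
    show "of_nat p \<in> M" using pA nA by (simp add: M_def)
    show "x \<in> M \<or> y \<in> M" if "x \<in> A" "y \<in> A" "x * y \<in> M" for x y
    proof (rule ccontr)
      assume "\<not> (x \<in> M \<or> y \<in> M)"
      then have "x \<noteq> 0" "y \<noteq> 0" "inverse x \<in> A" "inverse y \<in> A" using that by (auto simp: M_def)
      then have "inverse (x * y) \<in> A" "x * y \<noteq> 0" by (auto intro: cl)
      then show False using that by (auto simp: M_def)
    qed
    show "x \<in> A" if f: "lead_coeff f = 1" "\<And>i. coeff f i \<in> A" "poly f x = 0" for f x
    proof (rule ccontr)
      assume xA: "x \<notin> A"
      then have iA: "inverse x \<in> A" and x0: "x \<noteq> 0" using val cl by auto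
      define n where "n = degree f"
      have n0: "n > 0"
      proof (rule ccontr)
        assume "\<not> n > 0"
        then have "poly f x = coeff f 0" by (simp add: poly_altdef n_def)
        then show False using f \<open>\<not> n > 0\<close> by (simp add: n_def)
      qed
      have "0 = (\<Sum>i\<le>n. coeff f i * x ^ i)" using f by (simp add: poly_altdef n_def)
      also have "{..n} = insert n {..<n}" by auto
      also have "(\<Sum>i\<in>insert n {..<n}. coeff f i * x ^ i) = x ^ n + (\<Sum>i<n. coeff f i * x ^ i)"
        using f by (simp add: n_def)
      finally have "x ^ n = - (\<Sum>i<n. coeff f i * x ^ i)" by (simp add: add_eq_0_iff2)
      then have "x ^ n * inverse x ^ (n - 1) = - (\<Sum>i<n. coeff f i * x ^ i) * inverse x ^ (n - 1)"
        by simp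
      also have "x ^ n * inverse x ^ (n - 1) = x"
        using n0 x0 by (cases n) (auto simp: field_simps power_inverse)
      also have "- (\<Sum>i<n. coeff f i * x ^ i) * inverse x ^ (n - 1)
        = - (\<Sum>i<n. coeff f i * inverse x ^ (n - 1 - i))"
      proof -
        have "coeff f i * x ^ i * inverse x ^ (n - 1) = coeff f i * inverse x ^ (n - 1 - i)" if "i < n" for i
        proof -
          have "n - 1 = i + (n - 1 - i)" using that by simp
          then have "inverse x ^ (n - 1) = inverse x ^ i * inverse x ^ (n - 1 - i)" by (metis power_add)
          then show ?thesis using x0 by (simp add: field_simps power_inverse)
        qed
        then have "(\<Sum>i<n. coeff f i * x ^ i * inverse x ^ (n - 1)) = (\<Sum>i<n. coeff f i * inverse x ^ (n - 1 - i))"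
          by (intro sum.cong refl) (simp only: lessThan_iff)
        then show ?thesis by (simp only: mult_minus_left sum_distrib_right)
      qed
      also have "\<dots> \<in> A" using f iA by (auto intro!: cl)
      finally show False using xA by simp
    qed
  qed
  then show ?thesis using that by blast
qed

section \<open>Residue classes and finite fields\<close>

context residue
begin

lemmas A_closed [simp, intro] = csubring_closed[OF subring]

text \<open>Membership in \<open>A\<close> is part of the relation, so that congruences can be
  multiplied and chained without side conditions.\<close>

definition cg :: "complex \<Rightarrow> complex \<Rightarrow> bool" (infix "\<doteq>" 50) where
  "x \<doteq> y \<longleftrightarrow> x \<in> A \<and> y \<in> A \<and> x - y \<in> M"

lemma M_closed:
  shows "0 \<in> M" and "x \<in> M \<Longrightarrow> - x \<in> M" and "x \<in> M \<Longrightarrow> y \<in> M \<Longrightarrow> x + y \<in> M"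
proof -
  have z: "0 \<in> M" using M_diff[OF p_in_M p_in_M] by simp
  have um: "- x \<in> M" if "x \<in> M" for x using M_diff[OF z that] by simp
  show "0 \<in> M" "x \<in> M \<Longrightarrow> - x \<in> M" using z um by auto
  show "x \<in> M \<Longrightarrow> y \<in> M \<Longrightarrow> x + y \<in> M" using M_diff[of x "- y"] um by simp
qed

lemma cg_refl [simp]: "x \<in> A \<Longrightarrow> x \<doteq> x"
  by (simp add: cg_def M_closed)

lemma cg_sym: "x \<doteq> y \<Longrightarrow> y \<doteq> x"
  using M_closed(2)[of "x - y"] by (simp add: cg_def)

lemma cg_trans [trans]: "x \<doteq> y \<Longrightarrow> y \<doteq> z \<Longrightarrow> x \<doteq> z"
  using M_closed(3)[of "x - y" "y - z"] by (simp add: cg_def)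

lemma cg_A: "x \<doteq> y \<Longrightarrow> x \<in> A" "x \<doteq> y \<Longrightarrow> y \<in> A"
  by (simp_all add: cg_def)

lemma cg_0_iff: "x \<doteq> 0 \<longleftrightarrow> x \<in> M"
  using M_subset by (auto simp: cg_def)

lemma cg_add: "x \<doteq> y \<Longrightarrow> u \<doteq> v \<Longrightarrow> x + u \<doteq> y + v"
  using M_closed(3)[of "x - y" "u - v"] by (simp add: cg_def algebra_simps)

lemma cg_minus: "x \<doteq> y \<Longrightarrow> - x \<doteq> - y"
  using M_closed(2)[of "x - y"] by (simp add: cg_def)

lemma cg_diff: "x \<doteq> y \<Longrightarrow> u \<doteq> v \<Longrightarrow> x - u \<doteq> y - v"
  using cg_add[of x y "- u" "- v"] cg_minus[of u v] by simp

lemma cg_mult: "x \<doteq> y \<Longrightarrow> u \<doteq> v \<Longrightarrow> x * u \<doteq> y * v"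
proof -
  assume *: "x \<doteq> y" "u \<doteq> v"
  have "u * (x - y) + y * (u - v) \<in> M" using * by (intro M_closed M_mult) (auto simp: cg_def)
  then show ?thesis using * by (simp add: cg_def algebra_simps)
qed

lemma cg_power: "x \<doteq> y \<Longrightarrow> x ^ n \<doteq> y ^ n"
  by (induction n) (auto intro: cg_mult)

lemma cg_sum: "(\<And>i. i \<in> I \<Longrightarrow> f i \<doteq> g i) \<Longrightarrow> sum f I \<doteq> sum g I"
  by (induction I rule: infinite_finite_induct) (auto intro: cg_add)

lemma cg_diff_iff: "x \<in> A \<Longrightarrow> y \<in> A \<Longrightarrow> x - y \<doteq> 0 \<longleftrightarrow> x \<doteq> y"
  by (simp add: cg_def)

lemma cg_mult_0_iff: "x \<in> A \<Longrightarrow> y \<in> A \<Longrightarrow> x * y \<doteq> 0 \<longleftrightarrow> x \<doteq> 0 \<or> y \<doteq> 0"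
  using M_prime[of x y] M_mult[of x y] M_mult[of y x] by (auto simp: cg_0_iff mult.commute)

lemma cg_mult_cancel: "c \<in> A \<Longrightarrow> \<not> c \<doteq> 0 \<Longrightarrow> x \<in> A \<Longrightarrow> y \<in> A \<Longrightarrow> c * x \<doteq> c * y \<Longrightarrow> x \<doteq> y"
  using cg_diff_iff[of "c * x" "c * y"] cg_mult_0_iff[of c "x - y"] cg_diff_iff[of x y]
  by (simp add: algebra_simps)

lemma cg_power_0_iff: "x \<in> A \<Longrightarrow> n > 0 \<Longrightarrow> x ^ n \<doteq> 0 \<longleftrightarrow> x \<doteq> 0"
proof (induction n)
  case (Suc n)
  then show ?case by (cases n) (auto simp: cg_mult_0_iff)
qed simp

lemma one_not_cg_0 [simp]: "\<not> 1 \<doteq> 0" "\<not> 0 \<doteq> 1"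
  using M_one cg_sym[of 0 1] by (auto simp: cg_0_iff)

lemma of_int_A [simp, intro]: "of_int z \<in> A"
proof -
  have nat: "of_nat n \<in> A" for n by (induction n) auto
  show ?thesis by (cases z) (auto simp: nat simp del: of_nat_Suc)
qed

lemma of_nat_A [simp, intro]: "of_nat n \<in> A"
  using of_int_A[of "int n"] by simp

text \<open>By Bezout, an integer prime to p that lay in \<open>M\<close> would put 1 into
  \<open>M\<close>. Hence the integers reduce to the field with p elements.\<close>

lemma of_int_cg_0: "of_int z \<doteq> 0 \<longleftrightarrow> int p dvd z"
proof
  assume "int p dvd z"
  then obtain k where "z = int p * k" by blast
  then show "of_int z \<doteq> 0" using M_mult[of "of_int k" "of_nat p"] p_in_M
    by (simp add: cg_0_iff mult.commute)
next
  assume z: "of_int z \<doteq> 0"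
  show "int p dvd z"
  proof (rule ccontr)
    assume "\<not> int p dvd z"
    then have "coprime (int p) z" using prime_p by (simp add: prime_imp_coprime)
    then obtain a b where "a * int p + b * z = 1" by (metis bezout_int coprime_imp_gcd_eq_1)
    then have "(of_int (a * int p + b * z) :: complex) = 1" by simp
    then have eq: "of_int a * of_nat p + of_int b * of_int z = (1 :: complex)" by simp
    have "of_int a * of_nat p + of_int b * of_int z \<doteq> of_int a * 0 + of_int b * 0"
      using z p_in_M by (intro cg_add cg_mult) (auto simp: cg_0_iff)
    then show False using eq by simp
  qed
qed

lemma of_int_cg: "of_int a \<doteq> of_int b \<longleftrightarrow> a mod int p = b mod int p"
  using of_int_cg_0[of "a - b"] cg_diff_iff[of "of_int a" "of_int b"]
  by (simp add: mod_eq_dvd_iff)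

lemma frobenius_add: "x \<in> A \<Longrightarrow> y \<in> A \<Longrightarrow> (x + y) ^ p \<doteq> x ^ p + y ^ p"
proof -
  assume xy: "x \<in> A" "y \<in> A"
  have p1: "p > 1" using prime_gt_1_nat[OF prime_p] .
  have "(x + y) ^ p = (\<Sum>k\<le>p. of_nat (p choose k) * x ^ k * y ^ (p - k))"
    by (rule binomial_ring)
  also have "\<dots> \<doteq> (\<Sum>k\<le>p. if k = 0 then y ^ p else if k = p then x ^ p else 0)"
  proof (rule cg_sum)
    fix k assume k: "k \<in> {..p}"
    have "of_nat (p choose k) * x ^ k * y ^ (p - k) \<doteq> 0" if "k \<noteq> 0" "k \<noteq> p"
    proof -
      have "p dvd p choose k" using k that prime_p by (intro dvd_choose_prime) auto
      then have "int p dvd int (p choose k)" by simp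
      then have "of_int (int (p choose k)) \<doteq> 0" by (simp only: of_int_cg_0)
      then have "of_nat (p choose k) * (x ^ k * y ^ (p - k)) \<doteq> 0 * (x ^ k * y ^ (p - k))"
        using xy by (intro cg_mult) auto
      then show ?thesis by (simp add: mult.assoc)
    qed
    then show "of_nat (p choose k) * x ^ k * y ^ (p - k)
        \<doteq> (if k = 0 then y ^ p else if k = p then x ^ p else 0)"
      using xy by auto
  qed
  also have "(\<Sum>k\<le>p. if k = 0 then y ^ p else if k = p then x ^ p else 0)
    = (\<Sum>k\<in>{0, p}. if k = 0 then y ^ p else if k = p then x ^ p else 0)"
    by (intro sum.mono_neutral_right) auto
  also have "\<dots> = x ^ p + y ^ p" using p1 by simp
  finally show ?thesis .
qed

section \<open>Frobenius powers and the finite subfields of the residue field\<close>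

definition ppow :: "nat \<Rightarrow> bool" where
  "ppow N \<longleftrightarrow> (\<exists>j>0. N = p ^ j)"

lemma ppow_p: "ppow p"
  unfolding ppow_def by (rule exI[of _ 1]) auto

lemma ppow_power: "ppow N \<Longrightarrow> n > 0 \<Longrightarrow> ppow (N ^ n)"
proof -
  assume "ppow N" "n > 0"
  then obtain j where "j > 0" "N = p ^ j" by (auto simp: ppow_def)
  then show ?thesis using \<open>n > 0\<close> unfolding ppow_def
    by (intro exI[of _ "j * n"]) (auto simp: power_mult)
qed

lemma ppow_ge_2: "ppow N \<Longrightarrow> N \<ge> 2"
proof -
  assume "ppow N"
  then obtain j where j: "j > 0" "N = p ^ j" by (auto simp: ppow_def)
  have "p \<ge> 2" using prime_p by (simp add: prime_ge_2_nat)
  also have "p = p ^ 1" by simp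
  also have "\<dots> \<le> p ^ j" using j \<open>p \<ge> 2\<close> by (intro power_increasing) auto
  finally show ?thesis using j by simp
qed

lemma ppow_cg_0: "ppow N \<Longrightarrow> of_nat N \<doteq> 0"
  using of_int_cg_0[of "int N"] by (auto simp: ppow_def)

lemma ppow_add: "ppow N \<Longrightarrow> x \<in> A \<Longrightarrow> y \<in> A \<Longrightarrow> (x + y) ^ N \<doteq> x ^ N + y ^ N"
proof -
  assume N: "ppow N" and xy: "x \<in> A" "y \<in> A"
  have "(x + y) ^ (p ^ j) \<doteq> x ^ (p ^ j) + y ^ (p ^ j)" for j
  proof (induction j)
    case 0 show ?case using xy by simp
  next
    case (Suc j)
    have "(x + y) ^ p ^ Suc j = ((x + y) ^ p ^ j) ^ p" by (simp flip: power_mult add: mult.commute)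
    also have "\<dots> \<doteq> (x ^ (p ^ j) + y ^ (p ^ j)) ^ p" by (intro cg_power Suc)
    also have "\<dots> \<doteq> (x ^ (p ^ j)) ^ p + (y ^ (p ^ j)) ^ p" using xy by (intro frobenius_add) auto
    also have "\<dots> = x ^ p ^ Suc j + y ^ p ^ Suc j" by (simp flip: power_mult add: mult.commute)
    finally show ?case .
  qed
  then show ?thesis using N by (auto simp: ppow_def)
qed

lemma ppow_diff: "ppow N \<Longrightarrow> x \<in> A \<Longrightarrow> y \<in> A \<Longrightarrow> (x - y) ^ N \<doteq> x ^ N - y ^ N"
proof -
  assume N: "ppow N" and xy: "x \<in> A" "y \<in> A"
  have "x ^ N \<doteq> (x - y) ^ N + y ^ N" using ppow_add[OF N, of "x - y" y] xy by simp
  then have "x ^ N - y ^ N \<doteq> ((x - y) ^ N + y ^ N) - y ^ N" using xy by (intro cg_diff) auto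
  then show ?thesis by (simp add: cg_sym)
qed

lemma ppow_sum:
  assumes N: "ppow N"
  shows "(\<And>i. i \<in> I \<Longrightarrow> f i \<in> A) \<Longrightarrow> (\<Sum>i\<in>I. f i) ^ N \<doteq> (\<Sum>i\<in>I. f i ^ N)"
proof (induction I rule: infinite_finite_induct)
  case (insert i I)
  have "(\<Sum>i\<in>insert i I. f i) ^ N = (f i + (\<Sum>i\<in>I. f i)) ^ N" using insert by simp
  also have "\<dots> \<doteq> f i ^ N + (\<Sum>i\<in>I. f i) ^ N" using insert by (intro ppow_add N) auto
  also have "\<dots> \<doteq> f i ^ N + (\<Sum>i\<in>I. f i ^ N)" using insert by (intro cg_add) auto
  finally show ?case using insert by simp
qed (use ppow_ge_2[OF N] in \<open>auto simp: zero_power\<close>)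

text \<open>The elements whose residue class lies in the field with \<open>N\<close> elements.\<close>

definition fx :: "nat \<Rightarrow> complex set" where
  "fx N = {w \<in> A. w ^ N \<doteq> w}"

lemma fx_A: "x \<in> fx N \<Longrightarrow> x \<in> A"
  by (simp add: fx_def)

lemma fx_closed:
  assumes N: "ppow N"
  shows "0 \<in> fx N" and "1 \<in> fx N"
    and "x \<in> fx N \<Longrightarrow> y \<in> fx N \<Longrightarrow> x + y \<in> fx N"
    and "x \<in> fx N \<Longrightarrow> y \<in> fx N \<Longrightarrow> x - y \<in> fx N"
    and "x \<in> fx N \<Longrightarrow> - x \<in> fx N"
    and "x \<in> fx N \<Longrightarrow> y \<in> fx N \<Longrightarrow> x * y \<in> fx N"
    and "x \<in> fx N \<Longrightarrow> x ^ n \<in> fx N"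
    and "(\<And>i. i \<in> I \<Longrightarrow> f i \<in> fx N) \<Longrightarrow> sum f I \<in> fx N"
    and "of_int z \<in> fx N" and "of_nat k \<in> fx N"
proof -
  have N0: "N > 0" using ppow_ge_2[OF N] by simp
  show z: "0 \<in> fx N" using N0 by (auto simp: fx_def zero_power)
  show o: "1 \<in> fx N" by (auto simp: fx_def)
  have add: "x + y \<in> fx N" if "x \<in> fx N" "y \<in> fx N" for x y
    using that cg_trans[OF ppow_add[OF N] cg_add] by (auto simp: fx_def)
  have diff: "x - y \<in> fx N" if "x \<in> fx N" "y \<in> fx N" for x y
    using that cg_trans[OF ppow_diff[OF N] cg_diff] by (auto simp: fx_def)
  have um: "- x \<in> fx N" if "x \<in> fx N" for x using diff[OF z that] by simp
  have mul: "x * y \<in> fx N" if "x \<in> fx N" "y \<in> fx N" for x y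
    using that cg_mult by (auto simp: fx_def power_mult_distrib)
  show "x \<in> fx N \<Longrightarrow> y \<in> fx N \<Longrightarrow> x + y \<in> fx N" "x \<in> fx N \<Longrightarrow> y \<in> fx N \<Longrightarrow> x - y \<in> fx N"
    "x \<in> fx N \<Longrightarrow> - x \<in> fx N" "x \<in> fx N \<Longrightarrow> y \<in> fx N \<Longrightarrow> x * y \<in> fx N"
    by (auto intro: add diff um mul)
  show "x \<in> fx N \<Longrightarrow> x ^ n \<in> fx N" by (induction n) (auto intro: mul o)
  show "(\<And>i. i \<in> I \<Longrightarrow> f i \<in> fx N) \<Longrightarrow> sum f I \<in> fx N"
    by (induction I rule: infinite_finite_induct) (auto intro: z add)
  have nat: "of_nat k \<in> fx N" for k by (induction k) (auto intro: z o add)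
  show "of_nat k \<in> fx N" by (rule nat)
  show "of_int z \<in> fx N" by (cases z) (auto intro: nat um simp del: of_nat_Suc)
qed

lemma fx_cg: "x \<in> fx N \<Longrightarrow> x \<doteq> y \<Longrightarrow> y \<in> fx N"
proof -
  assume x: "x \<in> fx N" and xy: "x \<doteq> y"
  have "y ^ N \<doteq> x ^ N" by (intro cg_power cg_sym[OF xy])
  also have "x ^ N \<doteq> x" using x by (simp add: fx_def)
  also note xy
  finally show ?thesis using cg_A(2)[OF xy] by (simp add: fx_def)
qed

lemma fx_subset: "x \<in> fx N \<Longrightarrow> x \<in> fx (N ^ k)"
proof (induction k)
  case (Suc k)
  then have "x ^ N ^ Suc k = (x ^ N ^ k) ^ N" by (simp flip: power_mult add: mult.commute)
  also have "\<dots> \<doteq> x ^ N" using Suc by (intro cg_power) (auto simp: fx_def)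
  also have "\<dots> \<doteq> x" using Suc by (auto simp: fx_def)
  finally show ?case using Suc by (auto simp: fx_def)
qed (auto simp: fx_def)

end

text \<open>
  The Teichmueller representatives of the field with \<open>N\<close> elements: multiplication, norms and
  the Frobenius map are exact on them, only sums have to be taken modulo \<open>M\<close>.
\<close>

definition gf :: "nat \<Rightarrow> complex set" where
  "gf N = {x. x ^ N = x}"

lemma gf_eq: "N > 0 \<Longrightarrow> gf N = insert 0 {x. x ^ (N - 1) = 1}"
  unfolding gf_def by (cases N) auto

lemma card_gf: "N \<ge> 2 \<Longrightarrow> card (gf N) = N" and finite_gf: "N \<ge> 2 \<Longrightarrow> finite (gf N)"
proof -
  assume N: "N \<ge> 2"
  have c: "card {x :: complex. x ^ (N - 1) = 1} = N - 1" using N by (intro card_roots_unity_eq) auto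
  then have f: "finite {x :: complex. x ^ (N - 1) = 1}" using N by (intro card_ge_0_finite) auto
  have "0 \<notin> {x :: complex. x ^ (N - 1) = 1}" using N by (auto simp: power_0_left)
  then show "card (gf N) = N" using c f N by (simp add: gf_eq)
  show "finite (gf N)" using f N by (simp add: gf_eq)
qed

lemma lead_coeff_gf_poly:
  assumes N: "N \<ge> 2"
  shows "lead_coeff (monom 1 N - monom 1 1 :: complex poly) = 1"
proof -
  have "degree (monom 1 N - monom 1 1 :: complex poly) = N"
    by (rule antisym) (use N in \<open>auto intro!: degree_diff_le le_degree simp: degree_monom_eq\<close>)
  then show ?thesis using N by simp
qed

lemma gf_closed:
  shows "N > 0 \<Longrightarrow> 0 \<in> gf N" and "1 \<in> gf N"
    and "x \<in> gf N \<Longrightarrow> y \<in> gf N \<Longrightarrow> x * y \<in> gf N"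
    and "x \<in> gf N \<Longrightarrow> inverse x \<in> gf N"
    and "x \<in> gf N \<Longrightarrow> y \<in> gf N \<Longrightarrow> x / y \<in> gf N"
    and "x \<in> gf N \<Longrightarrow> x ^ n \<in> gf N"
proof -
  show "x \<in> gf N \<Longrightarrow> x ^ n \<in> gf N"
    unfolding gf_def by (simp flip: power_mult) (simp add: mult.commute power_mult)
qed (auto simp: gf_def power_mult_distrib power_inverse power_divide)

lemma gf_subset: "x \<in> gf N \<Longrightarrow> x \<in> gf (N ^ k)"
  unfolding gf_def by (induction k) (auto simp: power_mult)

context residue
begin

lemma gf_fx: "ppow N \<Longrightarrow> gf N \<subseteq> fx N"
proof
  fix x assume N: "ppow N" and x: "x \<in> gf N"
  define f where "f = (monom 1 N - monom 1 1 :: complex poly)"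
  have "lead_coeff f = 1" unfolding f_def by (rule lead_coeff_gf_poly[OF ppow_ge_2[OF N]])
  moreover have "coeff f i \<in> A" for i by (auto simp: f_def)
  moreover have "poly f x = 0" using x by (simp add: f_def poly_monom gf_def)
  ultimately have "x \<in> A" by (rule integrally_closed)
  then show "x \<in> fx N" using x by (simp add: fx_def gf_def)
qed

lemma gf_A: "ppow N \<Longrightarrow> x \<in> gf N \<Longrightarrow> x \<in> A"
  using gf_fx fx_A by blast

lemma gf_not_cg_0:
  assumes "ppow N" "x \<in> gf N" "x \<noteq> 0"
  shows "\<not> x \<doteq> 0"
proof
  assume "x \<doteq> 0"
  then have "x * inverse x \<doteq> 0 * inverse x"
    using gf_A[OF assms(1) gf_closed(4)[OF assms(2)]] by (intro cg_mult) auto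
  then show False using assms by simp
qed

text \<open>Reduction is injective on the roots of unity of order dividing N - 1: if z is such a
  root with z \<noteq> 1 but z \<doteq> 1, then the vanishing geometric sum 1 + z + ... + z ^ (N -
  2) is congruent to N - 1, that is to -1.\<close>

lemma gf_cg_eq:
  assumes N: "ppow N" and xy: "x \<in> gf N" "y \<in> gf N" "x \<doteq> y"
  shows "x = y"
proof (rule ccontr)
  assume neq: "x \<noteq> y"
  have N2: "N \<ge> 2" using ppow_ge_2[OF N] .
  show False
  proof (cases "y = 0")
    case True
    then show False using gf_not_cg_0[OF N, of x] xy neq by simp
  next
    case False
    define z where "z = x / y"
    have z: "z \<in> gf N" "z \<noteq> 1" using xy False neq by (auto simp: z_def gf_closed)
    have iy: "inverse y \<in> A" using gf_A[OF N] xy gf_closed by blast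
    have "x * inverse y \<doteq> y * inverse y" using xy iy by (intro cg_mult) auto
    then have z1: "z \<doteq> 1" using False by (simp add: z_def field_simps)
    have z0: "z \<noteq> 0" using z1 by auto
    have "z ^ (N - 1) = 1" using z z0 N2 by (auto simp: gf_eq)
    then have "(\<Sum>i<N - 1. z ^ i) = 0" using z geometric_sum[of z "N - 1"] by simp
    moreover have "(\<Sum>i<N - 1. z ^ i) \<doteq> (\<Sum>i<N - 1. 1 ^ i)" by (intro cg_sum cg_power z1)
    ultimately have "0 \<doteq> of_nat (N - 1)" by simp
    then have "0 + 1 \<doteq> of_nat (N - 1) + 1" by (intro cg_add) auto
    also have "of_nat (N - 1) + 1 = (of_nat N :: complex)" using N2 by (simp add: of_nat_diff)
    also have "\<dots> \<doteq> 0" by (rule ppow_cg_0[OF N])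
    finally show False by simp
  qed
qed

text \<open>Zero and the roots of unity of order prime to p: exact representatives for the algebraic
  closure of the prime field.\<close>

definition T :: "complex set" where
  "T = (\<Union>N\<in>{N. ppow N}. gf N)"

lemma gf_T: "ppow N \<Longrightarrow> x \<in> gf N \<Longrightarrow> x \<in> T"
  by (auto simp: T_def)

lemma T_common:
  assumes "x \<in> T" "y \<in> T"
  obtains N where "ppow N" "x \<in> gf N" "y \<in> gf N"
proof -
  obtain i j where i: "i > 0" "x \<in> gf (p ^ i)" and j: "j > 0" "y \<in> gf (p ^ j)"
    using assms by (auto simp: T_def ppow_def)
  have "x \<in> gf (p ^ (i * j))" using gf_subset[OF i(2), of j] by (simp flip: power_mult)
  moreover have "y \<in> gf (p ^ (i * j))" using gf_subset[OF j(2), of i]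
    by (simp flip: power_mult add: mult.commute)
  moreover have "ppow (p ^ (i * j))" using i j unfolding ppow_def by (intro exI[of _ "i * j"]) auto
  ultimately show ?thesis using that by blast
qed

lemma T_A: "x \<in> T \<Longrightarrow> x \<in> A"
  using T_common[of x x] gf_A by metis

lemma T_closed:
  shows "0 \<in> T" "1 \<in> T" "x \<in> T \<Longrightarrow> y \<in> T \<Longrightarrow> x * y \<in> T" "x \<in> T \<Longrightarrow> x ^ n \<in> T"
    "x \<in> T \<Longrightarrow> inverse x \<in> T" "x \<in> T \<Longrightarrow> y \<in> T \<Longrightarrow> x / y \<in> T"
proof -
  show "0 \<in> T" "1 \<in> T" using gf_T[OF ppow_p] gf_closed prime_p by (auto simp: prime_gt_0_nat)
  show "x \<in> T \<Longrightarrow> y \<in> T \<Longrightarrow> x * y \<in> T" by (metis T_common gf_T gf_closed(3))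
  show "x \<in> T \<Longrightarrow> x ^ n \<in> T" by (metis T_common gf_T gf_closed(6))
  show "x \<in> T \<Longrightarrow> inverse x \<in> T" by (metis T_common gf_T gf_closed(4))
  show "x \<in> T \<Longrightarrow> y \<in> T \<Longrightarrow> x / y \<in> T" by (metis T_common gf_T gf_closed(5))
qed

lemma T_cg_eq: "x \<in> T \<Longrightarrow> y \<in> T \<Longrightarrow> x \<doteq> y \<Longrightarrow> x = y"
  by (metis T_common gf_cg_eq)

text \<open>The fundamental theorem of algebra gives the factorization, and integral closedness puts
  the roots into \<open>A\<close>, so that the factorization can be reduced modulo
  \<open>M\<close>.\<close>

lemma poly_splits_A:
  assumes f: "lead_coeff f = 1" "\<And>i. coeff f i \<in> A"
  obtains m where "size m = degree f" "f = (\<Prod>x\<in>#m. [:- x, 1:])" "set_mset m \<subseteq> A"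
proof -
  have "f \<noteq> 0" using f by auto
  then obtain m where m: "size m = degree f" "f = smult (lead_coeff f) (\<Prod>x\<in>#m. [:- x, 1:])"
    using alg_closed_imp_factorization by blast
  then have fm: "f = (\<Prod>x\<in>#m. [:- x, 1:])" using f by simp
  have "x \<in> A" if "x \<in># m" for x
  proof (rule integrally_closed[OF f])
    show "poly f x = 0" using that by (subst fm) (auto simp: poly_prod_mset image_iff prod_mset_zero_iff)
  qed
  then show ?thesis using that m fm by blast
qed

lemma prod_mset_cg_0:
  assumes "(\<Prod>x\<in>#m. t - x) \<doteq> 0" "t \<in> A" "set_mset m \<subseteq> A"
  shows "\<exists>x\<in>#m. t \<doteq> x"
  using assms
proof (induction m)
  case (add x m)
  have "(\<Prod>x\<in>#m. t - x) \<in> A" using add.prems(2,3) by (induction m) auto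
  then show ?case using add cg_mult_0_iff[of "t - x" "\<Prod>x\<in>#m. t - x"] cg_diff_iff[of t x] by auto
qed simp

text \<open>Each root modulo \<open>M\<close> is congruent to one of the complex roots. This
  assignment is injective because distinct elements of \<open>T\<close> are incongruent.\<close>

lemma roots_le_degree:
  assumes f: "lead_coeff f = 1" "\<And>i. coeff f i \<in> A"
    and S: "S \<subseteq> T" "\<And>t. t \<in> S \<Longrightarrow> poly f t \<doteq> 0"
  shows "finite S \<and> card S \<le> degree f"
proof -
  obtain m where m: "size m = degree f" "f = (\<Prod>x\<in>#m. [:- x, 1:])" "set_mset m \<subseteq> A"
    using poly_splits_A[OF f] by metis
  have "\<exists>x\<in>#m. t \<doteq> x" if "t \<in> S" for t
  proof (rule prod_mset_cg_0)
    show "(\<Prod>x\<in>#m. t - x) \<doteq> 0" using S(2)[OF that] unfolding m(2)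
      by (simp add: poly_prod_mset image_mset.compositionality comp_def)
    show "t \<in> A" using S that T_A by blast
  qed (rule m)
  then obtain h where h: "\<And>t. t \<in> S \<Longrightarrow> h t \<in># m \<and> t \<doteq> h t" by metis
  have inj: "inj_on h S"
  proof (rule inj_onI)
    fix s t assume st: "s \<in> S" "t \<in> S" "h s = h t"
    then have "s \<doteq> t" using h[of s] h[of t] cg_sym[of t "h t"] cg_trans[of s "h s" t] by simp
    then show "s = t" using st S T_cg_eq by blast
  qed
  have sub: "h ` S \<subseteq> set_mset m" using h by blast
  have fin: "finite S" using inj sub finite_set_mset finite_subset finite_imageD by metis
  have "card S \<le> card (set_mset m)" using inj sub by (intro card_inj_on_le[where f = h]) auto
  also have "\<dots> \<le> size m" by (metis mset_set_set_mset_msubset size_mset_mono size_mset_set)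
  finally show ?thesis using m fin by simp
qed

text \<open>The complex roots of X ^ N - X are the elements of \<open>gf N\<close>. Evaluating the
  product of its linear factors at w gives 0 modulo \<open>M\<close>, so w is congruent to one of
  them.\<close>

lemma exists_rep:
  assumes N: "ppow N" and w: "w \<in> fx N"
  shows "\<exists>t\<in>gf N. t \<doteq> w"
proof -
  have N2: "N \<ge> 2" using ppow_ge_2[OF N] .
  define f where "f = (monom 1 N - monom 1 1 :: complex poly)"
  have lf: "lead_coeff f = 1" unfolding f_def by (rule lead_coeff_gf_poly[OF N2])
  have cf: "coeff f i \<in> A" for i by (auto simp: f_def)
  obtain m where m: "size m = degree f" "f = (\<Prod>x\<in>#m. [:- x, 1:])" "set_mset m \<subseteq> A"
    using poly_splits_A[OF lf cf] by metis
  have root: "poly f x = (\<Prod>y\<in>#m. x - y)" for x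
    unfolding m(2) by (simp add: poly_prod_mset image_mset.compositionality comp_def)
  have "(\<Prod>y\<in>#m. w - y) \<doteq> 0" using w cg_diff_iff[of "w ^ N" w]
    by (simp add: f_def poly_monom fx_def flip: root)
  then obtain x where x: "x \<in># m" "w \<doteq> x" using prod_mset_cg_0 fx_A[OF w] m by blast
  have "poly f x = 0" unfolding root using x by (auto simp: prod_mset_zero_iff)
  then have "x \<in> gf N" by (simp add: f_def poly_monom gf_def)
  then show ?thesis using x cg_sym by blast
qed

text \<open>The Teichmueller lift of the residue class of w. It is meaningful only for classes
  algebraic over the prime field, which is ensured by membership in some
  \<open>fx N\<close>.\<close>

definition rp :: "complex \<Rightarrow> complex" where
  "rp w = (SOME t. t \<in> T \<and> t \<doteq> w)"

lemma rp_eqI: "t \<in> T \<Longrightarrow> t \<doteq> w \<Longrightarrow> rp w = t"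
  unfolding rp_def
proof (rule some_equality)
  fix t' assume "t \<in> T" "t \<doteq> w" "t' \<in> T \<and> t' \<doteq> w"
  then show "t' = t" using T_cg_eq[of t' t] cg_trans[of t' w t] cg_sym[of t w] by blast
qed auto

lemma rp_fx:
  assumes N: "ppow N" and w: "w \<in> fx N"
  shows "rp w \<in> gf N" and "rp w \<doteq> w"
proof -
  obtain t where t: "t \<in> gf N" "t \<doteq> w" using exists_rep[OF assms] by blast
  then have "rp w = t" using gf_T[OF N] by (intro rp_eqI) auto
  then show "rp w \<in> gf N" "rp w \<doteq> w" using t by auto
qed

lemma rp_T: "t \<in> T \<Longrightarrow> rp t = t"
  by (intro rp_eqI) (auto simp: T_A)

lemma rp_cg: "w \<doteq> w' \<Longrightarrow> rp w = rp w'"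
proof -
  assume w: "w \<doteq> w'"
  have "t \<doteq> w \<longleftrightarrow> t \<doteq> w'" for t
    using cg_trans[of t w w'] cg_trans[of t w' w] cg_sym[OF w] w by blast
  then show ?thesis by (simp add: rp_def)
qed

section \<open>Frobenius-stable multisets\<close>

text \<open>Modulo \<open>M\<close>, all powers of \<alpha> lie in the span of 1, ..., \<alpha> ^ (n
  - 1) over the field with N elements. With coefficients taken from \<open>gf N\<close> this span is
  finite, and two powers must coincide.\<close>

lemma root_finite_order:
  assumes N: "ppow N" and f: "lead_coeff f = 1" "\<And>i. coeff f i \<in> fx N" and r: "poly f \<alpha> = 0"
  shows "\<exists>i j. i < j \<and> \<alpha> ^ i \<doteq> \<alpha> ^ j"
proof -
  have aA: "\<alpha> \<in> A" using integrally_closed[OF f(1) _ r] fx_A f(2) by blast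
  have "degree f \<noteq> 0"
  proof
    assume "degree f = 0"
    then show False using f r by (simp add: poly_altdef)
  qed
  then obtain n' where n': "degree f = Suc n'" by (cases "degree f") auto
  define n where "n = Suc n'"
  have "0 = (\<Sum>i\<le>n. coeff f i * \<alpha> ^ i)" using r by (simp add: poly_altdef n' n_def)
  also have "{..n} = insert n {..<n}" by auto
  also have "(\<Sum>i\<in>insert n {..<n}. coeff f i * \<alpha> ^ i) = \<alpha> ^ n + (\<Sum>i<n. coeff f i * \<alpha> ^ i)"
    using f n' by (simp add: n_def)
  finally have an: "\<alpha> ^ n = - (\<Sum>i<n. coeff f i * \<alpha> ^ i)" by (simp add: add_eq_0_iff2)
  have "\<exists>c. c \<in> {..<n} \<rightarrow>\<^sub>E gf N \<and> \<alpha> ^ k \<doteq> (\<Sum>i<n. c i * \<alpha> ^ i)" for k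
  proof (induction k)
    case 0
    define c where "c = (\<lambda>i\<in>{..<n}. if i = 0 then 1 else 0 :: complex)"
    have "(\<Sum>i<n. c i * \<alpha> ^ i) = (\<Sum>i\<in>{0 :: nat}. 1)"
      unfolding c_def by (intro sum.mono_neutral_cong_right) (auto simp: n_def)
    moreover have "c \<in> {..<n} \<rightarrow>\<^sub>E gf N" using ppow_ge_2[OF N] by (auto simp: c_def gf_closed)
    ultimately show ?case using aA by (intro exI[of _ c]) auto
  next
    case (Suc k)
    then obtain c where c: "c \<in> {..<n} \<rightarrow>\<^sub>E gf N" "\<alpha> ^ k \<doteq> (\<Sum>i<n. c i * \<alpha> ^ i)" by blast
    have cfx: "c i \<in> fx N" if "i < n" for i using c that gf_fx[OF N] by (auto simp: PiE_def)
    \<comment> \<open>Multiplication by \<alpha> shifts the coefficients, and the overflow c n' *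
      \<alpha> ^ n is removed with the equation of \<alpha>. Passing to \<open>rp\<close> afterwards
      keeps the coefficients in the finite set \<open>gf N\<close>.\<close>
    define d where "d = (\<lambda>i. (if i = 0 then 0 else c (i - 1)) - c n' * coeff f i)"
    have dfx: "d i \<in> fx N" if "i < n" for i
      unfolding d_def using that by (auto intro!: fx_closed[OF N] cfx f simp: n_def)
    define e where "e = (\<lambda>i\<in>{..<n}. rp (d i))"
    have "\<alpha> ^ Suc k = \<alpha> * \<alpha> ^ k" by simp
    also have "\<dots> \<doteq> \<alpha> * (\<Sum>i<n. c i * \<alpha> ^ i)" using aA c by (intro cg_mult) auto
    also have "\<alpha> * (\<Sum>i<n. c i * \<alpha> ^ i) = (\<Sum>i<n'. c i * \<alpha> ^ Suc i) + c n' * \<alpha> ^ n"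
      by (simp add: n_def sum_distrib_left algebra_simps)
    also have "\<dots> = (\<Sum>i<n. (if i = 0 then 0 else c (i - 1)) * \<alpha> ^ i) + c n' * \<alpha> ^ n"
      by (simp only: n_def sum.lessThan_Suc_shift) simp
    also have "\<dots> = (\<Sum>i<n. d i * \<alpha> ^ i)"
      unfolding an d_def by (simp add: sum_distrib_left left_diff_distrib sum_subtractf mult.assoc)
    also have "\<dots> \<doteq> (\<Sum>i<n. e i * \<alpha> ^ i)"
      unfolding e_def using rp_fx(2)[OF N dfx] aA by (intro cg_sum cg_mult) (auto intro: cg_sym)
    finally have "\<alpha> ^ Suc k \<doteq> (\<Sum>i<n. e i * \<alpha> ^ i)" .
    moreover have "e \<in> {..<n} \<rightarrow>\<^sub>E gf N" using rp_fx(1)[OF N dfx] by (auto simp: e_def)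
    ultimately show ?case by blast
  qed
  then obtain c where c: "\<And>k. c k \<in> {..<n} \<rightarrow>\<^sub>E gf N" "\<And>k. \<alpha> ^ k \<doteq> (\<Sum>i<n. c k i * \<alpha> ^ i)"
    by metis
  have "finite ({..<n} \<rightarrow>\<^sub>E gf N)" using finite_gf ppow_ge_2[OF N] by (intro finite_PiE) auto
  then have "finite (range c)" using c by (meson finite_subset image_subsetI)
  then have "\<not> inj c" using finite_imageD infinite_UNIV_nat by blast
  then obtain i j where "i \<noteq> j" "c i = c j" by (auto simp: inj_def)
  then have *: "\<alpha> ^ i \<doteq> \<alpha> ^ j" "i \<noteq> j"
    using cg_trans[OF c(2)[of i] cg_sym[OF c(2)[of j, folded \<open>c i = c j\<close>]]] by auto
  then show ?thesis using cg_sym[OF *(1)] by (metis nat_neq_iff)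
qed

lemma root_rep:
  assumes N: "ppow N" and f: "lead_coeff f = 1" "\<And>i. coeff f i \<in> fx N" and r: "poly f \<alpha> = 0"
  shows "\<exists>t\<in>T. t \<doteq> \<alpha>"
proof (cases "\<alpha> \<doteq> 0")
  case True
  then show ?thesis using T_closed(1) cg_sym by blast
next
  case False
  have aA: "\<alpha> \<in> A" using integrally_closed[OF f(1) _ r] fx_A f(2) by blast
  obtain i j where ij: "i < j" "\<alpha> ^ i \<doteq> \<alpha> ^ j" using root_finite_order[OF assms] by blast
  define d where "d = j - i"
  have d0: "d > 0" using ij by (simp add: d_def)
  have ni: "\<not> \<alpha> ^ i \<doteq> 0"
  proof (cases "i = 0")
    case False
    then show ?thesis using \<open>\<not> \<alpha> \<doteq> 0\<close> aA by (simp add: cg_power_0_iff)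
  qed simp
  have "\<alpha> ^ i * \<alpha> ^ d = \<alpha> ^ j" using ij by (simp add: d_def flip: power_add)
  then have "\<alpha> ^ i * 1 \<doteq> \<alpha> ^ i * \<alpha> ^ d" using ij by simp
  then have "1 \<doteq> \<alpha> ^ d" using ni aA cg_mult_cancel[of "\<alpha> ^ i" 1 "\<alpha> ^ d"] by auto
  then have ad: "\<alpha> ^ d \<doteq> 1" by (rule cg_sym)
  obtain a d' where d': "\<not> p dvd d'" "d = d' * p ^ a"
    using prime_power_canonical[OF prime_p d0] by blast
  define x where "x = \<alpha> ^ d'"
  have xA: "x \<in> A" using aA by (auto simp: x_def)
  have "x ^ (p ^ a) \<doteq> 1" using ad by (simp add: x_def d' power_mult)
  then have x1: "x \<doteq> 1"
  proof (cases "a = 0")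
    case False
    then have pp: "ppow (p ^ a)" by (auto simp: ppow_def)
    assume x: "x ^ (p ^ a) \<doteq> 1"
    have "(x - 1) ^ (p ^ a) \<doteq> x ^ (p ^ a) - 1 ^ (p ^ a)" using xA by (intro ppow_diff pp) auto
    also have "\<dots> \<doteq> 1 - 1" using x by (intro cg_diff) auto
    finally have "x - 1 \<doteq> 0" using xA ppow_ge_2[OF pp] cg_power_0_iff[of "x - 1" "p ^ a"] prime_gt_0_nat[OF prime_p]
      by auto
    then show ?thesis using xA by (simp add: cg_diff_iff)
  qed simp
  have "d' > 0" using d' d0 by (cases d') auto
  define e where "e = totient d'"
  have e0: "e > 0" using \<open>d' > 0\<close> by (simp add: e_def)
  have "coprime p d'" using d' prime_p by (simp add: prime_imp_coprime)
  then have "[p ^ e = 1] (mod d')" unfolding e_def by (rule euler_theorem)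
  moreover have "p ^ e \<ge> 1" using prime_gt_0_nat[OF prime_p] by simp
  moreover have "d' dvd p ^ e - 1" using calculation(1) by (rule cong_to_1_nat)
  ultimately obtain w where "p ^ e - 1 = d' * w" "p ^ e \<ge> 1" by (auto elim: dvdE)
  then have w: "p ^ e = 1 + d' * w" by linarith
  have "\<alpha> ^ (p ^ e) = \<alpha> * x ^ w" by (simp add: w x_def power_add power_mult)
  also have "\<dots> \<doteq> \<alpha> * 1 ^ w" using aA x1 by (intro cg_mult cg_power) auto
  finally have "\<alpha> \<in> fx (p ^ e)" using aA by (simp add: fx_def)
  moreover have pe: "ppow (p ^ e)" using e0 by (auto simp: ppow_def)
  ultimately show ?thesis using exists_rep[OF pe] gf_T[OF pe] by blast
qed

end

section \<open>Monic polynomials described by their root multisets\<close>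

definition pm :: "complex multiset \<Rightarrow> complex poly" where
  "pm m = (\<Prod>x\<in>#m. [:- x, 1:])"

lemma pm_empty [simp]: "pm {#} = 1"
  by (simp add: pm_def)

lemma pm_add: "pm (add_mset x m) = [:- x, 1:] * pm m"
  by (simp add: pm_def)

lemma coeff_linear_mult:
  "coeff ([:- x, 1:] * f) i = (if i = 0 then 0 else coeff f (i - 1)) - x * coeff f i"
  for x :: complex
  by (cases i) (auto simp: coeff_pCons)

lemma coeff_pm_add:
  "coeff (pm (add_mset x m)) i = (if i = 0 then 0 else coeff (pm m) (i - 1)) - x * coeff (pm m) i"
  by (simp only: pm_add coeff_linear_mult)

lemma degree_pm: "degree (pm m) = size m" and lead_coeff_pm: "coeff (pm m) (size m) = 1"
proof -
  have "degree (pm m) = size m \<and> coeff (pm m) (size m) = 1"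
  proof (induction m)
    case (add x m)
    have nz: "pm m \<noteq> 0" using add by auto
    have "degree (pm (add_mset x m)) = Suc (size m)"
      unfolding pm_add using add nz by (subst degree_mult_eq) auto
    moreover have "coeff (pm m) (Suc (size m)) = 0" using add by (intro coeff_eq_0) auto
    ultimately show ?case using add by (simp add: coeff_pm_add)
  qed simp
  then show "degree (pm m) = size m" "coeff (pm m) (size m) = 1" by auto
qed

lemma coeff_pm_gt: "i > size m \<Longrightarrow> coeff (pm m) i = 0"
  by (intro coeff_eq_0) (simp add: degree_pm)

lemma coeff_pm_0: "coeff (pm m) 0 = (- 1) ^ size m * prod_mset m"
  by (induction m) (auto simp: coeff_pm_add)

lemma coeff_pm_sum: "m \<noteq> {#} \<Longrightarrow> coeff (pm m) (size m - 1) = - sum_mset m"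
proof (induction m)
  case (add x m)
  then show ?case
    by (cases "m = {#}") (auto simp: coeff_pm_add lead_coeff_pm)
qed simp

lemma poly_pm: "poly (pm m) x = (\<Prod>y\<in>#m. x - y)"
  by (simp add: pm_def poly_prod_mset image_mset.compositionality comp_def)

context residue
begin

lemma coeff_pm_A: "set_mset m \<subseteq> A \<Longrightarrow> coeff (pm m) i \<in> A"
proof (induction m arbitrary: i)
  case (add x m)
  then show ?case by (auto simp: coeff_pm_add)
qed auto

text \<open>The coefficients are integer polynomials in the roots, and the N-th power map respects
  sums modulo \<open>M\<close> and products exactly. It serves both ways: stable roots give
  coefficients in the small field, and such coefficients give stable roots.\<close>

lemma coeff_pm_frobenius:
  assumes N: "ppow N"
  shows "set_mset m \<subseteq> A \<Longrightarrow> coeff (pm (image_mset (\<lambda>x. x ^ N) m)) i \<doteq> coeff (pm m) i ^ N"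
proof (induction m arbitrary: i)
  case empty
  show ?case using ppow_ge_2[OF N] by (cases i) (auto simp: zero_power)
next
  case (add x m)
  define g where "g = (\<lambda>i. if i = 0 then 0 else coeff (pm m) (i - 1))"
  have gA: "g i \<in> A" using add by (auto simp: g_def coeff_pm_A)
  have mA: "coeff (pm m) i \<in> A" "x \<in> A" using add by (auto simp: coeff_pm_A)
  have "coeff (pm (image_mset (\<lambda>x. x ^ N) (add_mset x m))) i
    = (if i = 0 then 0 else coeff (pm (image_mset (\<lambda>x. x ^ N) m)) (i - 1))
      - x ^ N * coeff (pm (image_mset (\<lambda>x. x ^ N) m)) i"
    by (simp add: coeff_pm_add)
  also have "\<dots> \<doteq> g i ^ N - x ^ N * coeff (pm m) i ^ N"
    using add ppow_ge_2[OF N] by (intro cg_diff cg_mult) (auto simp: g_def zero_power)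
  also have "\<dots> = g i ^ N - (x * coeff (pm m) i) ^ N" by (simp add: power_mult_distrib)
  also have "\<dots> \<doteq> (g i - x * coeff (pm m) i) ^ N"
    using gA mA by (intro cg_sym[OF ppow_diff] N) auto
  also have "g i - x * coeff (pm m) i = coeff (pm (add_mset x m)) i"
    by (simp add: coeff_pm_add g_def)
  finally show ?case .
qed

lemma coeff_pm_cong:
  assumes "\<And>x. x \<in># m \<Longrightarrow> h x \<doteq> x"
  shows "coeff (pm (image_mset h m)) i \<doteq> coeff (pm m) i"
  using assms
proof (induction m arbitrary: i)
  case (add x m)
  show ?case unfolding image_mset_add_mset coeff_pm_add
    using add by (intro cg_diff cg_mult) auto
qed auto

lemma poly_cg:
  assumes fg: "\<And>i. coeff f i \<doteq> coeff g i" and b: "b \<in> A"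
  shows "poly f b \<doteq> poly g b"
proof -
  have "poly (f - g) b = (\<Sum>i\<le>degree (f - g). coeff (f - g) i * b ^ i)" by (rule poly_altdef)
  also have "\<dots> \<doteq> (\<Sum>i\<le>degree (f - g). 0 * b ^ i)"
  proof (intro cg_sum cg_mult)
    fix i show "coeff (f - g) i \<doteq> 0"
      using fg[of i] cg_A[OF fg[of i]] by (simp add: cg_diff_iff)
  qed (use b in auto)
  finally have *: "poly f b - poly g b \<doteq> 0" by simp
  have "poly f b \<in> A" "poly g b \<in> A" unfolding poly_altdef
    using b cg_A[OF fg] by auto
  then show ?thesis using * by (simp add: cg_diff_iff)
qed

text \<open>Cancellation of a monic linear factor modulo \<open>M\<close>, without forming
  polynomials over the residue field: the difference h satisfies h_n \<doteq> b * h_(n+1), and the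
  congruence descends from an index beyond the degree.\<close>

lemma linear_mult_cancel_cg:
  assumes b: "b \<in> A" and f: "\<And>i. coeff f i \<in> A" and g: "\<And>i. coeff g i \<in> A"
    and fg: "\<And>i. coeff ([:- b, 1:] * f) i \<doteq> coeff ([:- b, 1:] * g) i"
  shows "coeff f i \<doteq> coeff g i"
proof -
  define h where "h = f - g"
  have hA: "coeff h i \<in> A" for i using f g by (simp add: h_def)
  have bh: "coeff ([:- b, 1:] * h) i \<doteq> 0" for i
  proof -
    have "coeff ([:- b, 1:] * h) i = coeff ([:- b, 1:] * f) i - coeff ([:- b, 1:] * g) i"
      by (simp only: h_def right_diff_distrib coeff_diff)
    then show ?thesis using fg[of i] cg_A[OF fg[of i]] by (simp add: cg_diff_iff)
  qed
  define d where "d = Suc (max i (degree h))"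
  have "i \<le> d" by (simp add: d_def)
  then have "coeff h i \<doteq> 0"
  proof (induction rule: inc_induct)
    case base show ?case by (simp add: d_def coeff_eq_0)
  next
    case (step n)
    have "coeff h n - b * coeff h (Suc n) \<doteq> 0" using bh[of "Suc n"] by (simp only: coeff_linear_mult) simp
    then have "coeff h n \<doteq> b * coeff h (Suc n)" using b hA by (simp add: cg_diff_iff)
    also have "\<dots> \<doteq> b * 0" using b step by (intro cg_mult) auto
    finally show ?case by simp
  qed
  then show ?thesis using f g by (simp add: h_def cg_diff_iff)
qed

text \<open>Unique factorization over the residue field: a root of one polynomial is congruent to a
  root of the other, hence equal to it inside \<open>T\<close>, and the common factor
  cancels.\<close>

lemma pm_inj:
  assumes "set_mset m \<subseteq> T" "set_mset m' \<subseteq> T" "\<And>i. coeff (pm m) i \<doteq> coeff (pm m') i"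
  shows "m = m'"
  using assms
proof (induction m' arbitrary: m)
  case empty
  show ?case
  proof (rule ccontr)
    assume "m \<noteq> {#}"
    then have "size m > 0" by (simp add: nonempty_has_size)
    then show False using empty(3)[of "size m"] \<open>m \<noteq> {#}\<close> by (simp add: lead_coeff_pm)
  qed
next
  case (add b m')
  have bT: "b \<in> T" and m'T: "set_mset m' \<subseteq> T" using add by auto
  have bA: "b \<in> A" and mA: "set_mset m \<subseteq> A" and m'A: "set_mset m' \<subseteq> A"
    using add.prems T_A by auto
  have "poly (pm m) b \<doteq> poly (pm (add_mset b m')) b" by (intro poly_cg add.prems bA)
  then have "(\<Prod>y\<in>#m. b - y) \<doteq> 0" by (simp add: poly_pm)
  then obtain a where "a \<in># m" "b \<doteq> a" using prod_mset_cg_0 bA mA by blast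
  then have "b \<in># m" using T_cg_eq[of b a] bT add.prems by auto
  then obtain m0 where m0: "m = add_mset b m0" by (metis insert_DiffM)
  have m0T: "set_mset m0 \<subseteq> T" using add.prems m0 by auto
  have "coeff (pm m0) i \<doteq> coeff (pm m') i" for i
  proof (rule linear_mult_cancel_cg[OF bA])
    show "coeff (pm m0) i \<in> A" for i using mA m0 by (intro coeff_pm_A) auto
    show "coeff (pm m') i \<in> A" for i using m'A by (intro coeff_pm_A) auto
    show "coeff ([:- b, 1:] * pm m0) i \<doteq> coeff ([:- b, 1:] * pm m') i" for i
      using add.prems(3)[of i] by (simp only: m0 pm_add)
  qed
  then have "m0 = m'" using add.IH[OF m0T m'T] by blast
  then show ?case using m0 by simp
qed

section \<open>Frobenius-stable multisets with prescribed product and sum\<close>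

definition stab :: "nat \<Rightarrow> complex multiset \<Rightarrow> bool" where
  "stab Q m \<longleftrightarrow> set_mset m \<subseteq> T \<and> image_mset (\<lambda>x. x ^ Q) m = m"

text \<open>The product is prescribed exactly, the sum only modulo \<open>M\<close>, since
  \<open>T\<close> is closed under multiplication but not under addition.\<close>

definition FM :: "nat \<Rightarrow> nat \<Rightarrow> complex \<Rightarrow> complex \<Rightarrow> complex multiset set" where
  "FM Q n \<nu> \<tau> = {m. stab Q m \<and> size m = n \<and> prod_mset m = \<nu> \<and> sum_mset m \<doteq> \<tau>}"

lemma prod_mset_T: "set_mset m \<subseteq> T \<Longrightarrow> prod_mset m \<in> T"
  by (induction m) (auto intro: T_closed)

lemma sum_mset_A: "set_mset m \<subseteq> A \<Longrightarrow> sum_mset m \<in> A"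
  by (induction m) auto

text \<open>
  A Frobenius-stable multiset is the root multiset of a monic polynomial over the field with
  \<open>Q\<close> elements, and \<open>\<nu>\<close> and \<open>\<tau>\<close> prescribe two of its coefficients.
\<close>

lemma card_FM:
  assumes Q: "ppow Q" and n: "n \<ge> 2" and nu: "\<nu> \<in> gf Q" and tau: "\<tau> \<in> fx Q"
  shows "finite (FM Q n \<nu> \<tau>) \<and> card (FM Q n \<nu> \<tau>) = Q ^ (n - 2)"
proof -
  \<comment> \<open>Of the n lower coefficients, number 0 is fixed by \<nu> and number n - 1 by
    \<tau>; the remaining n - 2 are free in the field with Q elements.\<close>
  define g where "g = (\<lambda>m. \<lambda>i\<in>{1..<n - 1}. rp (coeff (pm m) i))"
  have TA: "set_mset m \<subseteq> A" if "stab Q m" for m using that T_A by (auto simp: stab_def)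
  have cfx: "coeff (pm m) i \<in> fx Q" if "stab Q m" for m i
    using coeff_pm_frobenius[OF Q TA[OF that], of i] that coeff_pm_A[OF TA[OF that], of i]
    by (auto simp: fx_def stab_def intro: cg_sym)
  have "bij_betw g (FM Q n \<nu> \<tau>) ({1..<n - 1} \<rightarrow>\<^sub>E gf Q)"
    unfolding bij_betw_def
  proof
    show "inj_on g (FM Q n \<nu> \<tau>)"
    proof (rule inj_onI)
      fix m m' assume m: "m \<in> FM Q n \<nu> \<tau>" "m' \<in> FM Q n \<nu> \<tau>" "g m = g m'"
      then have st: "stab Q m" "stab Q m'" and sz: "size m = n" "size m' = n"
        and sm: "sum_mset m \<doteq> \<tau>" "sum_mset m' \<doteq> \<tau>" and pr: "prod_mset m = prod_mset m'"
        by (auto simp: FM_def)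
      have ne: "m \<noteq> {#}" "m' \<noteq> {#}" using sz n by auto
      show "m = m'"
      proof (rule pm_inj)
        show "set_mset m \<subseteq> T" "set_mset m' \<subseteq> T" using st by (auto simp: stab_def)
        fix i
        consider "i = 0" | "1 \<le> i" "i < n - 1" | "i = n - 1" | "i = n" | "i > n" by linarith
        then show "coeff (pm m) i \<doteq> coeff (pm m') i"
        proof cases
          case 1
          then show ?thesis using pr sz coeff_pm_A[OF TA[OF st(1)], of 0] by (simp add: coeff_pm_0)
        next
          case 2
          have "rp (coeff (pm m) i) = rp (coeff (pm m') i)"
            using fun_cong[OF m(3), of i] 2 by (simp add: g_def)
          then show ?thesis
            using cg_trans[OF cg_sym[OF rp_fx(2)[OF Q cfx[OF st(1), of i]]]]
              rp_fx(2)[OF Q cfx[OF st(2), of i]] by simp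
        next
          case 3
          have "sum_mset m \<doteq> sum_mset m'" by (rule cg_trans[OF sm(1) cg_sym[OF sm(2)]])
          then show ?thesis using cg_minus coeff_pm_sum[OF ne(1)] coeff_pm_sum[OF ne(2)] 3 sz by simp
        next
          case 4
          then show ?thesis using lead_coeff_pm[of m] lead_coeff_pm[of m'] sz by simp
        next
          case 5
          then show ?thesis using coeff_pm_gt[of m i] coeff_pm_gt[of m' i] sz by simp
        qed
      qed
    qed
    show "g ` FM Q n \<nu> \<tau> = {1..<n - 1} \<rightarrow>\<^sub>E gf Q"
    proof (intro equalityI subsetI)
      fix c assume "c \<in> g ` FM Q n \<nu> \<tau>"
      then show "c \<in> {1..<n - 1} \<rightarrow>\<^sub>E gf Q" using rp_fx(1)[OF Q cfx] by (auto simp: g_def FM_def)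
    next
      fix c assume c: "c \<in> {1..<n - 1} \<rightarrow>\<^sub>E gf Q"
      \<comment> \<open>The inverse construction: the coefficient list with the two prescribed
        entries and the sign of the constant term.\<close>
      define k where "k = (\<lambda>i. if i = 0 then (- 1) ^ n * \<nu> else if i = n then 1
        else if i = n - 1 then - \<tau> else c i)"
      define f where "f = (\<Sum>i\<le>n. monom (k i) i)"
      have cf: "coeff f i = (if i \<le> n then k i else 0)" for i
        by (simp add: f_def coeff_sum)
      have "degree f \<le> n" by (rule degree_le) (simp add: cf)
      moreover have "coeff f n = 1" using n by (simp add: cf k_def)
      ultimately have df: "degree f = n" by (metis le_degree antisym zero_neq_one)
      have lf: "lead_coeff f = 1" using df \<open>coeff f n = 1\<close> by simp
      have nufx: "\<nu> \<in> fx Q" using nu gf_fx[OF Q] by blast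
      have kfx: "k i \<in> fx Q" if "i \<le> n" for i
      proof -
        have "c i \<in> fx Q" if "i \<noteq> 0" "i \<noteq> n" "i \<noteq> n - 1"
          using c that \<open>i \<le> n\<close> gf_fx[OF Q] by (auto simp: PiE_def Pi_def)
        moreover have "(- 1 :: complex) \<in> fx Q" by (intro fx_closed Q)
        ultimately show ?thesis using nufx tau by (auto simp: k_def intro!: fx_closed[OF Q])
      qed
      have ffx: "coeff f i \<in> fx Q" for i using kfx by (auto simp: cf fx_closed[OF Q])
      obtain m0 where m0: "size m0 = degree f" "f = pm m0" "set_mset m0 \<subseteq> A"
        using poly_splits_A[OF lf] fx_A[OF ffx] unfolding pm_def by metis
      have rep: "rp x \<in> T \<and> rp x \<doteq> x" if "x \<in># m0" for x
      proof -
        have "poly f x = 0" unfolding m0(2) poly_pm using that by (auto simp: prod_mset_zero_iff)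
        then obtain t where "t \<in> T" "t \<doteq> x" using root_rep[OF Q lf ffx] by blast
        then show ?thesis using rp_eqI by metis
      qed
      \<comment> \<open>The complex roots need not be permuted by the Q-th power map, only their
        classes are. Passing to representatives changes the coefficients by elements of
        \<open>M\<close> and makes the stability exact.\<close>
      define m where "m = image_mset rp m0"
      have mT: "set_mset m \<subseteq> T" using rep by (auto simp: m_def)
      have mA: "set_mset m \<subseteq> A" using mT T_A by auto
      have cm: "coeff (pm m) i \<doteq> coeff f i" for i
        unfolding m_def m0(2) using rep by (intro coeff_pm_cong) auto
      have "image_mset (\<lambda>x. x ^ Q) m = m"
      proof (rule pm_inj)
        show "set_mset (image_mset (\<lambda>x. x ^ Q) m) \<subseteq> T" using mT T_closed by auto
        show "set_mset m \<subseteq> T" by (rule mT)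
        fix i
        have "coeff (pm (image_mset (\<lambda>x. x ^ Q) m)) i \<doteq> coeff (pm m) i ^ Q"
          by (rule coeff_pm_frobenius[OF Q mA])
        also have "\<dots> \<doteq> coeff f i ^ Q" by (intro cg_power cm)
        also have "\<dots> \<doteq> coeff f i" using ffx by (simp add: fx_def)
        also have "\<dots> \<doteq> coeff (pm m) i" by (rule cg_sym[OF cm])
        finally show "coeff (pm (image_mset (\<lambda>x. x ^ Q) m)) i \<doteq> coeff (pm m) i" .
      qed
      then have st: "stab Q m" using mT by (simp add: stab_def)
      have sz: "size m = n" using m0 df by (simp add: m_def)
      have "(- 1) ^ n * prod_mset m \<doteq> (- 1) ^ n * \<nu>"
        using cm[of 0] sz by (simp add: coeff_pm_0 cf k_def)
      then have "(- 1) ^ n * ((- 1) ^ n * prod_mset m) \<doteq> (- 1) ^ n * ((- 1) ^ n * \<nu>)"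
        by (rule cg_mult[OF cg_refl, rotated]) auto
      moreover have "(- 1) ^ n * ((- 1) ^ n * z) = z" for z :: complex by simp
      ultimately have "prod_mset m \<doteq> \<nu>" by (simp only:)
      then have pr: "prod_mset m = \<nu>" using T_cg_eq prod_mset_T[OF mT] gf_T[OF Q nu] by blast
      have "- sum_mset m \<doteq> - \<tau>"
      proof -
        have ne: "m \<noteq> {#}" using sz n by auto
        have "k (n - 1) = - \<tau>" using n by (simp add: k_def)
        then show ?thesis using cm[of "n - 1"] coeff_pm_sum[OF ne] sz by (simp add: cf)
      qed
      then have "sum_mset m \<doteq> \<tau>" using cg_minus[of "- sum_mset m" "- \<tau>"] by simp
      then have "m \<in> FM Q n \<nu> \<tau>" using st sz pr by (simp add: FM_def)
      moreover have "g m = c"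
      proof
        fix i
        show "g m i = c i"
        proof (cases "i \<in> {1..<n - 1}")
          case True
          then have "c i \<in> T" using c gf_T[OF Q] by (auto simp: PiE_def Pi_def)
          moreover have "coeff f i = c i" using True by (auto simp: cf k_def)
          then have "c i \<doteq> coeff (pm m) i" using cg_sym[OF cm[of i]] by simp
          ultimately show ?thesis using True rp_eqI by (simp add: g_def)
        next
          case False
          then show ?thesis using c by (auto simp: g_def PiE_def extensional_def)
        qed
      qed
      ultimately show "c \<in> g ` FM Q n \<nu> \<tau>" by blast
    qed
  qed
  moreover have "finite ({1..<n - 1} \<rightarrow>\<^sub>E gf Q)"
    using finite_gf ppow_ge_2[OF Q] by (intro finite_PiE) auto
  moreover have "card ({1..<n - 1} \<rightarrow>\<^sub>E gf Q) = Q ^ (n - 2)"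
    using card_gf[OF ppow_ge_2[OF Q]] by (simp add: card_PiE numeral_2_eq_2)
  ultimately show ?thesis by (metis bij_betw_finite bij_betw_same_card)
qed

end

section \<open>The Hasse-Davenport relation as a count\<close>

definition Nm :: "nat \<Rightarrow> nat \<Rightarrow> complex \<Rightarrow> complex" where
  "Nm Q j x = (\<Prod>i<j. x ^ (Q ^ i))"

definition Tr :: "nat \<Rightarrow> nat \<Rightarrow> complex \<Rightarrow> complex" where
  "Tr Q j x = (\<Sum>i<j. x ^ (Q ^ i))"

text \<open>A multiset, because conjugates repeat when x lies in a proper subfield: the size must
  remain j for product and sum to be \<open>Nm\<close> and \<open>Tr\<close>.\<close>

definition orb :: "nat \<Rightarrow> nat \<Rightarrow> complex \<Rightarrow> complex multiset" where
  "orb Q j x = image_mset (\<lambda>i. x ^ (Q ^ i)) (mset_set {..<j})"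

lemma orb_Suc: "orb Q (Suc j) x = add_mset (x ^ (Q ^ j)) (orb Q j x)"
  by (simp add: orb_def lessThan_Suc)

lemma orb_0 [simp]: "orb Q 0 x = {#}"
  by (simp add: orb_def)

lemma size_orb [simp]: "size (orb Q j x) = j"
  by (simp add: orb_def)

lemma prod_orb: "prod_mset (orb Q j x) = Nm Q j x"
  by (induction j) (auto simp: Nm_def orb_Suc mult.commute)

lemma sum_orb: "sum_mset (orb Q j x) = Tr Q j x"
  by (induction j) (auto simp: Tr_def orb_Suc add.commute)

lemma orb_add: "orb Q (i + j) x = orb Q i x + orb Q j (x ^ (Q ^ i))"
proof (induction j)
  case (Suc j)
  have "x ^ (Q ^ (i + j)) = (x ^ (Q ^ i)) ^ (Q ^ j)" by (simp flip: power_mult power_add)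
  then show ?case using Suc by (simp add: orb_Suc)
qed (simp add: orb_def)

lemma orb_frobenius:
  assumes "x \<in> gf (Q ^ j)"
  shows "image_mset (\<lambda>y. y ^ Q) (orb Q j x) = orb Q j x"
proof -
  have "add_mset x (image_mset (\<lambda>y. y ^ Q) (orb Q j x)) = orb Q (Suc j) x"
  proof (induction j)
    case (Suc j)
    have "(x ^ (Q ^ j)) ^ Q = x ^ (Q ^ Suc j)" by (simp flip: power_mult add: mult.commute)
    then have "add_mset x (image_mset (\<lambda>y. y ^ Q) (orb Q (Suc j) x))
      = add_mset (x ^ (Q ^ Suc j)) (add_mset x (image_mset (\<lambda>y. y ^ Q) (orb Q j x)))"
      by (simp add: orb_Suc)
    then show ?case by (simp only: Suc orb_Suc)
  qed (simp add: orb_Suc)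
  also have "\<dots> = add_mset x (orb Q j x)" using assms by (simp add: orb_Suc gf_def)
  finally show ?thesis by simp
qed

lemma Nm_gf:
  assumes "x \<in> gf (Q ^ j)"
  shows "Nm Q j x \<in> gf Q"
proof -
  have "Nm Q j x ^ Q = prod_mset (image_mset (\<lambda>y. y ^ Q) (orb Q j x))"
  proof -
    have "prod_mset m ^ Q = prod_mset (image_mset (\<lambda>y. y ^ Q) m)" for m :: "complex multiset"
      by (induction m) (auto simp: power_mult_distrib)
    then show ?thesis by (simp flip: prod_orb)
  qed
  also have "\<dots> = Nm Q j x" unfolding orb_frobenius[OF assms] prod_orb ..
  finally show ?thesis by (simp add: gf_def)
qed

lemma gf_mult_period: "x \<in> gf (Q ^ e) \<Longrightarrow> x \<in> gf (Q ^ (k * e))"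
  using gf_subset[of x "Q ^ e" k] by (simp flip: power_mult add: mult.commute)

context residue
begin

lemma Tr_fx:
  assumes Q: "ppow Q" and x: "x \<in> fx (Q ^ j)"
  shows "Tr Q j x \<in> fx Q"
proof -
  have xA: "x \<in> A" using x fx_A by blast
  have "Tr Q j x ^ Q \<doteq> (\<Sum>i<j. (x ^ (Q ^ i)) ^ Q)"
    unfolding Tr_def using xA by (intro ppow_sum Q) auto
  also have "(\<Sum>i<j. (x ^ (Q ^ i)) ^ Q) = (\<Sum>i<j. x ^ (Q ^ Suc i))"
    by (intro sum.cong refl) (simp flip: power_mult add: mult.commute)
  also have "\<dots> = (\<Sum>i<Suc j. x ^ (Q ^ i)) - x" by (simp only: sum.lessThan_Suc_shift) simp
  also have "\<dots> = Tr Q j x + x ^ (Q ^ j) - x" by (simp add: Tr_def)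
  also have "\<dots> \<doteq> Tr Q j x + x - x" using x xA by (intro cg_diff cg_add) (auto simp: fx_def Tr_def)
  finally show ?thesis using xA by (simp add: fx_def Tr_def)
qed

lemma T_frobenius_inj: "ppow Q \<Longrightarrow> inj_on (\<lambda>x. x ^ Q) T"
proof (rule inj_onI)
  fix x y assume Q: "ppow Q" and xy: "x \<in> T" "y \<in> T" "x ^ Q = y ^ Q"
  have xA: "x \<in> A" "y \<in> A" using xy T_A by auto
  have "(x - y) ^ Q \<doteq> x ^ Q - y ^ Q" using xA by (intro ppow_diff Q) auto
  then have "x - y \<doteq> 0" using xy xA cg_power_0_iff[of "x - y" Q] ppow_ge_2[OF Q] by auto
  then show "x = y" using xA T_cg_eq xy by (simp add: cg_diff_iff)
qed

lemma count_stab: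
  assumes Q: "ppow Q" and m: "stab Q m" and x: "x \<in> T"
  shows "count m (x ^ Q) = count m x"
proof -
  have mT: "set_mset m \<subseteq> T" using m by (simp add: stab_def)
  have "count m (x ^ Q) = count (image_mset (\<lambda>x. x ^ Q) m) (x ^ Q)" using m by (simp add: stab_def)
  also have "\<dots> = count m x"
  proof -
    have "(\<lambda>x. x ^ Q) -` {x ^ Q} \<inter> set_mset m = {x} \<inter> set_mset m"
      using inj_onD[OF T_frobenius_inj[OF Q]] mT x by auto
    then show ?thesis by (cases "x \<in># m") (auto simp: count_image_mset not_in_iff)
  qed
  finally show ?thesis .
qed

lemma period_exists:
  assumes Q: "ppow Q" and x: "x \<in> T"
  shows "\<exists>e>0. x \<in> gf (Q ^ e)"
proof -
  obtain j where j: "j > 0" "x \<in> gf (p ^ j)" using x by (auto simp: T_def ppow_def)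
  obtain k where k: "k > 0" "Q = p ^ k" using Q by (auto simp: ppow_def)
  have "x \<in> gf (Q ^ j)" using gf_subset[OF j(2), of k] unfolding k(2) by (simp flip: power_mult add: mult.commute)
  then show ?thesis using j by blast
qed

text \<open>With e the exact period of x, \<open>orb Q (k * e) x\<close> is k copies of the true
  orbit and contains x exactly k times. It fits into m because multiplicities in a stable multiset
  are constant along orbits.\<close>

lemma orb_multiple:
  assumes Q: "ppow Q" and m: "stab Q m" and x: "x \<in># m" and k: "1 \<le> k" "k \<le> count m x"
  shows "\<exists>j. 1 \<le> j \<and> x \<in> gf (Q ^ j) \<and> count (orb Q j x) x = k \<and> orb Q j x \<subseteq># m"
proof -
  have xT: "x \<in> T" using m x by (auto simp: stab_def)
  define e where "e = (LEAST e. e > 0 \<and> x \<in> gf (Q ^ e))"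
  have e: "e > 0 \<and> x \<in> gf (Q ^ e)" unfolding e_def using period_exists[OF Q xT] by (rule LeastI_ex)
  have least: "e \<le> i" if "i > 0" "x \<in> gf (Q ^ i)" for i
    unfolding e_def by (rule Least_le) (use that in blast)
  have xe: "x ^ (Q ^ e) = x" using e by (simp add: gf_def)
  have frob_inj: "u = v" if "u ^ (Q ^ i) = v ^ (Q ^ i)" "u \<in> T" "v \<in> T" for u v i
    using that
  proof (induction i)
    case (Suc i)
    have "(u ^ (Q ^ i)) ^ Q = (v ^ (Q ^ i)) ^ Q"
      using Suc.prems(1) by (simp flip: power_mult add: mult.commute)
    then have "u ^ (Q ^ i) = v ^ (Q ^ i)" using Suc.prems T_closed(4)
        inj_onD[OF T_frobenius_inj[OF Q], of "u ^ (Q ^ i)" "v ^ (Q ^ i)"] by simp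
    then show ?case using Suc by blast
  qed simp
  have inj: "inj_on (\<lambda>i. x ^ (Q ^ i)) {..<e}"
  proof (rule linorder_inj_onI')
    fix i j assume ij: "i \<in> {..<e}" "j \<in> {..<e}" "i < j"
    show "x ^ (Q ^ i) \<noteq> x ^ (Q ^ j)"
    proof
      assume "x ^ (Q ^ i) = x ^ (Q ^ j)"
      moreover have "x ^ (Q ^ j) = (x ^ (Q ^ (j - i))) ^ (Q ^ i)"
        using ij by (simp flip: power_mult power_add)
      ultimately have "x = x ^ (Q ^ (j - i))" using frob_inj[of x i "x ^ (Q ^ (j - i))"] xT T_closed by metis
      then have "e \<le> j - i" using ij by (intro least) (auto simp: gf_def)
      then show False using ij by auto
    qed
  qed
  have orb_e: "orb Q e x = mset_set ((\<lambda>i. x ^ (Q ^ i)) ` {..<e})"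
    unfolding orb_def by (rule image_mset_mset_set[OF inj])
  have cnt_e: "count (orb Q e x) y \<le> 1" for y unfolding orb_e by (simp add: count_mset_set')
  have "x = x ^ (Q ^ 0)" by simp
  then have "x \<in> (\<lambda>i. x ^ (Q ^ i)) ` {..<e}" using e by blast
  then have cnt_ex: "count (orb Q e x) x = 1" unfolding orb_e by simp
  have cnt: "count (orb Q (k * e) x) y = k * count (orb Q e x) y" for k y
  proof (induction k)
    case (Suc k)
    have "x ^ (Q ^ (k * e)) = x" using gf_mult_period[of x Q e k] e by (simp add: gf_def)
    then show ?case using Suc orb_add[of Q "k * e" e x] by (simp add: add.commute)
  qed (simp add: orb_def)
  have mcount: "count m (x ^ (Q ^ i)) = count m x" for i
  proof (induction i)
    case (Suc i)
    have "x ^ (Q ^ Suc i) = (x ^ (Q ^ i)) ^ Q" by (simp flip: power_mult add: mult.commute)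
    then show ?case using Suc count_stab[OF Q m, of "x ^ (Q ^ i)"] xT T_closed by simp
  qed simp
  have "orb Q (k * e) x \<subseteq># m"
  proof (rule mset_subset_eqI)
    fix y
    show "count (orb Q (k * e) x) y \<le> count m y"
    proof (cases "y \<in> (\<lambda>i. x ^ (Q ^ i)) ` {..<e}")
      case True
      then have "count m y = count m x" using mcount by auto
      moreover have "count (orb Q (k * e) x) y \<le> k" unfolding cnt using cnt_e[of y] by (simp add: mult_le_cancel1)
      ultimately show ?thesis using k by simp
    next
      case False
      then have "count (orb Q e x) y = 0" unfolding orb_e by simp
      then show ?thesis by (simp add: cnt)
    qed
  qed
  moreover have "count (orb Q (k * e) x) x = k" using cnt cnt_ex by simp
  moreover have "x \<in> gf (Q ^ (k * e))" using e by (intro gf_mult_period) auto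
  moreover have "1 \<le> k * e" using k e by simp
  ultimately show ?thesis by blast
qed

lemma orb_stab:
  assumes Q: "ppow Q" and j: "j > 0" and x: "x \<in> gf (Q ^ j)"
  shows "stab Q (orb Q j x)"
proof -
  have "x \<in> T" using gf_T[OF ppow_power[OF Q j] x] .
  then show ?thesis using orb_frobenius[OF x] T_closed by (auto simp: stab_def orb_def)
qed

text \<open>Each completed period adds one more copy of x, so j can be recovered from the number of
  copies; this gives injectivity of the orbit splitting.\<close>

lemma orb_count_less:
  assumes "x \<in> gf (Q ^ i)" "i < j"
  shows "count (orb Q i x) x < count (orb Q j x) x"
proof -
  obtain d where d: "j = Suc i + d" using assms by (metis Suc_leI le_add_diff_inverse)
  have "orb Q j x = orb Q (Suc i) x + orb Q d (x ^ (Q ^ Suc i))" unfolding d by (rule orb_add)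
  moreover have "count (orb Q (Suc i) x) x = Suc (count (orb Q i x) x)"
    using assms by (simp add: orb_Suc gf_def)
  ultimately show ?thesis by simp
qed

text \<open>What is left of a multiset in \<open>FM\<close> after an orbit of length j is split off.
  The product form of the norm condition makes sense also for x = 0.\<close>

definition RM :: "nat \<Rightarrow> nat \<Rightarrow> complex \<Rightarrow> complex \<Rightarrow> nat \<Rightarrow> complex \<Rightarrow> complex multiset set" where
  "RM Q n \<nu> \<tau> j x =
    {m. stab Q m \<and> size m = n - j \<and> Nm Q j x * prod_mset m = \<nu> \<and> Tr Q j x + sum_mset m \<doteq> \<tau>}"

text \<open>
  The combinatorial form of the logarithmic derivative of the L-function in the classical proof of
  the Hasse-Davenport relation: choosing \<open>k\<close> copies of an element \<open>x\<close> of a stable multiset amounts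
  to splitting off \<open>k\<close> copies of the Frobenius orbit of \<open>x\<close>.
\<close>

lemma orbit_splitting_bij:
  assumes Q: "ppow Q"
  shows "bij_betw (\<lambda>(j, x, m). (m + orb Q j x, x, count (orb Q j x) x))
    (SIGMA j:{1..n}. SIGMA x:gf (Q ^ j). RM Q n \<nu> \<tau> j x)
    (SIGMA m:FM Q n \<nu> \<tau>. SIGMA x:set_mset m. {1..count m x})" (is "bij_betw ?h ?S' ?S")
  unfolding bij_betw_def
proof
  show "inj_on ?h ?S'"
  proof (rule inj_onI)
    fix u u' assume "u \<in> ?S'" "u' \<in> ?S'" "?h u = ?h u'"
    then obtain j x m j' m' where u: "u = (j, x, m)" "u' = (j', x, m')"
      and j: "j \<in> {1..n}" "x \<in> gf (Q ^ j)" "j' \<in> {1..n}" "x \<in> gf (Q ^ j')"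
      and eq: "m + orb Q j x = m' + orb Q j' x" "count (orb Q j x) x = count (orb Q j' x) x"
      by (cases u; cases u') auto
    have "j = j'"
      using orb_count_less[of x Q j j'] orb_count_less[of x Q j' j] j eq(2) by (cases j j' rule: linorder_cases) auto
    then show "u = u'" using eq u by simp
  qed
  show "?h ` ?S' = ?S"
  proof (intro equalityI subsetI)
    fix u assume "u \<in> ?h ` ?S'"
    then obtain j x m where u: "u = (m + orb Q j x, x, count (orb Q j x) x)"
      and j: "1 \<le> j" "j \<le> n" "x \<in> gf (Q ^ j)" and m: "m \<in> RM Q n \<nu> \<tau> j x" by auto
    have st: "stab Q (orb Q j x)" using j by (intro orb_stab Q) auto
    have "stab Q (m + orb Q j x)" using m st by (auto simp: stab_def RM_def)
    then have "m + orb Q j x \<in> FM Q n \<nu> \<tau>"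
      using m j by (auto simp: FM_def RM_def prod_orb sum_orb mult.commute add.commute)
    moreover have "count (orb Q j x) x \<ge> 1"
    proof -
      have "orb Q j x = orb Q 1 x + orb Q (j - 1) (x ^ (Q ^ 1))" using orb_add[of Q 1 "j - 1" x] j by simp
      then show ?thesis by (simp add: orb_Suc)
    qed
    moreover from this have "x \<in># m + orb Q j x"
      using count_greater_eq_one_iff[of "orb Q j x" x] by simp
    ultimately show "u \<in> ?S" unfolding u by auto
  next
    fix u assume "u \<in> ?S"
    then obtain m x k where u: "u = (m, x, k)" and m: "m \<in> FM Q n \<nu> \<tau>" and x: "x \<in># m"
      and k: "1 \<le> k" "k \<le> count m x" by auto
    have st: "stab Q m" using m by (simp add: FM_def)
    obtain j where j: "1 \<le> j" "x \<in> gf (Q ^ j)" "count (orb Q j x) x = k" "orb Q j x \<subseteq># m"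
      using orb_multiple[OF Q st x k] by blast
    define m' where "m' = m - orb Q j x"
    have mm: "m = m' + orb Q j x" using j by (simp add: m'_def)
    have so: "stab Q (orb Q j x)" using j by (intro orb_stab Q) auto
    have "stab Q m'" using st so unfolding stab_def mm by auto
    moreover have "size m' + j = n" using m by (simp add: FM_def mm)
    ultimately have "m' \<in> RM Q n \<nu> \<tau> j x" "j \<le> n"
      using m by (auto simp: RM_def FM_def mm prod_orb sum_orb mult.commute add.commute)
    then have "(j, x, m') \<in> ?S'" using j by auto
    moreover have "?h (j, x, m') = u" using j mm by (simp add: u)
    ultimately show "u \<in> ?h ` ?S'" by (rule rev_image_eqI[OF _ sym])
  qed
qed

text \<open>Both sides count the elements, with multiplicity, of all multisets in
  \<open>FM Q n \<nu> \<tau>\<close>. In the splitting, j = n leaves nothing and yields the first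
  count, j = n - 1 leaves one element c and yields the second, and a smaller j leaves a number of
  multisets that \<open>card_FM\<close> gives independently of \<tau>. Thus the sum of the first two
  counts does not depend on \<tau>.\<close>

lemma hasse_davenport_count:
  assumes Q: "ppow Q" and n: "n \<ge> 2" and nu: "\<nu> \<in> gf Q" "\<nu> \<noteq> 0" and tau: "\<tau> \<in> fx Q"
  shows "card {x \<in> gf (Q ^ n). Nm Q n x = \<nu> \<and> Tr Q n x \<doteq> \<tau>}
    + card {(y, c). y \<in> gf (Q ^ (n - 1)) \<and> c \<in> gf Q \<and> Nm Q (n - 1) y * c = \<nu> \<and> Tr Q (n - 1) y + c \<doteq> \<tau>}
    + (\<Sum>j\<in>{1..n - 2}. (Q ^ j - 1) * Q ^ (n - j - 2)) = n * Q ^ (n - 2)"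
proof -
  have fin_gf: "finite (gf (Q ^ j))" if "j > 0" for j
    using finite_gf ppow_ge_2[OF ppow_power[OF Q that]] by blast
  note FM = card_FM[OF Q n nu(1) tau]
  have "card (SIGMA m:FM Q n \<nu> \<tau>. SIGMA x:set_mset m. {1..count m x})
    = (\<Sum>m\<in>FM Q n \<nu> \<tau>. card (SIGMA x:set_mset m. {1..count m x}))"
    using FM by (intro card_SigmaI) auto
  also have "\<dots> = (\<Sum>m\<in>FM Q n \<nu> \<tau>. n)"
    by (intro sum.cong refl) (auto simp: FM_def card_SigmaI size_multiset_overloaded_eq)
  also have "\<dots> = n * Q ^ (n - 2)" using FM by simp
  finally have cS: "card (SIGMA m:FM Q n \<nu> \<tau>. SIGMA x:set_mset m. {1..count m x}) = n * Q ^ (n - 2)" .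
  \<comment> \<open>The element 0 has norm 0, so it cannot occur when \<nu> \<noteq> 0; this
    accounts for Q ^ j - 1 in the sum.\<close>
  have R0: "RM Q n \<nu> \<tau> j 0 = {}" if "j > 0" for j
  proof -
    have "Nm Q j 0 = 0" using that ppow_ge_2[OF Q] unfolding Nm_def
      by (auto simp: prod_zero_iff zero_power intro!: bexI[of _ 0])
    then show ?thesis using nu by (auto simp: RM_def)
  qed
  have Nm0: "Nm Q j x \<noteq> 0" if "x \<noteq> 0" for j x using that by (simp add: Nm_def)
  have TrA: "Tr Q j x \<in> A" if "j > 0" "x \<in> gf (Q ^ j)" for j x
    using Tr_fx[OF Q] gf_fx[OF ppow_power[OF Q that(1)]] fx_A that by blast
  have Rlow: "finite (RM Q n \<nu> \<tau> j x) \<and> card (RM Q n \<nu> \<tau> j x) = Q ^ (n - j - 2)"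
    if j: "j \<in> {1..n - 2}" and x: "x \<in> gf (Q ^ j)" "x \<noteq> 0" for j x
  proof -
    have j0: "j > 0" and jn: "n - j \<ge> 2" using j n by auto
    have Nmgf: "Nm Q j x \<in> gf Q" by (rule Nm_gf[OF x(1)])
    have Trfx: "Tr Q j x \<in> fx Q" using Tr_fx[OF Q] gf_fx[OF ppow_power[OF Q j0]] x by blast
    have "RM Q n \<nu> \<tau> j x = FM Q (n - j) (\<nu> / Nm Q j x) (\<tau> - Tr Q j x)"
    proof -
      have "Nm Q j x * prod_mset m = \<nu> \<longleftrightarrow> prod_mset m = \<nu> / Nm Q j x" for m
        using Nm0[OF x(2), of j] by (auto simp: field_simps)
      moreover have "Tr Q j x + sum_mset m \<doteq> \<tau> \<longleftrightarrow> sum_mset m \<doteq> \<tau> - Tr Q j x" if "stab Q m" for m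
      proof -
        have "sum_mset m \<in> A" using that T_A by (intro sum_mset_A) (auto simp: stab_def)
        then show ?thesis using fx_A[OF Trfx] fx_A[OF tau] by (simp add: cg_def algebra_simps)
      qed
      ultimately show ?thesis by (auto simp: RM_def FM_def)
    qed
    moreover have "finite (FM Q (n - j) (\<nu> / Nm Q j x) (\<tau> - Tr Q j x)) \<and>
        card (FM Q (n - j) (\<nu> / Nm Q j x) (\<tau> - Tr Q j x)) = Q ^ (n - j - 2)"
      by (rule card_FM[OF Q jn]) (use nu Nmgf tau Trfx in \<open>auto intro: gf_closed fx_closed[OF Q]\<close>)
    ultimately show ?thesis by simp
  qed
  have Rn: "RM Q n \<nu> \<tau> n x = (if Nm Q n x = \<nu> \<and> Tr Q n x \<doteq> \<tau> then {{#}} else {})" for x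
    by (auto simp: RM_def stab_def)
  \<comment> \<open>Stability of a singleton means c ^ Q = c, which is why the remaining element
    belongs to \<open>gf Q\<close>.\<close>
  have Rn1: "RM Q n \<nu> \<tau> (n - 1) x
    = (\<lambda>c. {#c#}) ` {c \<in> gf Q. Nm Q (n - 1) x * c = \<nu> \<and> Tr Q (n - 1) x + c \<doteq> \<tau>}" for x
  proof -
    have "m \<in> RM Q n \<nu> \<tau> (n - 1) x \<longleftrightarrow>
      (\<exists>c. m = {#c#} \<and> c \<in> gf Q \<and> Nm Q (n - 1) x * c = \<nu> \<and> Tr Q (n - 1) x + c \<doteq> \<tau>)" for m
    proof
      assume m: "m \<in> RM Q n \<nu> \<tau> (n - 1) x"
      then have "size m = 1" using n by (simp add: RM_def)
      then obtain c where "m = {#c#}" using size_1_singleton_mset by blast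
      then show "\<exists>c. m = {#c#} \<and> c \<in> gf Q \<and> Nm Q (n - 1) x * c = \<nu> \<and> Tr Q (n - 1) x + c \<doteq> \<tau>"
        using m by (auto simp: RM_def stab_def gf_def)
    next
      assume "\<exists>c. m = {#c#} \<and> c \<in> gf Q \<and> Nm Q (n - 1) x * c = \<nu> \<and> Tr Q (n - 1) x + c \<doteq> \<tau>"
      then show "m \<in> RM Q n \<nu> \<tau> (n - 1) x"
        using n gf_T[OF Q] by (auto simp: RM_def stab_def gf_def)
    qed
    then show ?thesis by blast
  qed
  have finR: "finite (RM Q n \<nu> \<tau> j x)" if j: "j \<in> {1..n}" and x: "x \<in> gf (Q ^ j)" for j x
  proof -
    consider "x = 0" | "j = n" | "j = n - 1" | "x \<noteq> 0" "j \<in> {1..n - 2}" using j by fastforce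
    then show ?thesis
    proof cases
      case 1 then show ?thesis using R0 j by simp
    next
      case 2 then show ?thesis by (simp add: Rn)
    next
      case 3 then show ?thesis unfolding Rn1 3 using fin_gf[of 1] by simp
    next
      case 4 then show ?thesis using Rlow x by blast
    qed
  qed
  define w where "w = (\<lambda>j. \<Sum>x\<in>gf (Q ^ j). card (RM Q n \<nu> \<tau> j x))"
  have "card (SIGMA j:{1..n}. SIGMA x:gf (Q ^ j). RM Q n \<nu> \<tau> j x)
    = (\<Sum>j\<in>{1..n}. card (SIGMA x:gf (Q ^ j). RM Q n \<nu> \<tau> j x))"
    using finR fin_gf by (intro card_SigmaI) (auto intro!: finite_SigmaI)
  also have "\<dots> = (\<Sum>j\<in>{1..n}. w j)" unfolding w_def
    using finR fin_gf by (intro sum.cong refl card_SigmaI) auto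
  also have "(\<Sum>j\<in>{1..n}. w j) = w n + (w (n - 1) + (\<Sum>j\<in>{1..n - 2}. w j))"
  proof -
    have "{1..n} = insert n (insert (n - 1) {1..n - 2})" using n by auto
    moreover
    have "n - 1 \<notin> {1..n - 2}" "n \<notin> insert (n - 1) {1..n - 2}" using n by auto
    ultimately show ?thesis by simp
  qed
  finally have cS': "card (SIGMA j:{1..n}. SIGMA x:gf (Q ^ j). RM Q n \<nu> \<tau> j x)
    = w n + w (n - 1) + (\<Sum>j\<in>{1..n - 2}. w j)" by simp
  have "w n = (\<Sum>x\<in>gf (Q ^ n). if Nm Q n x = \<nu> \<and> Tr Q n x \<doteq> \<tau> then 1 else 0)"
    unfolding w_def Rn by (intro sum.cong) auto
  also have "\<dots> = card {x \<in> gf (Q ^ n). Nm Q n x = \<nu> \<and> Tr Q n x \<doteq> \<tau>}"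
    using fin_gf[of n] n by (simp add: sum.If_cases Int_def)
  finally have wn: "w n = card {x \<in> gf (Q ^ n). Nm Q n x = \<nu> \<and> Tr Q n x \<doteq> \<tau>}" .
  have "w (n - 1) = (\<Sum>y\<in>gf (Q ^ (n - 1)). card {c \<in> gf Q. Nm Q (n - 1) y * c = \<nu> \<and> Tr Q (n - 1) y + c \<doteq> \<tau>})"
    unfolding w_def Rn1 by (intro sum.cong refl card_image) (auto simp: inj_on_def)
  also have "\<dots> = card (SIGMA y:gf (Q ^ (n - 1)). {c \<in> gf Q. Nm Q (n - 1) y * c = \<nu> \<and> Tr Q (n - 1) y + c \<doteq> \<tau>})"
    using fin_gf[of "n - 1"] fin_gf[of 1] n by (intro card_SigmaI[symmetric]) auto
  also have "(SIGMA y:gf (Q ^ (n - 1)). {c \<in> gf Q. Nm Q (n - 1) y * c = \<nu> \<and> Tr Q (n - 1) y + c \<doteq> \<tau>})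
    = {(y, c). y \<in> gf (Q ^ (n - 1)) \<and> c \<in> gf Q \<and> Nm Q (n - 1) y * c = \<nu> \<and> Tr Q (n - 1) y + c \<doteq> \<tau>}" by auto
  finally have wn1: "w (n - 1) = card \<dots>" .
  have "w j = (Q ^ j - 1) * Q ^ (n - j - 2)" if j: "j \<in> {1..n - 2}" for j
  proof -
    have j0: "j > 0" using j by simp
    have "0 \<in> gf (Q ^ j)" using ppow_ge_2[OF Q] by (intro gf_closed) simp
    then have "w j = (\<Sum>x\<in>gf (Q ^ j) - {0}. card (RM Q n \<nu> \<tau> j x))"
      unfolding w_def using fin_gf[OF j0] R0[OF j0] by (simp add: sum.remove)
    also have "\<dots> = (\<Sum>x\<in>gf (Q ^ j) - {0}. Q ^ (n - j - 2))"
      using Rlow[OF j] by (intro sum.cong) auto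
    also have "\<dots> = (Q ^ j - 1) * Q ^ (n - j - 2)"
      using card_gf[OF ppow_ge_2[OF ppow_power[OF Q j0]]] \<open>0 \<in> gf (Q ^ j)\<close> by (simp add: card_Diff_singleton)
    finally show ?thesis .
  qed
  then have "(\<Sum>j\<in>{1..n - 2}. w j) = (\<Sum>j\<in>{1..n - 2}. (Q ^ j - 1) * Q ^ (n - j - 2))"
    by (intro sum.cong) auto
  then show ?thesis
    using cS cS' bij_betw_same_card[OF orbit_splitting_bij[OF Q, of n \<nu> \<tau>]] wn wn1 by simp
qed

section \<open>Additive characters\<close>

lemma Tr_add: "ppow Q \<Longrightarrow> x \<in> A \<Longrightarrow> y \<in> A \<Longrightarrow> Tr Q j (x + y) \<doteq> Tr Q j x + Tr Q j y"
proof -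
  assume Q: "ppow Q" and xy: "x \<in> A" "y \<in> A"
  have "(x + y) ^ (Q ^ i) \<doteq> x ^ (Q ^ i) + y ^ (Q ^ i)" for i
    using ppow_add[OF ppow_power[OF Q]] xy by (cases "i = 0") auto
  then show ?thesis unfolding Tr_def sum.distrib[symmetric] by (intro cg_sum)
qed

lemma Tr_cg: "x \<doteq> y \<Longrightarrow> Tr Q j x \<doteq> Tr Q j y"
  unfolding Tr_def by (intro cg_sum cg_power)

lemma Tr_mult:
  assumes "c \<in> fx Q" "x \<in> A"
  shows "Tr Q j (c * x) \<doteq> c * Tr Q j x"
  unfolding Tr_def sum_distrib_left power_mult_distrib
  using fx_subset[OF assms(1)] assms(2) by (intro cg_sum cg_mult) (auto simp: fx_def)

text \<open>The trace is a polynomial function of degree Q ^ (j - 1), too small to vanish on all Q ^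
  j elements.\<close>

lemma Tr_nonzero:
  assumes Q: "ppow Q" and j: "j > 0"
  shows "\<exists>x\<in>gf (Q ^ j). \<not> Tr Q j x \<doteq> 0"
proof (rule ccontr)
  assume "\<not> ?thesis"
  then have all: "Tr Q j x \<doteq> 0" if "x \<in> gf (Q ^ j)" for x using that by blast
  have Q2: "Q \<ge> 2" using ppow_ge_2[OF Q] .
  define f where "f = (\<Sum>i<j. monom (1 :: complex) (Q ^ i))"
  have cf: "coeff f d = of_nat (card {i. i < j \<and> Q ^ i = d})" for d
    unfolding f_def coeff_sum by (simp add: sum.If_cases Int_def)
  have "degree f \<le> Q ^ (j - 1)"
  proof (rule degree_le, intro allI impI)
    fix d assume d: "Q ^ (j - 1) < d"
    have "Q ^ i \<noteq> d" if "i < j" for i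
    proof -
      have "Q ^ i \<le> Q ^ (j - 1)" using that Q2 by (intro power_increasing) auto
      then show ?thesis using d by simp
    qed
    then have "{i. i < j \<and> Q ^ i = d} = {}" by blast
    then show "coeff f d = 0" by (simp only: cf card.empty of_nat_0)
  qed
  moreover have "coeff f (Q ^ (j - 1)) = 1"
  proof -
    have "{i. i < j \<and> Q ^ i = Q ^ (j - 1)} = {j - 1}" using j Q2 by (auto simp: power_inject_exp)
    then show ?thesis by (simp only: cf card_1_singleton_iff) simp
  qed
  ultimately have df: "degree f = Q ^ (j - 1)" by (metis antisym le_degree zero_neq_one)
  have lf: "lead_coeff f = 1" using df \<open>coeff f (Q ^ (j - 1)) = 1\<close> by simp
  have "card (gf (Q ^ j)) \<le> degree f"
  proof (rule conjunct2[OF roots_le_degree[OF lf]])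
    show "coeff f i \<in> A" for i by (simp add: cf)
    show "gf (Q ^ j) \<subseteq> T" using gf_T[OF ppow_power[OF Q j]] by blast
    show "poly f t \<doteq> 0" if "t \<in> gf (Q ^ j)" for t
      using all[OF that] by (simp add: f_def poly_sum poly_monom Tr_def)
  qed
  then have "Q ^ j \<le> Q ^ (j - 1)" using card_gf[OF ppow_ge_2[OF ppow_power[OF Q j]]] df by simp
  then show False using Q2 j by (simp add: power_increasing_iff)
qed

text \<open>The integers below p give p distinct classes, and \<open>gf p\<close> has only p
  elements.\<close>

lemma prime_field_int:
  assumes "u \<in> fx p"
  shows "\<exists>c<p. of_nat c \<doteq> u"
proof -
  have p2: "p \<ge> 2" using prime_p by (rule prime_ge_2_nat)
  have "inj_on (\<lambda>c. rp (of_nat c)) {..<p}"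
  proof (rule inj_onI)
    fix c d assume cd: "c \<in> {..<p}" "d \<in> {..<p}" "rp (of_nat c) = rp (of_nat d)"
    have "of_nat c \<doteq> of_nat d"
      using cg_trans[OF cg_sym[OF rp_fx(2)[OF ppow_p fx_closed(10)[OF ppow_p, of c]]]]
        rp_fx(2)[OF ppow_p fx_closed(10)[OF ppow_p, of d]] cd by simp
    then have "int c mod int p = int d mod int p" using of_int_cg[of "int c" "int d"] by simp
    then show "c = d" using cd by simp
  qed
  moreover have "(\<lambda>c. rp (of_nat c)) ` {..<p} \<subseteq> gf p"
    using rp_fx(1)[OF ppow_p fx_closed(10)[OF ppow_p]] by blast
  ultimately have "(\<lambda>c. rp (of_nat c)) ` {..<p} = gf p"
    using card_gf[OF p2] finite_gf[OF p2] by (intro card_subset_eq) (auto simp: card_image)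
  then obtain c where c: "c < p" "rp u = rp (of_nat c)" using rp_fx(1)[OF ppow_p assms] by blast
  then have "of_nat c \<doteq> u"
    using cg_trans[OF cg_sym[OF rp_fx(2)[OF ppow_p fx_closed(10)[OF ppow_p, of c]]]]
      rp_fx(2)[OF ppow_p assms] by simp
  then show ?thesis using c by blast
qed

text \<open>The character c |-> exp (2 pi i c / p) of the prime field. The argument stands for a
  residue class, whereas the value is a genuine complex number; \<open>ech_eq\<close> shows that the
  chosen integer does not matter.\<close>

definition ech :: "complex \<Rightarrow> complex" where
  "ech u = cis (2 * pi * real (SOME c. c < p \<and> of_nat c \<doteq> u) / real p)"

lemma ech_eq:
  assumes c: "of_nat c \<doteq> u"
  shows "ech u = cis (2 * pi * real c / real p)"
proof -
  have p0: "p > 0" using prime_p by (rule prime_gt_0_nat)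
  define d where "d = (SOME c. c < p \<and> of_nat c \<doteq> u)"
  have "u \<in> fx p" by (rule fx_cg[OF fx_closed(10)[OF ppow_p] c])
  then have d: "d < p \<and> of_nat d \<doteq> u" unfolding d_def by (rule someI_ex[OF prime_field_int])
  then have "of_nat c \<doteq> of_nat d" using cg_trans[OF c cg_sym] by blast
  then have "int c mod int p = int d mod int p" using of_int_cg[of "int c" "int d"] by simp
  then have "c mod p = d" using d by (simp flip: of_nat_mod)
  then have "c = p * (c div p) + d" using mult_div_mod_eq[of p c] by simp
  then have "real c = real p * real (c div p) + real d" by (metis of_nat_add of_nat_mult)
  then have "2 * pi * real c / real p = 2 * pi * real (c div p) + 2 * pi * real d / real p"
    using p0 by (simp add: field_simps)
  then have "cis (2 * pi * real c / real p) = cis (2 * pi * real (c div p)) * cis (2 * pi * real d / real p)"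
    by (simp only: cis_mult)
  also have "cis (2 * pi * real (c div p)) = 1" by (intro cis_multiple_2pi) auto
  finally show ?thesis by (simp add: ech_def d_def)
qed

lemma ech_add:
  assumes "u \<in> fx p" "v \<in> fx p"
  shows "ech (u + v) = ech u * ech v"
proof -
  obtain c d where cd: "of_nat c \<doteq> u" "of_nat d \<doteq> v"
    using prime_field_int[OF assms(1)] prime_field_int[OF assms(2)] by blast
  then have "of_nat (c + d) \<doteq> u + v" using cg_add[OF cd] by simp
  then have "ech (u + v) = cis (2 * pi * real (c + d) / real p)" by (rule ech_eq)
  also have "\<dots> = ech u * ech v"
    unfolding ech_eq[OF cd(1)] ech_eq[OF cd(2)] cis_mult by (simp add: distrib_left add_divide_distrib)
  finally show ?thesis .
qed

lemma ech_cg: "u \<in> fx p \<Longrightarrow> u \<doteq> v \<Longrightarrow> ech u = ech v"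
proof -
  assume u: "u \<in> fx p" and uv: "u \<doteq> v"
  obtain c where c: "of_nat c \<doteq> u" using prime_field_int[OF u] by blast
  show ?thesis unfolding ech_eq[OF c] ech_eq[OF cg_trans[OF c uv]] ..
qed

lemma ech_eq_1:
  assumes u: "u \<in> fx p" and "ech u = 1"
  shows "u \<doteq> 0"
proof -
  have p0: "p > 0" using prime_p by (rule prime_gt_0_nat)
  obtain c where c: "c < p" "of_nat c \<doteq> u" using prime_field_int[OF u] by blast
  have "inj_on (\<lambda>k. cis (2 * pi * real k / real p)) {..<p}"
    using bij_betw_roots_unity[OF p0] by (simp add: bij_betw_def)
  moreover have "cis (2 * pi * real c / real p) = cis (2 * pi * real 0 / real p)"
    using assms(2) ech_eq[OF c(2)] by simp
  ultimately have "c = 0" using c p0 inj_onD[of "\<lambda>k. cis (2 * pi * real k / real p)" "{..<p}" c 0] by simp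
  then show ?thesis using c cg_sym by auto
qed

text \<open>Translation by \<open>x0\<close> permutes S, so the sum equals f x0 times itself. It is
  stated for subsets closed under field addition in order to cover both whole fields and the
  subgroup H.\<close>

lemma char_sum_zero:
  fixes f :: "complex \<Rightarrow> complex"
  assumes N: "ppow N" and S: "S \<subseteq> gf N" and add: "\<And>x y. x \<in> S \<Longrightarrow> y \<in> S \<Longrightarrow> rp (x + y) \<in> S"
    and f: "\<And>x y. x \<in> S \<Longrightarrow> y \<in> S \<Longrightarrow> f (rp (x + y)) = f x * f y"
    and x0: "x0 \<in> S" "f x0 \<noteq> 1"
  shows "sum f S = 0"
proof -
  have fin: "finite S" using finite_subset[OF S finite_gf[OF ppow_ge_2[OF N]]] .
  have inj: "inj_on (\<lambda>x. rp (x + x0)) S"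
  proof (rule inj_onI)
    fix x y assume xy: "x \<in> S" "y \<in> S" "rp (x + x0) = rp (y + x0)"
    have fx: "x + x0 \<in> fx N" "y + x0 \<in> fx N" using xy x0 S gf_fx[OF N] by (auto intro!: fx_closed[OF N])
    have "x + x0 \<doteq> y + x0"
      using cg_trans[OF cg_sym[OF rp_fx(2)[OF N fx(1)]]] rp_fx(2)[OF N fx(2)] xy by simp
    then have "x \<doteq> y" using xy S gf_A[OF N] by (auto simp: cg_def)
    then show "x = y" using xy S gf_cg_eq[OF N] by blast
  qed
  have "(\<lambda>x. rp (x + x0)) ` S = S"
    using add x0 inj fin by (intro card_subset_eq) (auto simp: card_image)
  then have "sum f S = sum f ((\<lambda>x. rp (x + x0)) ` S)" by simp
  also have "\<dots> = (\<Sum>x\<in>S. f x * f x0)" unfolding sum.reindex[OF inj] using f x0 by (intro sum.cong) auto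
  also have "\<dots> = f x0 * sum f S" by (simp add: sum_distrib_left mult.commute)
  finally have "(f x0 - 1) * sum f S = 0" by (simp add: algebra_simps)
  then show ?thesis using x0 by simp
qed

end

section \<open>Characters and norms on the fields of order Q ^ j\<close>

locale field_pair = residue +
  fixes e Q l :: nat
  assumes e_pos: "e > 0" and Q_eq: "Q = p ^ e" and l_pos: "l > 0"
begin

lemma ppQ: "ppow Q"
  using e_pos by (auto simp: ppow_def Q_eq)

lemma Q_ge_2: "Q \<ge> 2"
  by (rule ppow_ge_2[OF ppQ])

definition psi :: "complex \<Rightarrow> complex" where
  "psi u = ech (Tr p e u)"

lemma Tr_p_fx: "u \<in> fx Q \<Longrightarrow> Tr p e u \<in> fx p"
  using Tr_fx[OF ppow_p, of u e] by (simp add: Q_eq)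

lemma psi_cg: "u \<in> fx Q \<Longrightarrow> u \<doteq> v \<Longrightarrow> psi u = psi v"
  unfolding psi_def by (intro ech_cg Tr_cg Tr_p_fx)

lemma psi_add: "u \<in> fx Q \<Longrightarrow> v \<in> fx Q \<Longrightarrow> psi (u + v) = psi u * psi v"
proof -
  assume uv: "u \<in> fx Q" "v \<in> fx Q"
  have "psi (u + v) = ech (Tr p e u + Tr p e v)" unfolding psi_def
    by (rule ech_cg[OF Tr_p_fx[OF fx_closed(3)[OF ppQ uv]] Tr_add[OF ppow_p fx_A[OF uv(1)] fx_A[OF uv(2)]]])
  also have "\<dots> = psi u * psi v" unfolding psi_def using uv by (simp add: ech_add Tr_p_fx)
  finally show ?thesis .
qed

lemma psi_0: "psi 0 = 1"
proof -
  have "Tr p e 0 = 0" unfolding Tr_def using prime_gt_0_nat[OF prime_p] by (simp add: zero_power)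
  moreover have "ech 0 = 1" using ech_eq[of 0 0] by simp
  ultimately show ?thesis by (simp add: psi_def)
qed

lemma psi_nontrivial: "\<exists>u\<in>gf Q. psi u \<noteq> 1"
proof -
  obtain u where u: "u \<in> gf Q" "\<not> Tr p e u \<doteq> 0" using Tr_nonzero[OF ppow_p e_pos] by (auto simp: Q_eq)
  then show ?thesis using ech_eq_1[OF Tr_p_fx] gf_fx[OF ppQ] by (auto simp: psi_def)
qed

definition Psi :: "nat \<Rightarrow> complex \<Rightarrow> complex" where
  "Psi j x = psi (Tr Q j x)"

lemma ppj: "j > 0 \<Longrightarrow> ppow (Q ^ j)"
  by (rule ppow_power[OF ppQ])

lemma finite_gfj: "j > 0 \<Longrightarrow> finite (gf (Q ^ j))" and card_gfj: "j > 0 \<Longrightarrow> card (gf (Q ^ j)) = Q ^ j"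
  using finite_gf card_gf ppow_ge_2[OF ppj] by blast+

lemma Psi_cg: "x \<in> fx (Q ^ j) \<Longrightarrow> x \<doteq> y \<Longrightarrow> Psi j x = Psi j y"
  unfolding Psi_def by (intro psi_cg Tr_cg Tr_fx ppQ)

lemma Psi_add: "j > 0 \<Longrightarrow> x \<in> fx (Q ^ j) \<Longrightarrow> y \<in> fx (Q ^ j) \<Longrightarrow> Psi j (x + y) = Psi j x * Psi j y"
proof -
  assume j: "j > 0" and xy: "x \<in> fx (Q ^ j)" "y \<in> fx (Q ^ j)"
  have "Psi j (x + y) = psi (Tr Q j x + Tr Q j y)" unfolding Psi_def
    by (rule psi_cg[OF Tr_fx[OF ppQ fx_closed(3)[OF ppj[OF j] xy]]
        Tr_add[OF ppQ fx_A[OF xy(1)] fx_A[OF xy(2)]]])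
  also have "\<dots> = Psi j x * Psi j y" unfolding Psi_def using xy by (simp add: psi_add Tr_fx[OF ppQ])
  finally show ?thesis .
qed

lemma Psi_0: "j > 0 \<Longrightarrow> Psi j 0 = 1"
proof -
  assume "j > 0"
  then have "Tr Q j 0 = 0" unfolding Tr_def using Q_ge_2 by (simp add: zero_power)
  then show ?thesis by (simp add: Psi_def psi_0)
qed

lemma gf_fxj: "j > 0 \<Longrightarrow> x \<in> gf (Q ^ j) \<Longrightarrow> x \<in> fx (Q ^ j)"
  using gf_fx[OF ppj] by blast

text \<open>An element y of nonzero trace is scaled by c from the field with Q elements until its
  trace is a given u with psi u \<noteq> 1; division by a then absorbs the twist.\<close>

lemma Psi_nontrivial:
  assumes j: "j > 0" and a: "a \<in> gf (Q ^ j)" "a \<noteq> 0"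
  shows "\<exists>x\<in>gf (Q ^ j). Psi j (a * x) \<noteq> 1"
proof -
  obtain y where y: "y \<in> gf (Q ^ j)" "\<not> Tr Q j y \<doteq> 0" using Tr_nonzero[OF ppQ j] by blast
  obtain u where u: "u \<in> gf Q" "psi u \<noteq> 1" using psi_nontrivial by blast
  have tfx: "Tr Q j y \<in> fx Q" using Tr_fx[OF ppQ gf_fxj[OF j y(1)]] .
  define t where "t = rp (Tr Q j y)"
  have t: "t \<in> gf Q" "t \<doteq> Tr Q j y" using rp_fx[OF ppQ tfx] by (auto simp: t_def)
  have t0: "t \<noteq> 0" using t y cg_sym by auto
  define c where "c = u / t"
  have c: "c \<in> gf Q" unfolding c_def by (intro gf_closed u t)
  have cj: "c \<in> gf (Q ^ j)" by (rule gf_subset[OF c])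
  define x where "x = c * y / a"
  have x: "x \<in> gf (Q ^ j)" unfolding x_def by (intro gf_closed cj y a)
  have "a * x = c * y" using a by (simp add: x_def)
  have cfx: "c \<in> fx Q" using c gf_fx[OF ppQ] by blast
  have yA: "y \<in> A" using gf_A[OF ppj[OF j] y(1)] .
  have "Tr Q j (c * y) \<doteq> c * Tr Q j y" by (rule Tr_mult[OF cfx yA])
  also have "\<dots> \<doteq> c * t" by (rule cg_mult[OF cg_refl[OF fx_A[OF cfx]] cg_sym[OF t(2)]])
  also have "c * t = u" using t0 by (simp add: c_def)
  finally have "psi (Tr Q j (c * y)) = psi u"
    using gf_fxj[OF j gf_closed(3)[OF cj y(1)]] by (intro psi_cg Tr_fx ppQ)
  then show ?thesis using x u \<open>a * x = c * y\<close> by (intro bexI[of _ x]) (auto simp: Psi_def)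
qed

lemma rp_add_gf: "j > 0 \<Longrightarrow> x \<in> gf (Q ^ j) \<Longrightarrow> y \<in> gf (Q ^ j) \<Longrightarrow> rp (x + y) \<in> gf (Q ^ j) \<and> rp (x + y) \<doteq> x + y"
  using rp_fx[OF ppj, of j "x + y"] fx_closed(3)[OF ppj] gf_fxj by blast

lemma Psi_mult_add:
  assumes j: "j > 0" and gf: "a \<in> gf (Q ^ j)" "x \<in> gf (Q ^ j)" "y \<in> gf (Q ^ j)" "w \<in> gf (Q ^ j)"
    and w: "w \<doteq> x + y"
  shows "Psi j (a * w) = Psi j (a * x) * Psi j (a * y)"
proof -
  have "a * w \<doteq> a * (x + y)" by (rule cg_mult[OF cg_refl[OF gf_A[OF ppj[OF j] gf(1)]] w])
  then have "Psi j (a * w) = Psi j (a * x + a * y)"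
    using Psi_cg[OF gf_fxj[OF j gf_closed(3)[OF gf(1,4)]]] by (simp add: distrib_left)
  also have "\<dots> = Psi j (a * x) * Psi j (a * y)"
    by (rule Psi_add[OF j gf_fxj[OF j gf_closed(3)[OF gf(1,2)]] gf_fxj[OF j gf_closed(3)[OF gf(1,3)]]])
  finally show ?thesis .
qed

lemma Psi_sum:
  assumes j: "j > 0" and a: "a \<in> gf (Q ^ j)"
  shows "(\<Sum>x\<in>gf (Q ^ j). Psi j (a * x)) = (if a = 0 then of_nat (Q ^ j) else 0)"
proof (cases "a = 0")
  case True
  then show ?thesis using Psi_0[OF j] card_gfj[OF j] by simp
next
  case False
  obtain x0 where x0: "x0 \<in> gf (Q ^ j)" "Psi j (a * x0) \<noteq> 1" using Psi_nontrivial[OF j a False] by blast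
  have "(\<Sum>x\<in>gf (Q ^ j). Psi j (a * x)) = 0"
  proof (rule char_sum_zero[OF ppj[OF j] order_refl _ _ x0(1)])
    show "Psi j (a * x0) \<noteq> 1" by (rule x0)
    fix x y assume xy: "x \<in> gf (Q ^ j)" "y \<in> gf (Q ^ j)"
    show "rp (x + y) \<in> gf (Q ^ j)" using rp_add_gf[OF j xy] by blast
    show "Psi j (a * rp (x + y)) = Psi j (a * x) * Psi j (a * y)"
      using rp_add_gf[OF j xy] by (intro Psi_mult_add j a xy) auto
  qed
  then show ?thesis using False by simp
qed

lemma zero_gfj [simp]: "0 \<in> gf (Q ^ j)" and zero_gf [simp]: "0 \<in> gf Q"
  using Q_ge_2 by (auto intro!: gf_closed)

lemma Psi_sum_nz:
  assumes j: "j > 0" and a: "a \<in> gf (Q ^ j)"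
  shows "(\<Sum>x\<in>gf (Q ^ j) - {0}. Psi j (a * x)) = (if a = 0 then of_nat (Q ^ j) - 1 else - 1)"
  using Psi_sum[OF assms] Psi_0[OF j] finite_gfj[OF j]
  by (simp add: sum_diff1)

lemma psi_sum:
  assumes a: "a \<in> gf Q" "a \<noteq> 0"
  shows "(\<Sum>u\<in>gf Q. psi (a * u)) = 0" "(\<Sum>u\<in>gf Q - {0}. psi (a * u)) = - 1"
proof -
  have "Psi 1 u = psi u" for u by (simp add: Psi_def Tr_def)
  then show "(\<Sum>u\<in>gf Q. psi (a * u)) = 0" "(\<Sum>u\<in>gf Q - {0}. psi (a * u)) = - 1"
    using Psi_sum[of 1 a] Psi_sum_nz[of 1 a] a by simp_all
qed

text \<open>The number (Q ^ j - 1) / (Q - 1): the norm is the power map with this exponent, and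
  every nonzero norm value is taken this many times.\<close>

definition Pn :: "nat \<Rightarrow> nat" where
  "Pn j = (\<Sum>i<j. Q ^ i)"

lemma Pn_mult: "Pn j * (Q - 1) = Q ^ j - 1"
proof -
  have "(\<Sum>i<j. Q ^ i) * (Q - 1) + 1 = Q ^ j"
  proof (induction j)
    case (Suc j)
    have "Q ^ j * (Q - 1) + Q ^ j = Q ^ j * Q" using Q_ge_2 by (cases Q) auto
    then show ?case using Suc by (simp add: algebra_simps)
  qed simp
  then show ?thesis unfolding Pn_def by simp
qed

lemma Pn_pos: "j > 0 \<Longrightarrow> Pn j > 0"
  using Q_ge_2 by (auto simp: Pn_def intro!: sum_pos)

lemma Nm_eq: "Nm Q j x = x ^ Pn j"
  by (simp add: Nm_def Pn_def power_sum)

lemma Nm_mult: "Nm Q j (x * y) = Nm Q j x * Nm Q j y" and Nm_divide: "Nm Q j (x / y) = Nm Q j x / Nm Q j y"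
  by (simp_all add: Nm_eq power_mult_distrib power_divide)

lemma Nm_0_iff: "j > 0 \<Longrightarrow> Nm Q j x = 0 \<longleftrightarrow> x = 0"
  using Pn_pos[of j] by (simp add: Nm_eq)

text \<open>Every complex \<open>Pn j\<close>-th root of \<nu> is automatically a root of unity of
  order dividing Q ^ j - 1, so the fibre consists of all complex roots of the equation.\<close>

lemma card_Nm_fiber:
  assumes j: "j > 0" and nu: "\<nu> \<in> gf Q" "\<nu> \<noteq> 0"
  shows "card {x \<in> gf (Q ^ j). Nm Q j x = \<nu>} = Pn j"
proof -
  have "x \<in> gf (Q ^ j)" if "x ^ Pn j = \<nu>" for x
  proof -
    have "x ^ (Q ^ j - 1) = \<nu> ^ (Q - 1)" unfolding Pn_mult[symmetric] power_mult that ..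
    also have "\<dots> = 1" using nu gf_eq[of Q] Q_ge_2 by auto
    finally show ?thesis using gf_eq[of "Q ^ j"] Q_ge_2 by simp
  qed
  then have "{x \<in> gf (Q ^ j). Nm Q j x = \<nu>} = {x. x ^ Pn j = \<nu>}" by (auto simp: Nm_eq)
  then show ?thesis using card_nth_roots[OF nu(2) Pn_pos[OF j]] by simp
qed

section \<open>Character sums of the construction\<close>

text \<open>Both character sums are grouped by the trace value \<tau>. The two weights of \<tau> add
  up to the constant \<open>K\<close>, and the sum of \<open>psi\<close> over the whole field
  vanishes.\<close>

lemma hasse_davenport_sum:
  assumes nu: "\<nu> \<in> gf Q" "\<nu> \<noteq> 0"
  shows "(\<Sum>x\<in>{x \<in> gf (Q ^ Suc l). Nm Q (Suc l) x = \<nu>}. Psi (Suc l) x)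
    = - (\<Sum>(y, c)\<in>{(y, c). y \<in> gf (Q ^ l) \<and> c \<in> gf Q \<and> Nm Q l y * c = \<nu>}. Psi l y * psi c)"
    (is "sum _ ?X = - sum _ ?Y")
proof -
  define n where "n = Suc l"
  have n2: "n \<ge> 2" and n0: "n > 0" using l_pos by (auto simp: n_def)
  have finX: "finite ?X" using finite_gfj[of "Suc l"] by simp
  have "?Y \<subseteq> gf (Q ^ l) \<times> gf Q" by auto
  then have finY: "finite ?Y" using finite_gfj[OF l_pos] finite_gf[OF Q_ge_2] by (meson finite_SigmaI finite_subset)
  define g where "g = (\<lambda>x. rp (Tr Q n x))"
  define h where "h = (\<lambda>(y, c). rp (Tr Q l y + c))"
  have trx: "Tr Q n x \<in> fx Q" if "x \<in> gf (Q ^ n)" for x using Tr_fx[OF ppQ gf_fxj[OF n0 that]] .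
  have tr_y: "Tr Q l y \<in> fx Q" if "y \<in> gf (Q ^ l)" for y using Tr_fx[OF ppQ gf_fxj[OF l_pos that]] .
  have gffx: "c \<in> fx Q" if "c \<in> gf Q" for c using gf_fx[OF ppQ] that by blast
  have rp_iff: "rp w = \<tau> \<longleftrightarrow> w \<doteq> \<tau>" if "w \<in> fx Q" "\<tau> \<in> gf Q" for w \<tau>
    using rp_fx(2)[OF ppQ that(1)] rp_eqI[OF gf_T[OF ppQ that(2)]] cg_sym by metis
  define a where "a = (\<lambda>\<tau>. card {x \<in> ?X. g x = \<tau>})"
  define b where "b = (\<lambda>\<tau>. card {yc \<in> ?Y. h yc = \<tau>})"
  define K where "K = n * Q ^ (n - 2) - (\<Sum>j\<in>{1..n - 2}. (Q ^ j - 1) * Q ^ (n - j - 2))"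
  have ab: "a \<tau> + b \<tau> = K" if "\<tau> \<in> gf Q" for \<tau>
  proof -
    have 1: "{x \<in> ?X. g x = \<tau>} = {x \<in> gf (Q ^ n). Nm Q n x = \<nu> \<and> Tr Q n x \<doteq> \<tau>}"
      using rp_iff[OF trx that] by (auto simp: g_def n_def)
    have 2: "{yc \<in> ?Y. h yc = \<tau>} = {(y, c). y \<in> gf (Q ^ (n - 1)) \<and> c \<in> gf Q
        \<and> Nm Q (n - 1) y * c = \<nu> \<and> Tr Q (n - 1) y + c \<doteq> \<tau>}"
      using rp_iff[OF fx_closed(3)[OF ppQ tr_y gffx] that] by (auto simp: h_def n_def)
    show ?thesis unfolding a_def b_def K_def 1 2
      using hasse_davenport_count[OF ppQ n2 nu gffx[OF that]] by linarith
  qed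
  have "(\<Sum>x\<in>?X. Psi n x) = (\<Sum>\<tau>\<in>gf Q. \<Sum>x\<in>{x \<in> ?X. g x = \<tau>}. Psi n x)"
    using rp_fx(1)[OF ppQ trx] finX finite_gf[OF Q_ge_2]
    by (intro sum.group[symmetric]) (auto simp: g_def n_def)
  also have "\<dots> = (\<Sum>\<tau>\<in>gf Q. of_nat (a \<tau>) * psi \<tau>)"
  proof (intro sum.cong refl)
    fix \<tau> assume tau: "\<tau> \<in> gf Q"
    have "Psi n x = psi \<tau>" if "x \<in> {x \<in> ?X. g x = \<tau>}" for x
      using that rp_fx(2)[OF ppQ trx, of x] psi_cg[OF gffx[OF tau], of "Tr Q n x"]
      by (auto simp: g_def n_def Psi_def)
    then show "(\<Sum>x\<in>{x \<in> ?X. g x = \<tau>}. Psi n x) = of_nat (a \<tau>) * psi \<tau>" by (simp add: a_def)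
  qed
  finally have sX: "(\<Sum>x\<in>?X. Psi n x) = (\<Sum>\<tau>\<in>gf Q. of_nat (a \<tau>) * psi \<tau>)" .
  define f where "f = (\<lambda>(y, c). Psi l y * psi c)"
  have "sum f ?Y = (\<Sum>\<tau>\<in>gf Q. \<Sum>yc\<in>{yc \<in> ?Y. h yc = \<tau>}. f yc)"
    using rp_fx(1)[OF ppQ fx_closed(3)[OF ppQ tr_y gffx]] finY finite_gf[OF Q_ge_2]
    by (intro sum.group[symmetric]) (auto simp: h_def)
  also have "\<dots> = (\<Sum>\<tau>\<in>gf Q. of_nat (b \<tau>) * psi \<tau>)"
  proof (intro sum.cong refl)
    fix \<tau> assume tau: "\<tau> \<in> gf Q"
    have "f yc = psi \<tau>" if "yc \<in> {yc \<in> ?Y. h yc = \<tau>}" for yc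
    proof -
      obtain y c where "yc = (y, c)" by (cases yc)
      then have yc: "yc = (y, c)" "y \<in> gf (Q ^ l)" "c \<in> gf Q" "rp (Tr Q l y + c) = \<tau>"
        using that by (simp_all add: h_def)
      have "psi \<tau> = psi (Tr Q l y + c)"
        using yc rp_fx(2)[OF ppQ fx_closed(3)[OF ppQ tr_y gffx], of y c] by (intro psi_cg gffx tau) auto
      also have "\<dots> = f yc" using yc by (simp add: f_def Psi_def psi_add[OF tr_y gffx])
      finally show ?thesis ..
    qed
    then show "(\<Sum>yc\<in>{yc \<in> ?Y. h yc = \<tau>}. f yc) = of_nat (b \<tau>) * psi \<tau>" by (simp add: b_def)
  qed
  finally have sY: "sum f ?Y = (\<Sum>\<tau>\<in>gf Q. of_nat (b \<tau>) * psi \<tau>)" .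
  have "(\<Sum>x\<in>?X. Psi n x) + sum f ?Y = (\<Sum>\<tau>\<in>gf Q. (of_nat (a \<tau> + b \<tau>)) * psi \<tau>)"
    unfolding sX sY by (simp add: sum.distrib distrib_right)
  also have "\<dots> = (\<Sum>\<tau>\<in>gf Q. of_nat K * psi \<tau>)" using ab by (intro sum.cong refl) simp
  also have "\<dots> = of_nat K * (\<Sum>\<tau>\<in>gf Q. psi (1 * \<tau>))" by (simp add: sum_distrib_left)
  also have "\<dots> = 0" using psi_sum(1)[of 1] gf_closed(2) by simp
  finally show ?thesis by (simp add: f_def n_def add_eq_0_iff2)
qed

text \<open>The representative of -1: it is -1 itself for odd p, but 1 for p = 2.\<close>

definition eps :: complex where
  "eps = rp (- 1)"

lemma eps: "j > 0 \<Longrightarrow> eps \<in> gf (Q ^ j)" "eps \<doteq> - 1"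
  using rp_fx[OF ppj fx_closed(5)[OF ppj fx_closed(2)[OF ppj]]] by (auto simp: eps_def)

lemma eps_nz: "eps \<noteq> 0"
proof
  assume "eps = 0"
  then have "- 0 \<doteq> - (- 1)" using cg_minus[OF eps(2)] by simp
  then show False by simp
qed

definition Fb :: "complex \<Rightarrow> complex \<Rightarrow> complex set" where
  "Fb h y = {x \<in> gf (Q ^ Suc l). Nm Q (Suc l) x = h * Nm Q l y}"

abbreviation W :: "complex set" where
  "W \<equiv> gf (Q ^ l) - {0}"

lemma psi_Nm_sum:
  assumes t: "t \<in> gf Q" "t \<noteq> 0"
  shows "(\<Sum>u\<in>W. psi (t * Nm Q l u)) = - of_nat (Pn l)"
proof -
  have fib: "{u \<in> W. Nm Q l u = \<nu>} = {u \<in> gf (Q ^ l). Nm Q l u = \<nu>}" if "\<nu> \<noteq> 0" for \<nu>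
    using that Nm_0_iff[OF l_pos] by auto
  have "(\<Sum>u\<in>W. psi (t * Nm Q l u)) = (\<Sum>\<nu>\<in>gf Q - {0}. \<Sum>u\<in>{u \<in> W. Nm Q l u = \<nu>}. psi (t * Nm Q l u))"
    using Nm_gf[of _ Q l] Nm_0_iff[OF l_pos] finite_gfj[OF l_pos] finite_gf[OF Q_ge_2]
    by (intro sum.group[symmetric]) auto
  also have "\<dots> = (\<Sum>\<nu>\<in>gf Q - {0}. of_nat (Pn l) * psi (t * \<nu>))"
    using card_Nm_fiber[OF l_pos] fib by (intro sum.cong refl) auto
  also have "\<dots> = of_nat (Pn l) * (\<Sum>\<nu>\<in>gf Q - {0}. psi (t * \<nu>))" by (simp add: sum_distrib_left)
  finally show ?thesis using psi_sum(2)[OF t] by simp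
qed

text \<open>Hasse-Davenport replaces the sum over x by one over z involving only the ratio u = y /
  z. For fixed u the remaining sum over z is that of the character at (u + 1) z, which is large only
  for u = -1. This one ratio gives the main term, all others together the constant.\<close>

lemma kappa:
  assumes t: "t \<in> gf Q" "t \<noteq> 0"
  shows "(\<Sum>y\<in>W. \<Sum>x\<in>Fb t y. Psi (Suc l) x * Psi l y)
    = - of_nat (Q ^ l) * psi (t * Nm Q l eps) - of_nat (Pn l)"
proof -
  have finW: "finite W" using finite_gfj[OF l_pos] by simp
  have Nmgf: "Nm Q l y \<in> gf Q" "Nm Q l y \<noteq> 0" if "y \<in> W" for y
    using Nm_gf[of y Q l] Nm_0_iff[OF l_pos] that by auto
  have inner: "(\<Sum>x\<in>Fb t y. Psi (Suc l) x) = - (\<Sum>z\<in>W. Psi l z * psi (t * Nm Q l (y / z)))" if y: "y \<in> W" for y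
  proof -
    define \<nu> where "\<nu> = t * Nm Q l y"
    have nu: "\<nu> \<in> gf Q" "\<nu> \<noteq> 0" using Nmgf[OF y] t by (auto simp: \<nu>_def intro: gf_closed)
    have "(\<Sum>x\<in>Fb t y. Psi (Suc l) x)
      = - (\<Sum>(z, c)\<in>{(z, c). z \<in> gf (Q ^ l) \<and> c \<in> gf Q \<and> Nm Q l z * c = \<nu>}. Psi l z * psi c)"
      unfolding Fb_def \<nu>_def[symmetric] by (rule hasse_davenport_sum[OF nu])
    also have "(\<Sum>(z, c)\<in>{(z, c). z \<in> gf (Q ^ l) \<and> c \<in> gf Q \<and> Nm Q l z * c = \<nu>}. Psi l z * psi c)
      = (\<Sum>z\<in>W. Psi l z * psi (\<nu> / Nm Q l z))"
    proof (rule sum.reindex_bij_witness[of _ "\<lambda>z. (z, \<nu> / Nm Q l z)" fst])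
      fix u assume u: "u \<in> {(z, c). z \<in> gf (Q ^ l) \<and> c \<in> gf Q \<and> Nm Q l z * c = \<nu>}"
      then obtain z c where zc: "u = (z, c)" "z \<in> gf (Q ^ l)" "c \<in> gf Q" "Nm Q l z * c = \<nu>" by auto
      then have z0: "z \<noteq> 0" using nu Nm_0_iff[OF l_pos, of z] by auto
      then have c: "c = \<nu> / Nm Q l z" using zc Nm_0_iff[OF l_pos, of z] by (auto simp: field_simps)
      show "fst u \<in> W" "(fst u, \<nu> / Nm Q l (fst u)) = u" using zc z0 c by auto
      show "Psi l (fst u) * psi (\<nu> / Nm Q l (fst u)) = (case u of (z, c) \<Rightarrow> Psi l z * psi c)" using zc c by simp
    next
      fix z assume z: "z \<in> W"
      show "(z, \<nu> / Nm Q l z) \<in> {(z, c). z \<in> gf (Q ^ l) \<and> c \<in> gf Q \<and> Nm Q l z * c = \<nu>}"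
        using z Nmgf[OF z] nu by (auto intro: gf_closed)
    qed simp
    finally show ?thesis by (simp add: \<nu>_def Nm_divide)
  qed
  have "(\<Sum>y\<in>W. \<Sum>x\<in>Fb t y. Psi (Suc l) x * Psi l y)
    = - (\<Sum>y\<in>W. \<Sum>z\<in>W. Psi l y * Psi l z * psi (t * Nm Q l (y / z)))"
  proof -
    have "(\<Sum>x\<in>Fb t y. Psi (Suc l) x * Psi l y)
      = - (\<Sum>z\<in>W. Psi l y * Psi l z * psi (t * Nm Q l (y / z)))" if y: "y \<in> W" for y
      unfolding sum_distrib_right[symmetric] inner[OF y]
      by (simp add: sum_distrib_left mult_ac)
    then show ?thesis by (simp add: sum_negf)
  qed
  also have "(\<Sum>y\<in>W. \<Sum>z\<in>W. Psi l y * Psi l z * psi (t * Nm Q l (y / z)))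
    = (\<Sum>z\<in>W. \<Sum>y\<in>W. Psi l y * Psi l z * psi (t * Nm Q l (y / z)))" by (rule sum.swap)
  \<comment> \<open>Substitution y = u z, after which the \<open>psi\<close> factor no longer
    depends on z.\<close>
  also have "\<dots> = (\<Sum>z\<in>W. \<Sum>u\<in>W. psi (t * Nm Q l u) * (Psi l (u * z) * Psi l z))"
  proof (rule sum.cong[OF refl])
    fix z assume z: "z \<in> W"
    show "(\<Sum>y\<in>W. Psi l y * Psi l z * psi (t * Nm Q l (y / z)))
      = (\<Sum>u\<in>W. psi (t * Nm Q l u) * (Psi l (u * z) * Psi l z))"
      by (rule sum.reindex_bij_witness[of _ "\<lambda>u. u * z" "\<lambda>y. y / z"]) (use z in \<open>auto intro: gf_closed\<close>)
  qed
  also have "\<dots> = (\<Sum>u\<in>W. \<Sum>z\<in>W. psi (t * Nm Q l u) * (Psi l (u * z) * Psi l z))" by (rule sum.swap)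
  also have "\<dots> = (\<Sum>u\<in>W. psi (t * Nm Q l u) * (if u = eps then of_nat (Q ^ l) - 1 else - 1))"
  proof (intro sum.cong refl)
    fix u assume u: "u \<in> W"
    have ugf: "u \<in> gf (Q ^ l)" using u by simp
    have one: "1 \<in> gf (Q ^ l)" by (rule gf_closed(2))
    \<comment> \<open>\<open>w\<close> is the field element u + 1; it vanishes exactly at u =
      \<open>eps\<close>.\<close>
    define w where "w = rp (u + 1)"
    have w: "w \<in> gf (Q ^ l)" "w \<doteq> u + 1" using rp_add_gf[OF l_pos ugf one] by (auto simp: w_def)
    have "w = 0 \<longleftrightarrow> u = eps"
    proof
      assume "w = 0"
      then have "u + 1 \<doteq> 0" using cg_sym[OF w(2)] by simp
      then have "u + 1 - 1 \<doteq> 0 - 1" by (intro cg_diff) auto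
      then have "u \<doteq> eps" using cg_trans[OF _ cg_sym[OF eps(2)]] by simp
      then show "u = eps" using gf_cg_eq[OF ppj[OF l_pos] ugf eps(1)[OF l_pos]] by blast
    next
      assume "u = eps"
      then have "u + 1 \<doteq> - 1 + 1" using eps(2) by (intro cg_add) auto
      then have "w \<doteq> 0" using cg_trans[OF w(2)] by simp
      then show "w = 0" using gf_cg_eq[OF ppj[OF l_pos] w(1), of 0] by simp
    qed
    moreover have "Psi l (u * z) * Psi l z = Psi l (w * z)" if z: "z \<in> W" for z
    proof -
      have zgf: "z \<in> gf (Q ^ l)" using z by simp
      have "w * z \<doteq> (u + 1) * z" using w gf_A[OF ppj[OF l_pos] zgf] by (intro cg_mult) auto
      then have "Psi l (w * z) = Psi l (u * z + z)"
        using Psi_cg[OF gf_fxj[OF l_pos gf_closed(3)[OF w(1) zgf]], of "(u + 1) * z"]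
        by (simp add: distrib_right)
      also have "\<dots> = Psi l (u * z) * Psi l z"
        by (rule Psi_add[OF l_pos gf_fxj[OF l_pos gf_closed(3)[OF ugf zgf]] gf_fxj[OF l_pos zgf]])
      finally show ?thesis ..
    qed
    ultimately show "(\<Sum>z\<in>W. psi (t * Nm Q l u) * (Psi l (u * z) * Psi l z))
      = psi (t * Nm Q l u) * (if u = eps then of_nat (Q ^ l) - 1 else - 1)"
      using Psi_sum_nz[OF l_pos w(1)] by (simp flip: sum_distrib_left)
  qed
  also have "\<dots> = (\<Sum>u\<in>W. (if u = eps then of_nat (Q ^ l) * psi (t * Nm Q l eps) else 0) - psi (t * Nm Q l u))"
    by (intro sum.cong refl) (auto simp: algebra_simps)
  also have "\<dots> = of_nat (Q ^ l) * psi (t * Nm Q l eps) - (\<Sum>u\<in>W. psi (t * Nm Q l u))"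
    using finW eps(1)[OF l_pos] eps_nz by (simp add: sum_subtractf)
  finally show ?thesis using psi_Nm_sum[OF t] by simp
qed

definition Es :: "complex \<Rightarrow> complex \<Rightarrow> complex \<Rightarrow> complex" where
  "Es h a b = (\<Sum>y\<in>W. \<Sum>x\<in>Fb h y. Psi (Suc l) (a * x) * Psi l (b * y))"

lemma Nm_W: "y \<in> W \<Longrightarrow> Nm Q l y \<in> gf Q" "y \<in> W \<Longrightarrow> Nm Q l y \<noteq> 0"
  using Nm_gf[of y Q l] Nm_0_iff[OF l_pos] by auto

lemma card_Fb:
  assumes "h \<in> gf Q" "h \<noteq> 0" "y \<in> W"
  shows "card (Fb h y) = Pn (Suc l)"
  unfolding Fb_def by (rule card_Nm_fiber) (use assms Nm_W[OF assms(3)] in \<open>auto intro: gf_closed\<close>)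

text \<open>Rescaling x by a and y by b removes both twists and changes the norm ratio from h to t =
  h N(a) / N(b), which reduces the sum to \<open>kappa\<close>.\<close>

lemma Es_generic:
  assumes h: "h \<in> gf Q" "h \<noteq> 0" and a: "a \<in> gf (Q ^ Suc l)" "a \<noteq> 0" and b: "b \<in> gf (Q ^ l)" "b \<noteq> 0"
  shows "Es h a b = - of_nat (Q ^ l) * psi (h * (Nm Q (Suc l) a / Nm Q l b * Nm Q l eps)) - of_nat (Pn l)"
proof -
  define t where "t = h * Nm Q (Suc l) a / Nm Q l b"
  have Na: "Nm Q (Suc l) a \<in> gf Q" "Nm Q (Suc l) a \<noteq> 0" using Nm_gf[OF a(1)] Nm_0_iff[of "Suc l" a] a by auto
  have Nb: "Nm Q l b \<in> gf Q" "Nm Q l b \<noteq> 0" using Nm_W[of b] b by auto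
  have t: "t \<in> gf Q" "t \<noteq> 0" using h Na Nb by (auto simp: t_def intro!: gf_closed)
  have "Es h a b = (\<Sum>y\<in>W. \<Sum>x\<in>Fb t y. Psi (Suc l) x * Psi l y)"
    unfolding Es_def
  proof (rule sum.reindex_bij_witness[of _ "\<lambda>y. y / b" "\<lambda>y. b * y"])
    fix y assume y: "y \<in> W"
    show "b * y / b = y" "b * y \<in> W" using y b by (auto intro: gf_closed)
    show "(\<Sum>x\<in>Fb t (b * y). Psi (Suc l) x * Psi l (b * y)) = (\<Sum>x\<in>Fb h y. Psi (Suc l) (a * x) * Psi l (b * y))"
    proof (rule sum.reindex_bij_witness[of _ "\<lambda>x. a * x" "\<lambda>x. x / a"])
      show "x / a \<in> Fb h y" if "x \<in> Fb t (b * y)" for x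
        using that a Na Nb by (auto simp: Fb_def Nm_divide Nm_mult t_def intro: gf_closed)
      show "a * x \<in> Fb t (b * y)" if "x \<in> Fb h y" for x
        using that a Na Nb by (auto simp: Fb_def Nm_mult t_def intro: gf_closed)
    qed (use a in auto)
  next
    fix y assume y: "y \<in> W"
    show "b * (y / b) = y" "y / b \<in> W" using y b by (auto intro: gf_closed)
  qed
  also have "\<dots> = - of_nat (Q ^ l) * psi (t * Nm Q l eps) - of_nat (Pn l)" by (rule kappa[OF t])
  finally show ?thesis by (simp add: t_def mult.assoc)
qed

lemma Es_left_zero:
  assumes h: "h \<in> gf Q" "h \<noteq> 0" and b: "b \<in> gf (Q ^ l)"
  shows "Es h 0 b = of_nat (Pn (Suc l)) * (if b = 0 then of_nat (Q ^ l) - 1 else - 1)"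
proof -
  have "Es h 0 b = (\<Sum>y\<in>W. of_nat (Pn (Suc l)) * Psi l (b * y))"
    unfolding Es_def using Psi_0[of "Suc l"] card_Fb[OF h] by (intro sum.cong refl) simp
  also have "\<dots> = of_nat (Pn (Suc l)) * (\<Sum>y\<in>W. Psi l (b * y))" by (simp add: sum_distrib_left)
  finally show ?thesis unfolding Psi_sum_nz[OF l_pos b] .
qed

text \<open>With no character on y the summation order is exchanged: every nonzero x has exactly
  \<open>Pn l\<close> partners y, those of norm N(x) / h.\<close>

lemma Es_right_zero:
  assumes h: "h \<in> gf Q" "h \<noteq> 0" and a: "a \<in> gf (Q ^ Suc l)" "a \<noteq> 0"
  shows "Es h a 0 = - of_nat (Pn l)"
proof -
  have fin: "finite W" "finite (gf (Q ^ Suc l) - {0})" using finite_gfj[OF l_pos] finite_gfj[of "Suc l"] by auto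
  have "Es h a 0 = (\<Sum>y\<in>W. \<Sum>x\<in>{x \<in> gf (Q ^ Suc l) - {0}. Nm Q (Suc l) x = h * Nm Q l y}. Psi (Suc l) (a * x))"
    unfolding Es_def
  proof (rule sum.cong[OF refl], rule sum.cong)
    fix y assume y: "y \<in> W"
    have "Nm Q (Suc l) 0 = 0" using Nm_0_iff[of "Suc l" 0] by simp
    moreover have "h * Nm Q l y \<noteq> 0" using Nm_W(2)[OF y] h by simp
    ultimately show "Fb h y = {x \<in> gf (Q ^ Suc l) - {0}. Nm Q (Suc l) x = h * Nm Q l y}"
      unfolding Fb_def by (metis Diff_iff singletonD)
  qed (simp add: Psi_0[OF l_pos])
  also have "\<dots> = (\<Sum>x\<in>gf (Q ^ Suc l) - {0}. \<Sum>y\<in>{y \<in> W. Nm Q (Suc l) x = h * Nm Q l y}. Psi (Suc l) (a * x))"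
    using fin by (intro sum.swap_restrict)
  also have "\<dots> = (\<Sum>x\<in>gf (Q ^ Suc l) - {0}. of_nat (Pn l) * Psi (Suc l) (a * x))"
  proof (intro sum.cong refl)
    fix x assume x: "x \<in> gf (Q ^ Suc l) - {0}"
    define \<nu> where "\<nu> = Nm Q (Suc l) x / h"
    have nu: "\<nu> \<in> gf Q" "\<nu> \<noteq> 0" using x Nm_gf[of x Q "Suc l"] Nm_0_iff[of "Suc l" x] h by (auto simp: \<nu>_def intro: gf_closed)
    have "Nm Q (Suc l) x = h * Nm Q l y \<longleftrightarrow> Nm Q l y = \<nu>" for y
      using h by (auto simp: \<nu>_def nonzero_eq_divide_eq mult.commute)
    moreover have "y \<noteq> 0" if "Nm Q l y = \<nu>" for y using Nm_0_iff[OF l_pos, of y] nu that by blast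
    ultimately have "{y \<in> W. Nm Q (Suc l) x = h * Nm Q l y} = {y \<in> gf (Q ^ l). Nm Q l y = \<nu>}" by blast
    then show "(\<Sum>y\<in>{y \<in> W. Nm Q (Suc l) x = h * Nm Q l y}. Psi (Suc l) (a * x)) = of_nat (Pn l) * Psi (Suc l) (a * x)"
      using card_Nm_fiber[OF l_pos nu] by simp
  qed
  also have "\<dots> = of_nat (Pn l) * (\<Sum>x\<in>gf (Q ^ Suc l) - {0}. Psi (Suc l) (a * x))" by (simp add: sum_distrib_left)
  finally show ?thesis using Psi_sum_nz[of "Suc l" a] a by simp
qed

end

section \<open>The two-valued character sums of the complement of D\<close>

locale field_pair_subgroup = field_pair +
  fixes H :: "complex set"
  assumes H_subset: "H \<subseteq> gf Q" and H_zero: "0 \<in> H"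
    and H_add: "x \<in> H \<Longrightarrow> y \<in> H \<Longrightarrow> rp (x + y) \<in> H"
    and H_minus: "x \<in> H \<Longrightarrow> rp (- x) \<in> H"
begin

definition Cx :: "complex \<Rightarrow> complex set" where
  "Cx y = {x \<in> gf (Q ^ Suc l). \<exists>h\<in>H. Nm Q (Suc l) x = h * Nm Q l y}"

definition Csum :: "complex \<Rightarrow> complex \<Rightarrow> complex" where
  "Csum a b = (\<Sum>y\<in>gf (Q ^ l). \<Sum>x\<in>Cx y. Psi (Suc l) (a * x) * Psi l (b * y))"

lemma finite_H: "finite H"
  using finite_subset[OF H_subset finite_gf[OF Q_ge_2]] .

text \<open>The points (0, y) contribute the first sum. For y \<noteq> 0 the fibres of distinct
  nonzero h are disjoint because h = N(x) / N(y) is determined by the point.\<close>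

lemma Csum_eq: "Csum a b = (\<Sum>y\<in>gf (Q ^ l). Psi l (b * y)) + (\<Sum>h\<in>H - {0}. Es h a b)"
proof -
  define f where "f = (\<lambda>x y. Psi (Suc l) (a * x) * Psi l (b * y))"
  have P0: "Psi (Suc l) 0 = 1" "Psi l 0 = 1" using Psi_0 l_pos by auto
  have N0: "Nm Q (Suc l) x = 0 \<longleftrightarrow> x = 0" for x using Nm_0_iff by simp
  have finF: "finite (Fb h y)" for h y using finite_gfj[of "Suc l"] by (simp add: Fb_def)
  have zero: "(\<Sum>x\<in>Cx 0. f x 0) = 1"
  proof -
    have "Nm Q l 0 = 0" using Nm_0_iff[OF l_pos] by simp
    then have "Cx 0 = {0}" using N0 H_zero zero_gfj[of "Suc l"] by (auto simp: Cx_def)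
    then show ?thesis by (simp add: f_def P0)
  qed
  have nz: "(\<Sum>x\<in>Cx y. f x y) = Psi l (b * y) + (\<Sum>h\<in>H - {0}. \<Sum>x\<in>Fb h y. f x y)" if y: "y \<in> W" for y
  proof -
    have Ny: "Nm Q l y \<noteq> 0" using Nm_W y by auto
    have "\<exists>h\<in>H. Nm Q (Suc l) 0 = h * Nm Q l y" using H_zero N0[of 0] by (intro bexI[of _ 0]) auto
    then have "0 \<in> Cx y" using zero_gfj[of "Suc l"] by (simp only: Cx_def mem_Collect_eq)
    moreover have "x \<in> (\<Union>h\<in>H - {0}. Fb h y)" if x: "x \<in> Cx y" "x \<noteq> 0" for x
    proof -
      obtain h where h: "h \<in> H" "Nm Q (Suc l) x = h * Nm Q l y" using x by (auto simp: Cx_def)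
      then have "h \<noteq> 0" using N0[of x] x by auto
      then show ?thesis using h x by (auto simp: Cx_def Fb_def)
    qed
    moreover have "(\<Union>h\<in>H - {0}. Fb h y) \<subseteq> Cx y" unfolding Cx_def Fb_def by blast
    ultimately have "Cx y = insert 0 (\<Union>h\<in>H - {0}. Fb h y)" by blast
    moreover have "0 \<notin> (\<Union>h\<in>H - {0}. Fb h y)" using N0[of 0] Ny by (auto simp: Fb_def)
    ultimately have "(\<Sum>x\<in>Cx y. f x y) = f 0 y + (\<Sum>x\<in>(\<Union>h\<in>H - {0}. Fb h y). f x y)"
      using finF finite_H by simp
    also have "(\<Sum>x\<in>(\<Union>h\<in>H - {0}. Fb h y). f x y) = (\<Sum>h\<in>H - {0}. \<Sum>x\<in>Fb h y. f x y)"
      using finF finite_H Ny by (intro sum.UNION_disjoint) (auto simp: Fb_def)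
    finally show ?thesis by (simp add: f_def P0)
  qed
  have "Csum a b = (\<Sum>x\<in>Cx 0. f x 0) + (\<Sum>y\<in>W. \<Sum>x\<in>Cx y. f x y)"
    unfolding Csum_def f_def using finite_gfj[OF l_pos] by (intro sum.remove) auto
  also have "(\<Sum>y\<in>W. \<Sum>x\<in>Cx y. f x y) = (\<Sum>y\<in>W. Psi l (b * y)) + (\<Sum>y\<in>W. \<Sum>h\<in>H - {0}. \<Sum>x\<in>Fb h y. f x y)"
    by (simp add: nz sum.distrib)
  also have "(\<Sum>y\<in>W. \<Sum>h\<in>H - {0}. \<Sum>x\<in>Fb h y. f x y) = (\<Sum>h\<in>H - {0}. Es h a b)"
    unfolding Es_def f_def by (rule sum.swap)
  finally have "Csum a b = (1 + (\<Sum>y\<in>W. Psi l (b * y))) + (\<Sum>h\<in>H - {0}. Es h a b)" by (simp add: zero)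
  also have "1 + (\<Sum>y\<in>W. Psi l (b * y)) = (\<Sum>y\<in>gf (Q ^ l). Psi l (b * y))"
    using sum.remove[OF finite_gfj[OF l_pos] zero_gfj, of "\<lambda>y. Psi l (b * y)"] by (simp add: P0)
  finally show ?thesis .
qed

lemma card_H_nz: "of_nat (card (H - {0})) = (of_nat (card H) - 1 :: complex)"
proof -
  have "card H > 0" using finite_H H_zero by (auto simp: card_gt_0_iff)
  then show ?thesis using finite_H H_zero by (simp add: card_Diff_singleton of_nat_diff)
qed

text \<open>h |-> psi (h * c) is a character of the group H, so its sum is full or zero. This
  dichotomy is the source of the two values.\<close>

lemma H_psi_sum:
  assumes c: "c \<in> gf Q"
  shows "(\<Sum>h\<in>H. psi (h * c)) \<in> {0, of_nat (card H)}"
proof (cases "\<exists>h\<in>H. psi (h * c) \<noteq> 1")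
  case True
  then obtain h0 where h0: "h0 \<in> H" "psi (h0 * c) \<noteq> 1" by blast
  have fxc: "x * c \<in> fx Q" if "x \<in> gf Q" for x using gf_fx[OF ppQ] gf_closed(3)[OF that c] by blast
  have "(\<Sum>h\<in>H. psi (h * c)) = 0"
  proof (rule char_sum_zero[OF ppQ H_subset H_add _ h0(1)])
    show "psi (h0 * c) \<noteq> 1" by (rule h0)
    fix x y assume xy: "x \<in> H" "y \<in> H"
    have gxy: "x \<in> gf Q" "y \<in> gf Q" using xy H_subset by auto
    have r: "rp (x + y) \<in> gf Q" "rp (x + y) \<doteq> x + y" using rp_add_gf[of 1 x y] gxy by auto
    have "rp (x + y) * c \<doteq> (x + y) * c" using r gf_A[OF ppQ c] by (intro cg_mult) auto
    then have "psi (rp (x + y) * c) = psi (x * c + y * c)"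
      using psi_cg[OF fxc[OF r(1)]] by (simp add: distrib_right)
    then show "psi (rp (x + y) * c) = psi (x * c) * psi (y * c)" using psi_add fxc gxy by simp
  qed
  then show ?thesis by simp
next
  case False
  then have "(\<Sum>h\<in>H. psi (h * c)) = (\<Sum>h\<in>H. 1)" by (intro sum.cong) auto
  then show ?thesis by simp
qed

lemma Pn_Suc: "Pn (Suc l) = Pn l + Q ^ l"
  by (simp add: Pn_def)

lemma Csum_trivial:
  "Csum 0 0 = of_nat (Q ^ l) + (of_nat (card H) - 1) * (of_nat (Pn (Suc l)) * (of_nat (Q ^ l) - 1))"
proof -
  have "(\<Sum>h\<in>H - {0}. Es h 0 0) = (\<Sum>h\<in>H - {0}. of_nat (Pn (Suc l)) * (of_nat (Q ^ l) - 1))"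
    using H_subset Es_left_zero[of _ 0] by (intro sum.cong) auto
  then show ?thesis unfolding Csum_eq using Psi_sum[OF l_pos, of 0] card_H_nz by simp
qed

text \<open>If a and b are both nonzero, a full sum over H gives the first value and a vanishing one
  the second. The case a = 0 falls on the first value, and b = 0 on the second, since
  \<open>Pn (Suc l)\<close> = \<open>Pn l\<close> + Q ^ l.\<close>

lemma Csum_nontrivial:
  assumes a: "a \<in> gf (Q ^ Suc l)" and b: "b \<in> gf (Q ^ l)" and ab: "a \<noteq> 0 \<or> b \<noteq> 0"
  shows "Csum a b \<in> {- (of_nat (card H) - 1) * of_nat (Pn (Suc l)),
    of_nat (card H) * of_nat (Q ^ l) - (of_nat (card H) - 1) * of_nat (Pn (Suc l))}"
proof -
  consider "a = 0" "b \<noteq> 0" | "a \<noteq> 0" "b = 0" | "a \<noteq> 0" "b \<noteq> 0" using ab by blast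
  then show ?thesis
  proof cases
    case 1
    have "(\<Sum>h\<in>H - {0}. Es h a b) = (\<Sum>h\<in>H - {0}. - of_nat (Pn (Suc l)))"
      using H_subset Es_left_zero[OF _ _ b] 1 by (intro sum.cong) auto
    then show ?thesis unfolding Csum_eq using Psi_sum[OF l_pos b] 1 card_H_nz by (simp add: algebra_simps)
  next
    case 2
    have "(\<Sum>h\<in>H - {0}. Es h a b) = (\<Sum>h\<in>H - {0}. - of_nat (Pn l))"
      using H_subset Es_right_zero[OF _ _ a] 2 by (intro sum.cong) auto
    then have "Csum a b = of_nat (Q ^ l) - (of_nat (card H) - 1) * of_nat (Pn l)"
      unfolding Csum_eq using Psi_sum[OF l_pos b] 2 card_H_nz by simp
    then show ?thesis by (simp add: Pn_Suc algebra_simps)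
  next
    case 3
    define c where "c = Nm Q (Suc l) a / Nm Q l b * Nm Q l eps"
    have c: "c \<in> gf Q" unfolding c_def
      by (intro gf_closed Nm_gf a b eps l_pos)
    have "(\<Sum>h\<in>H - {0}. Es h a b) = (\<Sum>h\<in>H - {0}. - of_nat (Q ^ l) * psi (h * c) - of_nat (Pn l))"
      unfolding c_def using H_subset Es_generic[OF _ _ a 3(1) b 3(2)] by (intro sum.cong) auto
    also have "\<dots> = - of_nat (Q ^ l) * (\<Sum>h\<in>H - {0}. psi (h * c)) - (of_nat (card H) - 1) * of_nat (Pn l)"
      by (simp add: sum_subtractf sum_distrib_left sum_negf card_H_nz)
    also have "(\<Sum>h\<in>H - {0}. psi (h * c)) = (\<Sum>h\<in>H. psi (h * c)) - 1"
      using finite_H H_zero psi_0 by (simp add: sum_diff1)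
    finally have "Csum a b = - of_nat (Q ^ l) * ((\<Sum>h\<in>H. psi (h * c)) - 1) - (of_nat (card H) - 1) * of_nat (Pn l)"
      unfolding Csum_eq using Psi_sum[OF l_pos b] 3 by simp
    then show ?thesis using H_psi_sum[OF c] by (auto simp: Pn_Suc algebra_simps)
  qed
qed

end

section \<open>Partial difference sets and characters\<close>

text \<open>A common neighbour z of x and y corresponds to the pair (x - z, y - z) in D with
  difference x - y; the pair (g, h) comes from z = -g + x.\<close>

lemma strongly_regular_cayley_graph:
  fixes G (structure)
  assumes pds: "partial_difference_set G D v k lam mu" and sym: "D = m_inv G ` D"
  shows "strongly_regular_graph (cayley_graph G D) v k lam mu"
proof -
  have G: "group G" and fin: "finite (carrier G)" and DG: "D \<subseteq> carrier G" and D1: "\<one> \<notin> D"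
    and k: "card D = k" and v: "Coset.order G = v"
    and lam: "\<And>x. x \<in> D \<Longrightarrow> card (difference_reps G D x) = lam"
    and mu: "\<And>x. x \<in> carrier G \<Longrightarrow> x \<notin> D \<Longrightarrow> x \<noteq> \<one> \<Longrightarrow> card (difference_reps G D x) = mu"
    using pds by (auto simp: partial_difference_set_def)
  interpret group G by (rule G)
  define \<Gamma> where "\<Gamma> = cayley_graph G D"
  have V: "pverts \<Gamma> = carrier G"
    and E: "parcs \<Gamma> = {(g, h). g \<in> carrier G \<and> h \<in> carrier G \<and> g \<otimes> inv h \<in> D}"
    by (auto simp: \<Gamma>_def cayley_graph_def)
  have invD: "inv d \<in> D" if "d \<in> D" for d using sym that by blast
  have symE: "(h, g) \<in> parcs \<Gamma>" if "(g, h) \<in> parcs \<Gamma>" for g h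
  proof -
    have gh: "g \<in> carrier G" "h \<in> carrier G" "g \<otimes> inv h \<in> D" using that E by auto
    have "inv (g \<otimes> inv h) = h \<otimes> inv g" using gh by (simp add: inv_mult_group)
    then show ?thesis using invD[OF gh(3)] gh E by auto
  qed
  have "parcs \<Gamma> \<subseteq> carrier G \<times> carrier G" using E by auto
  then have finE: "finite (parcs \<Gamma>)" using fin by (meson finite_SigmaI finite_subset)
  have graph: "pair_graph \<Gamma>"
  proof
    show "fst e \<in> pverts \<Gamma>" "snd e \<in> pverts \<Gamma>" if "e \<in> parcs \<Gamma>" for e using that E V by auto
    show "finite (pverts \<Gamma>)" using V fin by simp
    show "finite (parcs \<Gamma>)" by (rule finE)
    show "fst e \<noteq> snd e" if "e \<in> parcs \<Gamma>" for e using that E D1 by auto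
    show "symmetric \<Gamma>" unfolding symmetric_def by (auto intro!: symI symE)
  qed
  have deg: "card (neighbours \<Gamma> x) = k" if x: "x \<in> carrier G" for x
  proof -
    have "bij_betw (\<lambda>y. x \<otimes> inv y) (neighbours \<Gamma> x) D"
    proof (rule bij_betwI[where g = "\<lambda>d. inv d \<otimes> x"])
      show "(\<lambda>y. x \<otimes> inv y) \<in> neighbours \<Gamma> x \<rightarrow> D" by (auto simp: neighbours_def V E)
      show "(\<lambda>d. inv d \<otimes> x) \<in> D \<rightarrow> neighbours \<Gamma> x"
      proof
        fix d assume d: "d \<in> D"
        then have dG: "d \<in> carrier G" using DG by blast
        have "x \<otimes> inv (inv d \<otimes> x) = d" using x dG by (simp add: inv_mult_group m_assoc[symmetric])
        then show "inv d \<otimes> x \<in> neighbours \<Gamma> x" using x dG d by (auto simp: neighbours_def V E)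
      qed
      show "inv (x \<otimes> inv y) \<otimes> x = y" if "y \<in> neighbours \<Gamma> x" for y
        using that x by (auto simp: neighbours_def V inv_mult_group m_assoc)
      show "x \<otimes> inv (inv d \<otimes> x) = d" if "d \<in> D" for d
        using that x DG by (auto simp: inv_mult_group m_assoc[symmetric])
    qed
    then show ?thesis using k bij_betw_same_card by metis
  qed
  have common: "card (neighbours \<Gamma> x \<inter> neighbours \<Gamma> y) = card (difference_reps G D (x \<otimes> inv y))"
    if x: "x \<in> carrier G" and y: "y \<in> carrier G" and xy: "x \<noteq> y" for x y
  proof -
    have quot: "(x \<otimes> inv z) \<otimes> inv (y \<otimes> inv z) = x \<otimes> inv y"
      if z: "z \<in> carrier G" for z
    proof -
      have "(x \<otimes> inv z) \<otimes> inv (y \<otimes> inv z)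
        = x \<otimes> (inv z \<otimes> (z \<otimes> inv y))" using x y z by (simp add: inv_mult_group m_assoc)
      also have "inv z \<otimes> (z \<otimes> inv y) = inv y" using y z by (simp add: m_assoc[symmetric])
      finally show ?thesis .
    qed
    have recover: "x \<otimes> inv (inv g \<otimes> x) = g" "y \<otimes> inv (inv g \<otimes> x) = h"
      if "g \<in> D" "h \<in> D" and eq: "g \<otimes> inv h = x \<otimes> inv y" for g h
    proof -
      have gh: "g \<in> carrier G" "h \<in> carrier G" using that DG by auto
      show "x \<otimes> inv (inv g \<otimes> x) = g" using x gh by (simp add: inv_mult_group m_assoc[symmetric])
      have "y \<otimes> inv (inv g \<otimes> x) = inv (x \<otimes> inv y) \<otimes> g"
        using x y gh by (simp add: inv_mult_group m_assoc)
      also have "\<dots> = h" unfolding eq[symmetric] using gh by (simp add: inv_mult_group m_assoc)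
      finally show "y \<otimes> inv (inv g \<otimes> x) = h" .
    qed
    have "bij_betw (\<lambda>z. (x \<otimes> inv z, y \<otimes> inv z))
      (neighbours \<Gamma> x \<inter> neighbours \<Gamma> y) (difference_reps G D (x \<otimes> inv y))"
    proof (rule bij_betwI[where g = "\<lambda>(g, h). inv g \<otimes> x"])
      show "(\<lambda>z. (x \<otimes> inv z, y \<otimes> inv z))
        \<in> neighbours \<Gamma> x \<inter> neighbours \<Gamma> y \<rightarrow> difference_reps G D (x \<otimes> inv y)"
        using x y xy quot by (auto simp: neighbours_def V E difference_reps_def)
      show "(\<lambda>(g, h). inv g \<otimes> x) \<in> difference_reps G D (x \<otimes> inv y)
        \<rightarrow> neighbours \<Gamma> x \<inter> neighbours \<Gamma> y"
        using recover x y DG by (auto simp: neighbours_def V E difference_reps_def subset_iff)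
      show "(case (x \<otimes> inv z, y \<otimes> inv z) of (g, h) \<Rightarrow> inv g \<otimes> x) = z"
        if "z \<in> neighbours \<Gamma> x \<inter> neighbours \<Gamma> y" for z
        using that x by (auto simp: neighbours_def V inv_mult_group m_assoc)
      show "(x \<otimes> inv (case u of (g, h) \<Rightarrow> inv g \<otimes> x),
          y \<otimes> inv (case u of (g, h) \<Rightarrow> inv g \<otimes> x)) = u"
        if "u \<in> difference_reps G D (x \<otimes> inv y)" for u
        using that recover by (auto simp: difference_reps_def)
    qed
    then show ?thesis by (rule bij_betw_same_card)
  qed
  have quot1: "x \<otimes> inv y \<noteq> \<one>" if "x \<in> carrier G" "y \<in> carrier G" "x \<noteq> y" for x y
    using that by (metis inv_closed inv_equality inv_inv)
  show ?thesis
    unfolding strongly_regular_graph_def \<Gamma>_def[symmetric] V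
  proof (intro conjI ballI impI)
    show "pair_graph \<Gamma>" by (rule graph)
    show "card (carrier G) = v" using v by (simp add: Coset.order_def)
    fix x assume x: "x \<in> carrier G"
    show "card (neighbours \<Gamma> x) = k" by (rule deg[OF x])
    fix y assume y: "y \<in> carrier G"
    show "card (neighbours \<Gamma> x \<inter> neighbours \<Gamma> y) = lam" if "(x, y) \<in> parcs \<Gamma>"
    proof -
      have d: "x \<otimes> inv y \<in> D" using that E by auto
      then have "x \<noteq> y" using D1 y by auto
      then show ?thesis using common[OF x y] lam[OF d] by simp
    qed
    show "card (neighbours \<Gamma> x \<inter> neighbours \<Gamma> y) = mu" if "x \<noteq> y \<and> (x, y) \<notin> parcs \<Gamma>"
    proof -
      have "x \<otimes> inv y \<notin> D" using that E x y by auto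
      then show ?thesis using common[OF x y] mu[of "x \<otimes> inv y"] quot1[OF x y] that x y by auto
    qed
  qed
qed

text \<open>Orthogonality expresses the count through the squares of the character sums
  \<open>S i\<close>, using D = -D. For a nontrivial character \<open>S i\<close> is a root of (t -
  \<theta>1) * (t - \<theta>2), so its square is linear in \<open>S i\<close>, and orthogonality
  evaluates the linear sum: it detects whether x lies in D.\<close>

lemma difference_count_characters:
  fixes G (structure) and chi :: "'i \<Rightarrow> 'a \<Rightarrow> complex" and \<theta>1 \<theta>2 :: complex
  assumes G: "group G" and fin: "finite (carrier G)" and finI: "finite I" and i0: "i0 \<in> I"
    and cardI: "card I = Coset.order G"
    and hom: "\<And>i g h. i \<in> I \<Longrightarrow> g \<in> carrier G \<Longrightarrow> h \<in> carrier G \<Longrightarrow> chi i (g \<otimes> h) = chi i g * chi i h"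
    and chi1: "\<And>i. i \<in> I \<Longrightarrow> chi i \<one> = 1"
    and triv: "\<And>g. g \<in> carrier G \<Longrightarrow> chi i0 g = 1"
    and orth: "\<And>g. g \<in> carrier G \<Longrightarrow> g \<noteq> \<one> \<Longrightarrow> (\<Sum>i\<in>I. chi i g) = 0"
    and DG: "D \<subseteq> carrier G" and sym: "D = m_inv G ` D"
    and vals: "\<And>i. i \<in> I \<Longrightarrow> i \<noteq> i0 \<Longrightarrow> (\<Sum>d\<in>D. chi i d) \<in> {\<theta>1, \<theta>2}"
    and x: "x \<in> carrier G" "x \<noteq> \<one>"
  shows "of_nat (Coset.order G) * of_nat (card (difference_reps G D x))
    = (if x \<in> D then of_nat (Coset.order G) * (\<theta>1 + \<theta>2) else 0)
      + (of_nat (card D) - \<theta>1) * (of_nat (card D) - \<theta>2)"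
proof -
  interpret group G by (rule G)
  define v where "v = (of_nat (Coset.order G) :: complex)"
  define S where "S = (\<lambda>i. \<Sum>d\<in>D. chi i d)"
  define u where "u = (\<lambda>i. chi i (inv x))"
  have finD: "finite D" using finite_subset[OF DG fin] .
  have orth': "(\<Sum>i\<in>I. chi i g) = (if g = \<one> then v else 0)" if "g \<in> carrier G" for g
    using orth[OF that] chi1 cardI by (simp add: v_def)
  have eq_iff: "g \<otimes> inv x = \<one> \<longleftrightarrow> g = x" if "g \<in> carrier G" for g
    using that x by (metis inv_closed inv_equality inv_inv r_inv)
  have reps: "difference_reps G D x = {(g, h) \<in> D \<times> D. g \<otimes> inv h = x}"
    using x DG by (auto simp: difference_reps_def)
  have Sinv: "(\<Sum>h\<in>D. chi i (inv h)) = S i" for i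
  proof -
    have "inj_on (m_inv G) D" using DG by (intro inj_onI) (metis inv_inv subsetD)
    then have "(\<Sum>h\<in>D. chi i (inv h)) = (\<Sum>d\<in>m_inv G ` D. chi i d)" by (simp add: sum.reindex)
    then show ?thesis using sym by (simp add: S_def)
  qed
  have "v * of_nat (card (difference_reps G D x))
    = (\<Sum>w\<in>D \<times> D. if fst w \<otimes> inv snd w = x then v else 0)"
  proof -
    have "D \<times> D \<inter> {w. fst w \<otimes> inv snd w = x} = difference_reps G D x" unfolding reps by auto
    then show ?thesis using finD by (simp add: sum.If_cases)
  qed
  also have "\<dots> = (\<Sum>w\<in>D \<times> D. \<Sum>i\<in>I. chi i (fst w \<otimes> inv snd w \<otimes> inv x))"
  proof (rule sum.cong[OF refl])
    fix w assume "w \<in> D \<times> D"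
    then have "fst w \<in> carrier G" "snd w \<in> carrier G" using DG by auto
    then show "(if fst w \<otimes> inv snd w = x then v else 0)
      = (\<Sum>i\<in>I. chi i (fst w \<otimes> inv snd w \<otimes> inv x))"
      using x by (subst orth') (auto simp: eq_iff)
  qed
  also have "\<dots> = (\<Sum>i\<in>I. \<Sum>w\<in>D \<times> D. chi i (fst w \<otimes> inv snd w \<otimes> inv x))" by (rule sum.swap)
  also have "\<dots> = (\<Sum>i\<in>I. S i * S i * u i)"
  proof (rule sum.cong[OF refl])
    fix i assume i: "i \<in> I"
    have "(\<Sum>w\<in>D \<times> D. chi i (fst w \<otimes> inv snd w \<otimes> inv x))
      = (\<Sum>w\<in>D \<times> D. chi i (fst w) * chi i (inv snd w) * u i)"
      unfolding u_def using i DG x by (intro sum.cong refl) (auto simp: hom subset_iff)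
    also have "\<dots> = (\<Sum>g\<in>D. \<Sum>h\<in>D. chi i g * chi i (inv h) * u i)"
      by (simp add: sum.cartesian_product case_prod_beta)
    also have "\<dots> = S i * (\<Sum>h\<in>D. chi i (inv h)) * u i"
      unfolding S_def sum_product by (simp only: sum_distrib_right)
    finally show "(\<Sum>w\<in>D \<times> D. chi i (fst w \<otimes> inv snd w \<otimes> inv x)) = S i * S i * u i"
      by (simp add: Sinv)
  qed
  \<comment> \<open>The quadratic relation is applied to every index; the trivial character, where
    \<open>S i\<close> = card D, does not satisfy it in general and contributes the correction
    term.\<close>
  also have "\<dots> = (\<Sum>i\<in>I. ((\<theta>1 + \<theta>2) * S i - \<theta>1 * \<theta>2) * u i
      + (if i = i0 then (of_nat (card D) - \<theta>1) * (of_nat (card D) - \<theta>2) else 0))"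
  proof (rule sum.cong[OF refl])
    fix i assume i: "i \<in> I"
    show "S i * S i * u i = ((\<theta>1 + \<theta>2) * S i - \<theta>1 * \<theta>2) * u i
      + (if i = i0 then (of_nat (card D) - \<theta>1) * (of_nat (card D) - \<theta>2) else 0)"
    proof (cases "i = i0")
      case True
      have "S i = of_nat (card D)" unfolding S_def True using triv DG by (simp add: subset_iff)
      moreover have "u i = 1" unfolding u_def True using triv x by simp
      ultimately show ?thesis using True by (simp add: algebra_simps)
    next
      case False
      then have "S i = \<theta>1 \<or> S i = \<theta>2" using vals[OF i] by (simp add: S_def)
      then show ?thesis using False by (auto simp: algebra_simps)
    qed
  qed
  also have "\<dots> = (\<theta>1 + \<theta>2) * (\<Sum>i\<in>I. S i * u i) - \<theta>1 * \<theta>2 * (\<Sum>i\<in>I. u i)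
      + (of_nat (card D) - \<theta>1) * (of_nat (card D) - \<theta>2)"
    using finI i0 by (simp add: sum.distrib sum_subtractf left_diff_distrib sum_distrib_left mult.assoc)
  also have "(\<Sum>i\<in>I. S i * u i) = (if x \<in> D then v else 0)"
  proof -
    have "(\<Sum>i\<in>I. S i * u i) = (\<Sum>i\<in>I. \<Sum>d\<in>D. chi i (d \<otimes> inv x))"
      unfolding S_def u_def sum_distrib_right using DG x
      by (intro sum.cong refl) (auto simp: hom subset_iff)
    also have "\<dots> = (\<Sum>d\<in>D. \<Sum>i\<in>I. chi i (d \<otimes> inv x))" by (rule sum.swap)
    also have "\<dots> = (\<Sum>d\<in>D. if d = x then v else 0)"
      using DG x by (intro sum.cong refl) (auto simp: orth' eq_iff subset_iff)
    finally show ?thesis using finD by simp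
  qed
  also have "(\<Sum>i\<in>I. u i) = 0"
    unfolding u_def using x by (intro orth) (auto simp: inv_eq_1_iff)
  finally show ?thesis by (simp add: v_def mult.commute)
qed

section \<open>Coordinates over the prime field\<close>

context residue
begin

text \<open>Reduced coordinate vectors, extensional so that this set equals the carrier of
  \<open>Zp_power p j\<close>.\<close>

definition cube :: "nat \<Rightarrow> (nat \<Rightarrow> int) set" where
  "cube j = {..<j} \<rightarrow>\<^sub>E {0..<int p}"

definition ls :: "nat \<Rightarrow> (nat \<Rightarrow> complex) \<Rightarrow> (nat \<Rightarrow> int) \<Rightarrow> complex" where
  "ls j e z = (\<Sum>i<j. of_int (z i) * e i)"

lemma finite_cube: "finite (cube j)" and card_cube: "card (cube j) = p ^ j"
  by (auto simp: cube_def card_PiE intro!: finite_PiE)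

lemma ls_fx:
  assumes N: "ppow N" and e: "\<And>i. e i \<in> gf N"
  shows "ls j e z \<in> fx N"
  unfolding ls_def using gf_fx[OF N] e by (intro fx_closed[OF N]) blast

lemma ls_cg:
  assumes N: "ppow N" and e: "\<And>i. e i \<in> gf N" and zw: "\<And>i. i < j \<Longrightarrow> z i mod int p = w i mod int p"
  shows "ls j e z \<doteq> ls j e w"
  unfolding ls_def using gf_A[OF N e] zw by (intro cg_sum cg_mult) (auto simp: of_int_cg)

lemma rp_ls_eq_iff:
  assumes N: "ppow N" and e: "\<And>i. e i \<in> gf N"
  shows "rp (ls j e z) = rp (ls j e w) \<longleftrightarrow> ls j e z \<doteq> ls j e w"
proof
  assume "rp (ls j e z) = rp (ls j e w)"
  then show "ls j e z \<doteq> ls j e w"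
    using cg_trans[OF cg_sym[OF rp_fx(2)[OF N ls_fx[OF N e, where j = j and z = z]]]]
      rp_fx(2)[OF N ls_fx[OF N e, where j = j and z = w]] by simp
qed (rule rp_cg)

text \<open>Basis elements are chosen one at a time outside the span so far, which has p ^ d < p ^ k
  elements. Independence is kept for all initial segments since their spans later provide the
  subgroups H.\<close>

lemma basis_exists:
  assumes k: "k > 0"
  shows "\<exists>e. (\<forall>i. e i \<in> gf (p ^ k)) \<and> (\<forall>j\<le>k. inj_on (\<lambda>z. rp (ls j e z)) (cube j))"
proof -
  define N where "N = p ^ k"
  have N: "ppow N" using k by (auto simp: N_def ppow_def)
  have N2: "N \<ge> 2" by (rule ppow_ge_2[OF N])
  have p1: "p > 1" using prime_p by (rule prime_gt_1_nat)
  have "d \<le> k \<longrightarrow> (\<exists>e. (\<forall>i. e i \<in> gf N) \<and> (\<forall>j\<le>d. inj_on (\<lambda>z. rp (ls j e z)) (cube j)))" for d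
  proof (induction d)
    case 0
    have "inj_on f (cube 0)" for f :: "(nat \<Rightarrow> int) \<Rightarrow> complex" by (simp add: cube_def inj_on_def)
    then show ?case using gf_closed(2) by (auto intro!: exI[of _ "\<lambda>_. 1"])
  next
    case (Suc d)
    show ?case
    proof
      assume dk: "Suc d \<le> k"
      then obtain e where e: "\<And>i. e i \<in> gf N" and inj: "\<And>j. j \<le> d \<Longrightarrow> inj_on (\<lambda>z. rp (ls j e z)) (cube j)"
        using Suc by auto
      define S where "S = (\<lambda>z. rp (ls d e z)) ` cube d"
      have "card S = p ^ d" unfolding S_def using inj[of d] by (simp add: card_image card_cube)
      also have "\<dots> < card (gf N)" using dk p1 card_gf[OF N2] by (simp add: N_def)
      finally have "\<not> gf N \<subseteq> S" using card_mono[of S "gf N"] finite_cube by (auto simp: S_def)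
      then obtain x where x: "x \<in> gf N" "x \<notin> S" by blast
      define e' where "e' = e(d := x)"
      have e': "e' i \<in> gf N" for i using e x by (simp add: e'_def)
      have ls': "ls j e' z = ls j e z" if "j \<le> d" for j z
        unfolding ls_def e'_def using that by (intro sum.cong) auto
      have lsS: "ls (Suc d) e' z = ls d e z + of_int (z d) * x" for z
        using ls'[of d z] by (simp add: ls_def e'_def)
      have xA: "x \<in> A" using gf_A[OF N x(1)] .
      have lsA: "ls d e z \<in> A" for z using fx_A[OF ls_fx[OF N e]] .
      have "inj_on (\<lambda>z. rp (ls (Suc d) e' z)) (cube (Suc d))"
      proof (rule inj_onI)
        fix z w assume zw: "z \<in> cube (Suc d)" "w \<in> cube (Suc d)" "rp (ls (Suc d) e' z) = rp (ls (Suc d) e' w)"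
        then have cg: "ls d e z + of_int (z d) * x \<doteq> ls d e w + of_int (w d) * x"
          using rp_ls_eq_iff[where e = e' and j = "Suc d" and z = z and w = w, OF N e'] by (simp add: lsS)
        have zd: "z d = w d"
        proof (rule ccontr)
          assume ne: "z d \<noteq> w d"
          \<comment> \<open>If the last coordinates differ, an inverse b of their difference modulo
            p expresses the new element x through the old ones, contrary to its choice outside their
            span.\<close>
          define c where "c = z d - w d"
          have "0 \<le> z d" "z d < int p" "0 \<le> w d" "w d < int p" using zw(1,2) by (auto simp: cube_def PiE_iff)
          then have "\<bar>c\<bar> < int p" "c \<noteq> 0" using ne by (auto simp: c_def)
          then have "\<not> int p dvd c" using zdvd_imp_le[of "int p" "\<bar>c\<bar>"] by auto
          then have "coprime (int p) c" using prime_p by (intro prime_imp_coprime) auto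
          then obtain a b where "a * int p + b * c = 1" by (metis bezout_int coprime_imp_gcd_eq_1)
          then have "b * c = 1 + (- a) * int p" by (simp add: algebra_simps)
          then have "(b * c) mod int p = 1 mod int p" by (metis mod_mult_self1)
          then have bc: "of_int (b * c) \<doteq> of_int 1" by (simp only: of_int_cg)
          define y where "y = (\<lambda>i\<in>{..<d}. (b * (w i - z i)) mod int p)"
          have yc: "y \<in> cube d" using p1 by (auto simp: y_def cube_def)
          have "of_int c * x \<doteq> ls d e w - ls d e z"
            using cg xA lsA by (simp add: cg_def c_def algebra_simps)
          then have "of_int b * (of_int c * x) \<doteq> of_int b * (ls d e w - ls d e z)"
            by (rule cg_mult[OF cg_refl, rotated]) auto
          also have "of_int b * (ls d e w - ls d e z) = ls d e (\<lambda>i. b * (w i - z i))"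
            by (simp add: ls_def sum_subtractf[symmetric] sum_distrib_left algebra_simps)
          also have "\<dots> \<doteq> ls d e y" by (rule ls_cg[OF N e]) (simp add: y_def)
          finally have "of_int (b * c) * x \<doteq> ls d e y" by (simp add: mult.assoc)
          moreover have "of_int 1 * x \<doteq> of_int (b * c) * x"
            by (rule cg_sym[OF cg_mult[OF bc cg_refl[OF xA]]])
          ultimately have "x \<doteq> ls d e y" using cg_trans[of "of_int 1 * x"] by simp
          then have "rp (ls d e y) = x" by (rule rp_eqI[OF gf_T[OF N x(1)]])
          then show False using x yc by (auto simp: S_def)
        qed
        then have "ls d e z \<doteq> ls d e w" using cg lsA by (simp add: cg_def)
        moreover have "ls d e (restrict z {..<d}) = ls d e z" for z
          unfolding ls_def by (intro sum.cong) auto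
        ultimately have "rp (ls d e (restrict z {..<d})) = rp (ls d e (restrict w {..<d}))" using rp_cg by simp
        moreover have "restrict z {..<d} \<in> cube d" "restrict w {..<d} \<in> cube d"
          using zw by (auto simp: cube_def PiE_iff)
        ultimately have eq: "restrict z {..<d} = restrict w {..<d}" using inj_onD[OF inj[OF order_refl]] by blast
        show "z = w"
        proof
          fix i
          consider "i < d" | "i = d" | "i > d" by linarith
          then show "z i = w i"
          proof cases
            case 1 then show ?thesis using fun_cong[OF eq, of i] by simp
          next
            case 2 then show ?thesis using zd by simp
          next
            case 3 then show ?thesis using zw by (auto simp: cube_def PiE_iff extensional_def)
          qed
        qed
      qed
      then have "inj_on (\<lambda>z. rp (ls j e' z)) (cube j)" if "j \<le> Suc d" for j
        using that inj[of j] ls'[of j] by (cases "j = Suc d") auto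
      then show "\<exists>e. (\<forall>i. e i \<in> gf N) \<and> (\<forall>j\<le>Suc d. inj_on (\<lambda>z. rp (ls j e z)) (cube j))"
        using e' by blast
    qed
  qed
  then show ?thesis unfolding N_def by blast
qed

end

section \<open>Realization in the elementary abelian group\<close>

lemma Zp_power_simps:
  assumes p: "p > 0"
  shows "carrier (Zp_power p k) = {..<k} \<rightarrow>\<^sub>E {0..<int p}"
    and "x \<otimes>\<^bsub>Zp_power p k\<^esub> y = (\<lambda>i\<in>{..<k}. (x i + y i) mod int p)"
    and "\<one>\<^bsub>Zp_power p k\<^esub> = (\<lambda>i\<in>{..<k}. 0)"
    and "group (Zp_power p k)"
proof -
  show "carrier (Zp_power p k) = {..<k} \<rightarrow>\<^sub>E {0..<int p}"
    using p by (simp add: Zp_power_def carrier_integer_mod_group)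
  show "x \<otimes>\<^bsub>Zp_power p k\<^esub> y = (\<lambda>i\<in>{..<k}. (x i + y i) mod int p)" "\<one>\<^bsub>Zp_power p k\<^esub> = (\<lambda>i\<in>{..<k}. 0)"
    "group (Zp_power p k)" by (simp_all add: Zp_power_def)
qed

context residue
begin

lemma rp_ls_add:
  assumes N: "ppow N" and e: "\<And>i. e i \<in> gf N"
    and u: "\<And>i. i < j \<Longrightarrow> u i mod int p = (z i + w i) mod int p"
  shows "rp (ls j e u) \<doteq> rp (ls j e z) + rp (ls j e w)"
proof -
  have "rp (ls j e u) \<doteq> ls j e u" by (rule rp_fx(2)[OF N ls_fx[where e = e, OF N e]])
  also have "\<dots> \<doteq> ls j e (\<lambda>i. z i + w i)" by (rule ls_cg[where e = e, OF N e u])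
  also have "\<dots> = ls j e z + ls j e w" by (simp add: ls_def distrib_right sum.distrib)
  also have "\<dots> \<doteq> rp (ls j e z) + rp (ls j e w)"
    by (intro cg_add cg_sym[OF rp_fx(2)[OF N ls_fx[where e = e, OF N e]]])
  finally show ?thesis .
qed

lemma rp_0: "rp 0 = 0"
  by (rule rp_T[OF T_closed(1)])

text \<open>A vector of length j + k is cut into its first j and last k entries, one block for each
  of the two fields.\<close>

lemma ls_shift_inj:
  assumes inj1: "inj_on (\<lambda>z. rp (ls j e z)) (cube j)" and inj2: "inj_on (\<lambda>z. rp (ls k e' z)) (cube k)"
  shows "inj_on (\<lambda>z. (rp (ls k e' (\<lambda>i. z (j + i))), rp (ls j e z))) (cube (j + k))"
proof (rule inj_onI)
  fix z w assume z: "z \<in> cube (j + k)" and w: "w \<in> cube (j + k)"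
    and eq: "(rp (ls k e' (\<lambda>i. z (j + i))), rp (ls j e z)) = (rp (ls k e' (\<lambda>i. w (j + i))), rp (ls j e w))"
  have r: "ls n f (restrict z {..<n}) = ls n f z" for n f and z :: "nat \<Rightarrow> int"
    unfolding ls_def by (intro sum.cong) auto
  have "restrict z {..<j} = restrict w {..<j}"
    by (rule inj_onD[OF inj1]) (use z w eq in \<open>auto simp: r cube_def PiE_iff\<close>)
  moreover have "(\<lambda>i\<in>{..<k}. z (j + i)) = (\<lambda>i\<in>{..<k}. w (j + i))"
    by (rule inj_onD[OF inj2]) (use z w eq in \<open>auto simp: r cube_def PiE_iff\<close>)
  ultimately have low: "\<And>i. i < j \<Longrightarrow> z i = w i" and high: "\<And>i. i < k \<Longrightarrow> z (j + i) = w (j + i)"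
    by (metis lessThan_iff restrict_apply')+
  show "z = w"
  proof
    fix i
    consider "i < j" | "j \<le> i" "i < j + k" | "i \<ge> j + k" by linarith
    then show "z i = w i"
    proof cases
      case 1 then show ?thesis by (rule low)
    next
      case 2 then show ?thesis using high[of "i - j"] by simp
    next
      case 3 then show ?thesis using z w by (auto simp: cube_def PiE_iff extensional_def)
    qed
  qed
qed

end

context field_pair
begin

text \<open>H is the span of the first j basis elements of the field with Q elements over the prime
  field.\<close>

lemma subgroup_exists:
  assumes je: "j \<le> e"
  shows "\<exists>H. field_pair_subgroup A M p e Q l H \<and> card H = p ^ j"
proof -
  obtain bs where bs: "\<And>i. bs i \<in> gf Q" and inj: "\<And>j. j \<le> e \<Longrightarrow> inj_on (\<lambda>z. rp (ls j bs z)) (cube j)"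
    using basis_exists[OF e_pos] by (auto simp: Q_eq)
  define H where "H = (\<lambda>z. rp (ls j bs z)) ` cube j"
  have p0: "p > 0" using prime_p by (rule prime_gt_0_nat)
  have lsfx: "ls j bs z \<in> fx Q" for z by (rule ls_fx[where e = bs, OF ppQ bs])
  have red: "rp w \<in> H" if "w \<doteq> ls j bs z" for w z
  proof -
    \<comment> \<open>Any integer combination can be reduced coordinatewise modulo p, which gives
      closure under sums and negatives at once.\<close>
    define y where "y = (\<lambda>i\<in>{..<j}. z i mod int p)"
    have "y \<in> cube j" using p0 by (auto simp: y_def cube_def)
    moreover have "w \<doteq> ls j bs y"
      using cg_trans[OF that ls_cg[where e = bs and j = j and z = z and w = y, OF ppQ bs]] by (simp add: y_def)
    ultimately show ?thesis using rp_cg by (auto simp: H_def)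
  qed
  have "field_pair_subgroup A M p e Q l H"
  proof (unfold_locales)
    show "H \<subseteq> gf Q" using rp_fx(1)[OF ppQ lsfx] by (auto simp: H_def)
    have "rp 0 \<in> H" by (rule red[where z = "\<lambda>_. 0"]) (simp add: ls_def)
    then show "0 \<in> H" by (simp add: rp_0)
    fix x assume x: "x \<in> H"
    then obtain z where z: "x = rp (ls j bs z)" by (auto simp: H_def)
    have xz: "x \<doteq> ls j bs z" unfolding z by (rule rp_fx(2)[OF ppQ lsfx])
    have "- x \<doteq> ls j bs (\<lambda>i. - z i)" using cg_minus[OF xz] by (simp add: ls_def sum_negf)
    then show "rp (- x) \<in> H" by (rule red)
    fix y assume y: "y \<in> H"
    then obtain w where w: "y = rp (ls j bs w)" by (auto simp: H_def)
    have yw: "y \<doteq> ls j bs w" unfolding w by (rule rp_fx(2)[OF ppQ lsfx])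
    have "x + y \<doteq> ls j bs (\<lambda>i. z i + w i)"
      using cg_add[OF xz yw] by (simp add: ls_def distrib_right sum.distrib)
    then show "rp (x + y) \<in> H" by (rule red)
  qed
  moreover have "card H = p ^ j" unfolding H_def using card_image[OF inj[OF je]] by (simp add: card_cube)
  ultimately show ?thesis by blast
qed

end

context field_pair_subgroup
begin

lemma eps_mult:
  assumes N: "ppow N" and x: "x \<in> gf N"
  shows "eps * x = rp (- x)"
proof -
  have xA: "x \<in> A" using gf_A[OF N x] .
  have "eps * x \<in> T" using T_closed(3) gf_T[OF ppj[OF l_pos] eps(1)[OF l_pos]] gf_T[OF N x] by blast
  moreover have "eps * x \<doteq> - 1 * x" by (rule cg_mult[OF eps(2) cg_refl[OF xA]])
  ultimately show ?thesis using rp_eqI[of "eps * x" "- x"] by simp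
qed

text \<open>The degrees differ by one, so the norm of -1 from the larger field is -1 times its norm
  from the smaller: negating (x, y) replaces h by -h, which lies in H again. This yields D =
  -D.\<close>

lemma Cx_neg:
  assumes "x \<in> Cx y"
  shows "eps * x \<in> Cx (eps * y)"
proof -
  obtain h where h: "h \<in> H" "Nm Q (Suc l) x = h * Nm Q l y" and x: "x \<in> gf (Q ^ Suc l)"
    using assms by (auto simp: Cx_def)
  have "eps ^ (Q ^ l) = eps" using eps(1)[OF l_pos] by (simp add: gf_def)
  then have "Nm Q (Suc l) eps = eps * Nm Q l eps" by (simp add: Nm_eq Pn_Suc power_add)
  then have "Nm Q (Suc l) (eps * x) = (eps * h) * Nm Q l (eps * y)" by (simp add: Nm_mult h)
  moreover have "eps * h \<in> H" using eps_mult[OF ppQ, of h] H_minus h H_subset by auto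
  moreover have "eps * x \<in> gf (Q ^ Suc l)" by (intro gf_closed eps x) simp
  ultimately show ?thesis unfolding Cx_def by blast
qed

lemma zero_Cx: "0 \<in> Cx y"
proof -
  have "Nm Q (Suc l) 0 = 0 * Nm Q l y" using Nm_0_iff[of "Suc l" 0] by simp
  then show ?thesis using H_zero zero_gfj[of "Suc l"] unfolding Cx_def by blast
qed

lemma Cx_zero: "Cx 0 = {0}"
proof -
  have "Nm Q l 0 = 0" using Nm_0_iff[OF l_pos] by simp
  then show ?thesis using zero_Cx[of 0] Nm_0_iff[of "Suc l"] by (auto simp: Cx_def)
qed

text \<open>A nontrivial character sums to 0 over the whole group, so its value on D is minus that
  on the complement: \<theta>1 and \<theta>2 are the negatives of the two values of
  \<open>Csum\<close>. The two nonemptiness claims allow \<lambda> and \<mu> to be read off as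
  actual counts later.\<close>

lemma pds_exists:
  fixes G v \<theta>1 \<theta>2
  defines "G \<equiv> Zp_power p (e * Suc l + e * l)"
    and "v \<equiv> real Q ^ Suc l * real Q ^ l"
    and "\<theta>1 \<equiv> (real (card H) - 1) * real (Pn (Suc l))"
    and "\<theta>2 \<equiv> (real (card H) - 1) * real (Pn (Suc l)) - real (card H) * real Q ^ l"
  obtains D where "D \<subseteq> carrier G" "\<one>\<^bsub>G\<^esub> \<notin> D" "D = m_inv G ` D" "D \<noteq> {}" "carrier G - D - {\<one>\<^bsub>G\<^esub>} \<noteq> {}"
    "group G" "finite (carrier G)" "Coset.order G = Q ^ Suc l * Q ^ l"
    "real (card D) = v - (real Q ^ l + (real (card H) - 1) * (real (Pn (Suc l)) * (real Q ^ l - 1)))"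
    "\<And>x. x \<in> carrier G \<Longrightarrow> x \<noteq> \<one>\<^bsub>G\<^esub> \<Longrightarrow> v * real (card (difference_reps G D x))
      = (if x \<in> D then v * (\<theta>1 + \<theta>2) else 0) + (real (card D) - \<theta>1) * (real (card D) - \<theta>2)"
proof -
  define k1 k2 n where "k1 = e * Suc l" and "k2 = e * l" and "n = Suc l"
  have p0: "p > 0" using prime_p by (rule prime_gt_0_nat)
  have k1: "p ^ k1 = Q ^ n" and k2: "p ^ k2 = Q ^ l" by (simp_all only: k1_def k2_def n_def Q_eq power_mult)
  have n0: "n > 0" by (simp add: n_def)
  have pp1: "ppow (Q ^ n)" and pp2: "ppow (Q ^ l)" using ppj n0 l_pos by auto
  have "k1 > 0" "k2 > 0" using e_pos l_pos by (auto simp: k1_def k2_def)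
  then obtain e1 e2 where e1: "\<And>i. e1 i \<in> gf (Q ^ n)" and inj1: "inj_on (\<lambda>z. rp (ls k1 e1 z)) (cube k1)"
    and e2: "\<And>i. e2 i \<in> gf (Q ^ l)" and inj2: "inj_on (\<lambda>z. rp (ls k2 e2 z)) (cube k2)"
    using basis_exists[of k1] basis_exists[of k2] k1 k2 by (metis order_refl)
  have G: "carrier G = cube (k1 + k2)" "\<And>x y. x \<otimes>\<^bsub>G\<^esub> y = (\<lambda>i\<in>{..<k1 + k2}. (x i + y i) mod int p)"
    "\<one>\<^bsub>G\<^esub> = (\<lambda>i\<in>{..<k1 + k2}. 0)" "group G"
    unfolding G_def using Zp_power_simps[OF p0] by (simp_all add: k1_def k2_def cube_def)
  interpret G: group G by (rule G)
  define f1 where "f1 = (\<lambda>z. rp (ls k1 e1 z))"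
  define f2 where "f2 = (\<lambda>z :: nat \<Rightarrow> int. rp (ls k2 e2 (\<lambda>i. z (k1 + i))))"
  have f1gf: "f1 z \<in> gf (Q ^ n)" for z
    unfolding f1_def by (rule rp_fx(1)[OF pp1 ls_fx[where e = e1, OF pp1 e1]])
  have f2gf: "f2 z \<in> gf (Q ^ l)" for z
    unfolding f2_def by (rule rp_fx(1)[OF pp2 ls_fx[where e = e2, OF pp2 e2]])
  have f1add: "f1 (x \<otimes>\<^bsub>G\<^esub> y) \<doteq> f1 x + f1 y" for x y
    unfolding f1_def G(2) by (rule rp_ls_add[where e = e1, OF pp1 e1]) simp
  have f2add: "f2 (x \<otimes>\<^bsub>G\<^esub> y) \<doteq> f2 x + f2 y" for x y
    unfolding f2_def G(2) by (rule rp_ls_add[where e = e2, OF pp2 e2]) simp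
  have f0: "f1 \<one>\<^bsub>G\<^esub> = 0" "f2 \<one>\<^bsub>G\<^esub> = 0"
    by (simp_all add: f1_def f2_def G(3) ls_def rp_0)
  \<comment> \<open>The identification of the group with the product of the two fields, additive in
    the sense of \<open>f1add\<close> and \<open>f2add\<close>. Surjectivity follows from
    injectivity by comparing cardinalities.\<close>
  define \<Phi> where "\<Phi> = (\<lambda>z. (f2 z, f1 z))"
  have injP: "inj_on \<Phi> (carrier G)"
    unfolding \<Phi>_def f1_def f2_def G(1) by (rule ls_shift_inj[OF inj1 inj2])
  have cardG: "card (carrier G) = Q ^ n * Q ^ l" unfolding G(1) card_cube power_add k1 k2 ..
  have finG: "finite (carrier G)" unfolding G(1) by (rule finite_cube)
  have imP: "\<Phi> ` carrier G = gf (Q ^ l) \<times> gf (Q ^ n)"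
  proof (rule card_subset_eq)
    show "finite (gf (Q ^ l) \<times> gf (Q ^ n))" using finite_gfj[OF l_pos] finite_gfj[OF n0] by blast
    show "\<Phi> ` carrier G \<subseteq> gf (Q ^ l) \<times> gf (Q ^ n)" using f1gf f2gf by (auto simp: \<Phi>_def)
    show "card (\<Phi> ` carrier G) = card (gf (Q ^ l) \<times> gf (Q ^ n))"
      using cardG card_image[OF injP] card_gfj[OF l_pos] card_gfj[OF n0] by (simp add: card_cartesian_product mult.commute)
  qed
  \<comment> \<open>The set whose character sums are known is B; D is its complement, so that the
    identity is excluded from D.\<close>
  define B where "B = {z \<in> carrier G. f1 z \<in> Cx (f2 z)}"
  define D where "D = carrier G - B"
  have DG: "D \<subseteq> carrier G" by (auto simp: D_def)
  have one: "\<one>\<^bsub>G\<^esub> \<notin> D" using zero_Cx[of 0] by (auto simp: D_def B_def f0)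
  have finv: "f1 (inv\<^bsub>G\<^esub> z) = eps * f1 z" "f2 (inv\<^bsub>G\<^esub> z) = eps * f2 z" if z: "z \<in> carrier G" for z
  proof -
    have zz: "z \<otimes>\<^bsub>G\<^esub> inv\<^bsub>G\<^esub> z = \<one>\<^bsub>G\<^esub>" using z by simp
    have neg: "b = rp (- a)" if "0 \<doteq> a + b" "b \<in> T" "a \<in> A" for a b
    proof -
      have "b \<doteq> - a" using cg_sym[OF that(1)] T_A[OF that(2)] that(3) by (simp add: cg_def add.commute)
      then show ?thesis using rp_eqI[OF that(2)] by simp
    qed
    have "0 \<doteq> f1 z + f1 (inv\<^bsub>G\<^esub> z)" using f1add[of z "inv\<^bsub>G\<^esub> z"] zz f0 by simp
    then show "f1 (inv\<^bsub>G\<^esub> z) = eps * f1 z"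
      using neg[of "f1 z"] gf_T[OF pp1 f1gf] gf_A[OF pp1 f1gf] eps_mult[OF pp1 f1gf] by simp
    have "0 \<doteq> f2 z + f2 (inv\<^bsub>G\<^esub> z)" using f2add[of z "inv\<^bsub>G\<^esub> z"] zz f0 by simp
    then show "f2 (inv\<^bsub>G\<^esub> z) = eps * f2 z"
      using neg[of "f2 z"] gf_T[OF pp2 f2gf] gf_A[OF pp2 f2gf] eps_mult[OF pp2 f2gf] by simp
  qed
  have Binv: "inv\<^bsub>G\<^esub> z \<in> B" if "z \<in> B" for z
    using that Cx_neg[of "f1 z" "f2 z"] by (auto simp: B_def finv)
  have Dinv: "inv\<^bsub>G\<^esub> z \<in> D" if "z \<in> D" for z
    using that Binv[of "inv\<^bsub>G\<^esub> z"] DG by (auto simp: D_def)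
  have sym: "D = m_inv G ` D"
  proof
    show "m_inv G ` D \<subseteq> D" using Dinv by blast
    show "D \<subseteq> m_inv G ` D"
    proof
      fix z assume z: "z \<in> D"
      then have "z = inv\<^bsub>G\<^esub> (inv\<^bsub>G\<^esub> z)" using DG by auto
      then show "z \<in> m_inv G ` D" using Dinv[OF z] by blast
    qed
  qed
  have sumG: "(\<Sum>z\<in>carrier G. F (f2 z) (f1 z)) = (\<Sum>y\<in>gf (Q ^ l). \<Sum>x\<in>gf (Q ^ n). F y x)" for F :: "complex \<Rightarrow> complex \<Rightarrow> complex"
  proof -
    have "(\<Sum>y\<in>gf (Q ^ l). \<Sum>x\<in>gf (Q ^ n). F y x) = (\<Sum>w\<in>gf (Q ^ l) \<times> gf (Q ^ n). F (fst w) (snd w))"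
      by (simp add: sum.cartesian_product case_prod_beta)
    also have "\<dots> = (\<Sum>z\<in>carrier G. F (f2 z) (f1 z))"
      unfolding imP[symmetric] sum.reindex[OF injP] by (simp add: \<Phi>_def comp_def)
    finally show ?thesis ..
  qed
  have sumB: "(\<Sum>z\<in>B. F (f2 z) (f1 z)) = (\<Sum>y\<in>gf (Q ^ l). \<Sum>x\<in>Cx y. F y x)" for F :: "complex \<Rightarrow> complex \<Rightarrow> complex"
  proof -
    have Cxsub: "Cx y \<subseteq> gf (Q ^ n)" for y by (auto simp: Cx_def n_def)
    have finC: "finite (Cx y)" for y using finite_subset[OF Cxsub finite_gfj[OF n0]] .
    have "\<Phi> ` B = (SIGMA y:gf (Q ^ l). Cx y)"
    proof (intro equalityI subsetI)
      fix w assume "w \<in> (SIGMA y:gf (Q ^ l). Cx y)"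
      then have w: "fst w \<in> gf (Q ^ l)" "snd w \<in> Cx (fst w)" by auto
      then have "w \<in> \<Phi> ` carrier G" unfolding imP using Cxsub by (cases w) auto
      then obtain z where z: "z \<in> carrier G" "w = (f2 z, f1 z)" by (auto simp: \<Phi>_def)
      then show "w \<in> \<Phi> ` B" using w by (auto simp: \<Phi>_def B_def)
    qed (use f2gf in \<open>auto simp: \<Phi>_def B_def\<close>)
    moreover have "inj_on \<Phi> B" using injP by (rule inj_on_subset) (auto simp: B_def)
    ultimately have "(\<Sum>w\<in>(SIGMA y:gf (Q ^ l). Cx y). F (fst w) (snd w)) = (\<Sum>z\<in>B. F (f2 z) (f1 z))"
      by (metis (mono_tags, lifting) \<Phi>_def comp_apply fst_conv snd_conv sum.cong sum.reindex)
    then show ?thesis using finC finite_gfj[OF l_pos] by (simp add: sum.Sigma case_prod_beta)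
  qed
  define chi where "chi = (\<lambda>w z. Psi n (snd w * f1 z) * Psi l (fst w * f2 z))"
  define I where "I = gf (Q ^ l) \<times> gf (Q ^ n)"
  have BG: "B \<subseteq> carrier G" by (auto simp: B_def)
  have sumD: "(\<Sum>z\<in>D. chi (b, a) z) = (\<Sum>y\<in>gf (Q ^ l). \<Sum>x\<in>gf (Q ^ n). Psi n (a * x) * Psi l (b * y)) - Csum a b" for a b
  proof -
    have "(\<Sum>z\<in>D. chi (b, a) z) = (\<Sum>z\<in>carrier G. chi (b, a) z) - (\<Sum>z\<in>B. chi (b, a) z)"
      unfolding D_def by (rule sum_diff[OF finG BG])
    also have "(\<Sum>z\<in>carrier G. chi (b, a) z) = (\<Sum>y\<in>gf (Q ^ l). \<Sum>x\<in>gf (Q ^ n). Psi n (a * x) * Psi l (b * y))"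
      unfolding chi_def using sumG[of "\<lambda>y x. Psi n (a * x) * Psi l (b * y)"] by simp
    also have "(\<Sum>z\<in>B. chi (b, a) z) = Csum a b"
      unfolding chi_def Csum_def using sumB[of "\<lambda>y x. Psi n (a * x) * Psi l (b * y)"] by (simp add: n_def)
    finally show ?thesis .
  qed
  have full: "(\<Sum>y\<in>gf (Q ^ l). \<Sum>x\<in>gf (Q ^ n). Psi n (a * x) * Psi l (b * y))
    = (if a = 0 \<and> b = 0 then of_nat (Q ^ n) * of_nat (Q ^ l) else 0)"
    if "a \<in> gf (Q ^ n)" "b \<in> gf (Q ^ l)" for a b
  proof -
    have "(\<Sum>y\<in>gf (Q ^ l). \<Sum>x\<in>gf (Q ^ n). Psi n (a * x) * Psi l (b * y))
      = (\<Sum>x\<in>gf (Q ^ n). Psi n (a * x)) * (\<Sum>y\<in>gf (Q ^ l). Psi l (b * y))"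
      by (simp add: sum_distrib_left sum_distrib_right)
    then show ?thesis using Psi_sum[OF n0 that(1)] Psi_sum[OF l_pos that(2)] by simp
  qed
  have cardD: "real (card D) = v - (real Q ^ l + (real (card H) - 1) * (real (Pn (Suc l)) * (real Q ^ l - 1)))"
  proof -
    have "(\<Sum>z\<in>D. chi (0, 0) z) = of_nat (card D)"
      using Psi_0[OF n0] Psi_0[OF l_pos] by (simp add: chi_def)
    then have "complex_of_nat (card D) = of_nat (Q ^ n) * of_nat (Q ^ l) - Csum 0 0"
      using sumD[of 0 0] full[of 0 0] by simp
    then have "complex_of_real (real (card D))
      = complex_of_real (v - (real Q ^ l + (real (card H) - 1) * (real (Pn (Suc l)) * (real Q ^ l - 1))))"
      by (simp add: Csum_trivial v_def n_def)
    then show ?thesis by (simp only: of_real_eq_iff)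
  qed
  have rep: "v * real (card (difference_reps G D x))
      = (if x \<in> D then v * (\<theta>1 + \<theta>2) else 0) + (real (card D) - \<theta>1) * (real (card D) - \<theta>2)"
    if x: "x \<in> carrier G" "x \<noteq> \<one>\<^bsub>G\<^esub>" for x
  proof -
    have ordG: "Coset.order G = Q ^ n * Q ^ l" unfolding Coset.order_def by (rule cardG)
    have "of_nat (Coset.order G) * of_nat (card (difference_reps G D x))
      = (if x \<in> D then of_nat (Coset.order G) * (complex_of_real \<theta>1 + complex_of_real \<theta>2) else 0)
        + (of_nat (card D) - complex_of_real \<theta>1) * (of_nat (card D) - complex_of_real \<theta>2)"
    proof (rule difference_count_characters[where chi = chi and I = I and ?i0.0 = "(0, 0)"])
      show "group G" "finite (carrier G)" "D \<subseteq> carrier G" "D = m_inv G ` D" by fact+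
      show "finite I" unfolding I_def using finite_gfj[OF l_pos] finite_gfj[OF n0] by blast
      show "(0, 0) \<in> I" by (simp add: I_def)
      show "card I = Coset.order G" unfolding ordG I_def
        using card_gfj[OF l_pos] card_gfj[OF n0] by (simp add: card_cartesian_product mult.commute)
      show "chi i (g \<otimes>\<^bsub>G\<^esub> h) = chi i g * chi i h" if "i \<in> I" for i g h
      proof -
        obtain b a where i: "i = (b, a)" "b \<in> gf (Q ^ l)" "a \<in> gf (Q ^ n)" using \<open>i \<in> I\<close> by (auto simp: I_def)
        show ?thesis
          using Psi_mult_add[OF n0 i(3) f1gf f1gf f1gf f1add] Psi_mult_add[OF l_pos i(2) f2gf f2gf f2gf f2add]
          by (simp add: chi_def i)
      qed
      show "chi i \<one>\<^bsub>G\<^esub> = 1" for i using Psi_0[OF n0] Psi_0[OF l_pos] by (simp add: chi_def f0)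
      show "chi (0, 0) g = 1" for g using Psi_0[OF n0] Psi_0[OF l_pos] by (simp add: chi_def)
      show "(\<Sum>i\<in>I. chi i g) = 0" if g: "g \<in> carrier G" "g \<noteq> \<one>\<^bsub>G\<^esub>" for g
      proof -
        have ne: "f1 g \<noteq> 0 \<or> f2 g \<noteq> 0"
        proof (rule ccontr)
          assume "\<not> ?thesis"
          then have "\<Phi> g = \<Phi> \<one>\<^bsub>G\<^esub>" by (simp add: \<Phi>_def f0)
          then show False using inj_onD[OF injP _ g(1)] g by fastforce
        qed
        have "(\<Sum>i\<in>I. chi i g) = (\<Sum>b\<in>gf (Q ^ l). \<Sum>a\<in>gf (Q ^ n). Psi n (f1 g * a) * Psi l (f2 g * b))"
          unfolding I_def chi_def by (simp add: sum.cartesian_product case_prod_beta mult.commute)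
        then show ?thesis using full[OF f1gf f2gf, of g g] ne by auto
      qed
      show "(\<Sum>d\<in>D. chi i d) \<in> {complex_of_real \<theta>1, complex_of_real \<theta>2}" if "i \<in> I" "i \<noteq> (0, 0)" for i
      proof -
        obtain b a where i: "i = (b, a)" "b \<in> gf (Q ^ l)" "a \<in> gf (Q ^ n)" using \<open>i \<in> I\<close> by (auto simp: I_def)
        have ab: "a \<noteq> 0 \<or> b \<noteq> 0" using \<open>i \<noteq> (0, 0)\<close> i by auto
        have "(\<Sum>d\<in>D. chi i d) = - Csum a b" using sumD[of b a] full[OF i(3) i(2)] ab by (auto simp: i)
        moreover have "Csum a b \<in> {- complex_of_real \<theta>1, - complex_of_real \<theta>2}"
          using Csum_nontrivial[OF _ i(2) ab] i(3) by (simp add: \<theta>1_def \<theta>2_def n_def algebra_simps)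
        ultimately show ?thesis by auto
      qed
      show "x \<in> carrier G" "x \<noteq> \<one>\<^bsub>G\<^esub>" by fact+
    qed
    then have "complex_of_real (v * real (card (difference_reps G D x)))
      = complex_of_real ((if x \<in> D then v * (\<theta>1 + \<theta>2) else 0) + (real (card D) - \<theta>1) * (real (card D) - \<theta>2))"
      by (simp add: v_def n_def ordG)
    then show ?thesis by (simp only: of_real_eq_iff)
  qed
  have surj: "\<exists>z\<in>carrier G. f1 z = x \<and> f2 z = y" if "x \<in> gf (Q ^ n)" "y \<in> gf (Q ^ l)" for x y
  proof -
    have "(y, x) \<in> \<Phi> ` carrier G" unfolding imP using that by simp
    then show ?thesis by (auto simp: \<Phi>_def)
  qed
  \<comment> \<open>The points (1, 0) and (0, 1) witness that D and its complement without the
    identity are nonempty, whatever H is.\<close>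
  obtain z where z: "z \<in> carrier G" "f1 z = 1" "f2 z = 0" using surj[of 1 0] gf_closed(2) zero_gfj by blast
  then have "z \<in> D" by (auto simp: D_def B_def Cx_zero)
  then have ne1: "D \<noteq> {}" by blast
  obtain z' where z': "z' \<in> carrier G" "f1 z' = 0" "f2 z' = 1" using surj[of 0 1] gf_closed(2) zero_gfj by blast
  then have "z' \<in> carrier G - D - {\<one>\<^bsub>G\<^esub>}" using zero_Cx f0 by (auto simp: D_def B_def)
  then have ne2: "carrier G - D - {\<one>\<^bsub>G\<^esub>} \<noteq> {}" by blast
  have ord: "Coset.order G = Q ^ Suc l * Q ^ l" unfolding Coset.order_def cardG n_def ..
  show ?thesis by (rule that[OF DG one sym ne1 ne2 G(4) finG ord cardD rep])
qed

end

section \<open>Evaluation of the parameters\<close>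

theorem theorem1p12:
  fixes p s q m l r :: nat
  assumes "prime p" and "s \<ge> 1" and "q = p ^ s"
    and "m \<ge> 1" and "l \<ge> 1" and "r \<le> m"
  defines "G \<equiv> Zp_power p (s * m * (2 * l + 1))"
  shows "\<exists>D v k lam mu.
      v = q ^ (m * (2 * l + 1)) \<and>
      real k =
        (real q ^ m - real q ^ (m - r)) * (real q ^ (m * l) - 1) * (real q ^ (m * (l + 1)) - 1)
          / (real q ^ m - 1)
        + real q ^ (m * (l + 1)) - 1 \<and>
      real lam =
        (real q ^ m - real q ^ (m - r)) * (real q ^ (m * (l + 1)) - 1)
          * (real q ^ (m * (l + 1)) - real q ^ (m * (l + 1) - r) + real q ^ (m - r) - 1)
          / (real q ^ m - 1)\<^sup>2
        + (real q ^ (m * (l + 2) - r) + real q ^ (m * (l + 1) - r)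
            - 2 * real q ^ (m * (l + 1)) - 2 * real q ^ (m - r) + 2)
          / (real q ^ m - 1) \<and>
      real mu =
        (real q ^ m - real q ^ (m - r)) * (real q ^ (m * (l + 1)) - 1)
          * (real q ^ (m * (l + 1)) - real q ^ (m * (l + 1) - r) + real q ^ (m - r) - 1)
          / (real q ^ m - 1)\<^sup>2 \<and>
      partial_difference_set G D v k lam mu \<and>
      D = m_inv G ` D \<and>
      strongly_regular_graph (cayley_graph G D) v k lam mu"
proof -
  obtain A M where res: "residue A M p" using exists_residue[OF \<open>prime p\<close>] by blast
  interpret residue A M p by (rule res)
  define e Q where "e = s * m" and "Q = p ^ e"
  have e0: "e > 0" using assms by (simp add: e_def)
  have qm: "q ^ m = Q" by (simp add: assms(3) Q_def e_def power_mult)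
  interpret field_pair A M p e Q l by unfold_locales (use e0 assms in \<open>auto simp: Q_def\<close>)
  \<comment> \<open>This exponent makes H have order p ^ j = q ^ (m - r), the number
    \<open>N\<close> in the parameter computations.\<close>
  define j where "j = s * (m - r)"
  have je: "j \<le> e" by (simp add: j_def e_def)
  obtain H where H: "field_pair_subgroup A M p e Q l H" and "card H = p ^ j"
    using subgroup_exists[OF je] by blast
  interpret field_pair_subgroup A M p e Q l H by (rule H)
  from \<open>card H = p ^ j\<close> have cH: "card H = q ^ (m - r)" by (simp add: j_def assms(3) power_mult)
  define N X where "N = real q ^ (m - r)" and "X = real Q ^ l"
  define Qr where "Qr = real Q"
  have Q1: "Qr > 1" using Q_ge_2 by (simp add: Qr_def)
  have X0: "X > 0" using Q1 by (simp add: X_def Qr_def)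
  have P: "real (Pn (Suc l)) = (Qr * X - 1) / (Qr - 1)"
  proof -
    have "real (Pn (Suc l) * (Q - 1)) = real (Q ^ Suc l - 1)" unfolding Pn_mult ..
    then have "real (Pn (Suc l)) * (Qr - 1) = Qr * X - 1"
      using Q_ge_2 by (simp add: of_nat_diff Qr_def X_def)
    then show ?thesis using Q1 by (simp add: field_simps)
  qed
  have Geq: "G = Zp_power p (e * Suc l + e * l)" 
  proof -
    have "s * m * (2 * l + 1) = e * Suc l + e * l" unfolding e_def by (simp add: algebra_simps)
    then show ?thesis by (simp only: G_def)
  qed
  define v' where "v' = Qr * X * X"
  define \<theta>1 where "\<theta>1 = (N - 1) * ((Qr * X - 1) / (Qr - 1))"
  define \<theta>2 where "\<theta>2 = \<theta>1 - N * X"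
  obtain D where D: "D \<subseteq> carrier G" "\<one>\<^bsub>G\<^esub> \<notin> D" "D = m_inv G ` D" "D \<noteq> {}" "carrier G - D - {\<one>\<^bsub>G\<^esub>} \<noteq> {}"
    "group G" "finite (carrier G)" "Coset.order G = Q ^ Suc l * Q ^ l"
    and cD: "real (card D) = v' - (X + (N - 1) * ((Qr * X - 1) / (Qr - 1) * (X - 1)))"
    and rep: "\<And>x. x \<in> carrier G \<Longrightarrow> x \<noteq> \<one>\<^bsub>G\<^esub> \<Longrightarrow> v' * real (card (difference_reps G D x))
      = (if x \<in> D then v' * (\<theta>1 + \<theta>2) else 0) + (real (card D) - \<theta>1) * (real (card D) - \<theta>2)"
  proof (rule pds_exists, goal_cases)
    case (1 D)
    show ?case
    proof (rule 1(1)[of D])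
      show "real (card D) = v' - (X + (N - 1) * ((Qr * X - 1) / (Qr - 1) * (X - 1)))"
        using 1(10) by (simp add: P cH v'_def N_def X_def Qr_def)
      show "v' * real (card (difference_reps G D x))
        = (if x \<in> D then v' * (\<theta>1 + \<theta>2) else 0) + (real (card D) - \<theta>1) * (real (card D) - \<theta>2)"
        if "x \<in> carrier G" "x \<noteq> \<one>\<^bsub>G\<^esub>" for x
        using 1(11)[of x] that by (simp add: Geq P cH v'_def N_def X_def Qr_def \<theta>1_def \<theta>2_def)
    qed (fact 1(2-9)[folded Geq])+
  qed
  \<comment> \<open>The closed form of (k - \<theta>1) * (k - \<theta>2) / v with k = card D, the
    part of the difference count common to all nonidentity elements; on D the count exceeds it by
    \<theta>1 + \<theta>2.\<close>
  define mu' where "mu' = (Qr - N) * (Qr * X - 1) * (Qr * X - N * X + N - 1) / (Qr - 1)\<^sup>2"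
  have v0: "v' > 0" using Q1 X0 by (simp add: v'_def)
  \<comment> \<open>The value of \<open>Pn (Suc l)\<close>, kept as a symbol together with
    \<open>PF\<close>, so that the identities below can be checked without denominators.\<close>
  define Pr where "Pr = (Qr * X - 1) / (Qr - 1)"
  have PF: "Pr * (Qr - 1) = Qr * X - 1" using Q1 by (simp add: Pr_def)
  have cD': "real (card D) = X * (Pr * (Qr - 1)) - (N - 1) * (Pr * (X - 1))"
    unfolding PF cD v'_def Pr_def[symmetric] by (simp add: algebra_simps)
  have D1: "real (card D) - \<theta>1 = X * (Qr - N) * Pr"
    unfolding cD' \<theta>1_def Pr_def[symmetric] by (simp add: algebra_simps)
  have D2: "(real (card D) - \<theta>2) * (Qr - 1) = Qr * X * (Qr * X - N * X + N - 1)"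
  proof -
    have "(real (card D) - \<theta>2) * (Qr - 1) = (real (card D) - \<theta>1 + N * X) * (Qr - 1)"
      by (simp add: \<theta>2_def)
    also have "\<dots> = X * (Qr - N) * (Pr * (Qr - 1)) + N * X * (Qr - 1)"
      unfolding D1 by (simp add: algebra_simps)
    finally show ?thesis unfolding PF by (simp add: algebra_simps)
  qed
  have mu_eq: "(real (card D) - \<theta>1) * (real (card D) - \<theta>2) = v' * mu'"
  proof -
    have "mu' * (Qr - 1)\<^sup>2 = (Qr - N) * (Qr * X - 1) * (Qr * X - N * X + N - 1)"
      using Q1 by (simp add: mu'_def)
    then have "v' * mu' * (Qr - 1)\<^sup>2
      = (X * (Qr - N) * (Pr * (Qr - 1))) * (Qr * X * (Qr * X - N * X + N - 1))"
      unfolding PF v'_def by (simp add: mult_ac)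
    also have "\<dots> = ((real (card D) - \<theta>1) * (real (card D) - \<theta>2)) * (Qr - 1)\<^sup>2"
      unfolding D1 D2[symmetric] by (simp add: power2_eq_square mult_ac)
    finally show ?thesis using Q1 by simp
  qed
  have val: "real (card (difference_reps G D x)) = (if x \<in> D then \<theta>1 + \<theta>2 else 0) + mu'"
    if "x \<in> carrier G" "x \<noteq> \<one>\<^bsub>G\<^esub>" for x
  proof -
    have "v' * real (card (difference_reps G D x)) = v' * ((if x \<in> D then \<theta>1 + \<theta>2 else 0) + mu')"
      unfolding rep[OF that] mu_eq by (simp add: distrib_left)
    then show ?thesis using v0 by simp
  qed
  \<comment> \<open>Taking \<lambda> and \<mu> to be the counts at one element inside and one
    outside D makes them natural numbers at once; integrality of the closed forms follows instead of
    having to be proved.\<close>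
  obtain d where d: "d \<in> D" using D by blast
  obtain c where c: "c \<in> carrier G" "c \<notin> D" "c \<noteq> \<one>\<^bsub>G\<^esub>" using D by blast
  define lam mu where "lam = card (difference_reps G D d)" and "mu = card (difference_reps G D c)"
  have dG: "d \<in> carrier G" "d \<noteq> \<one>\<^bsub>G\<^esub>" using d D by auto
  have lam: "real lam = \<theta>1 + \<theta>2 + mu'" using val[OF dG] d by (simp add: lam_def)
  have mu: "real mu = mu'" using val[OF c(1,3)] c by (simp add: mu_def)
  have v: "Coset.order G = q ^ (m * (2 * l + 1))"
  proof -
    have "q ^ (m * (2 * l + 1)) = Q ^ (2 * l + 1)" by (simp only: power_mult[of q m] qm)
    also have "\<dots> = Q ^ (Suc l + l)" by (rule arg_cong[of _ _ "power Q"]) simp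
    finally show ?thesis using D(8) by (simp only: power_add)
  qed
  have pds: "partial_difference_set G D (q ^ (m * (2 * l + 1))) (card D) lam mu"
    unfolding partial_difference_set_def
  proof (intro conjI ballI)
    fix x assume x: "x \<in> D"
    then have xG: "x \<in> carrier G" "x \<noteq> \<one>\<^bsub>G\<^esub>" using D by auto
    have "real (card (difference_reps G D x)) = real lam" using val[OF xG] x lam by simp
    then show "card (difference_reps G D x) = lam" by simp
  next
    fix x assume x: "x \<in> carrier G - D - {\<one>\<^bsub>G\<^esub>}"
    then have "real (card (difference_reps G D x)) = real mu" using val[of x] mu by simp
    then show "card (difference_reps G D x) = mu" by simp
  qed (use D v in auto)
  have qm': "real q ^ m = Qr" using qm by (simp add: Qr_def flip: of_nat_power)
  have e1: "real q ^ (m * l) = X" by (simp only: power_mult[of _ m] qm' X_def Qr_def)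
  have e2: "real q ^ (m * (l + 1)) = Qr * X" 
    by (simp only: power_mult[of _ m] qm' X_def Qr_def) simp
  have e3: "real q ^ (m * (l + 1) - r) = N * X"
  proof -
    have "m * (l + 1) - r = (m - r) + m * l" using assms by simp
    then show ?thesis by (simp only: power_add e1 N_def)
  qed
  have e4: "real q ^ (m * (l + 2) - r) = N * Qr * X"
  proof -
    have "m * (l + 2) - r = (m - r) + (m + m * l)" using assms by simp
    then show ?thesis by (simp only: power_add e1 N_def qm' mult.assoc)
  qed
  show ?thesis
  proof (intro exI conjI)
    show "q ^ (m * (2 * l + 1)) = q ^ (m * (2 * l + 1))" ..
    show "real (card D) = (real q ^ m - real q ^ (m - r)) * (real q ^ (m * l) - 1) * (real q ^ (m * (l + 1)) - 1)
        / (real q ^ m - 1) + real q ^ (m * (l + 1)) - 1"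
    proof -
      have "real (card D) = (Qr - N) * (X - 1) * Pr + Qr * X - 1"
        using cD' PF by (simp add: algebra_simps)
      then show ?thesis unfolding qm' e1 e2 N_def[symmetric] by (simp add: Pr_def)
    qed
    show "real mu = (real q ^ m - real q ^ (m - r)) * (real q ^ (m * (l + 1)) - 1)
          * (real q ^ (m * (l + 1)) - real q ^ (m * (l + 1) - r) + real q ^ (m - r) - 1)
          / (real q ^ m - 1)\<^sup>2"
      unfolding qm' e2 e3 N_def[symmetric] mu mu'_def ..
    show "real lam = (real q ^ m - real q ^ (m - r)) * (real q ^ (m * (l + 1)) - 1)
          * (real q ^ (m * (l + 1)) - real q ^ (m * (l + 1) - r) + real q ^ (m - r) - 1)
          / (real q ^ m - 1)\<^sup>2
        + (real q ^ (m * (l + 2) - r) + real q ^ (m * (l + 1) - r)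
            - 2 * real q ^ (m * (l + 1)) - 2 * real q ^ (m - r) + 2)
          / (real q ^ m - 1)"
    proof -
      have "\<theta>1 + \<theta>2 = (N * Qr * X + N * X - 2 * (Qr * X) - 2 * N + 2) / (Qr - 1)"
      proof -
        have "(\<theta>1 + \<theta>2) * (Qr - 1) = N * Qr * X + N * X - 2 * (Qr * X) - 2 * N + 2"
        proof -
          have "(\<theta>1 + \<theta>2) * (Qr - 1) = 2 * (N - 1) * (Pr * (Qr - 1)) - N * X * (Qr - 1)"
            unfolding \<theta>2_def \<theta>1_def Pr_def[symmetric] by (simp add: algebra_simps)
          then show ?thesis unfolding PF by (simp add: algebra_simps)
        qed
        then show ?thesis using Q1 by (simp add: nonzero_eq_divide_eq)
      qed
      then show ?thesis unfolding qm' e2 e3 e4 N_def[symmetric] lam mu'_def by simp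
    qed
    show "partial_difference_set G D (q ^ (m * (2 * l + 1))) (card D) lam mu" by (rule pds)
    show "D = m_inv G ` D" by (rule D)
    show "strongly_regular_graph (cayley_graph G D) (q ^ (m * (2 * l + 1))) (card D) lam mu"
      by (rule strongly_regular_cayley_graph[OF pds D(3)])
  qed
qed

end
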